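(* Let $\mathcal{U}$ be a finite collection of connected graphs each of which is both chordal and series-parallel. Then $\operatorname{trop}(\mathcal{N}_{\mathcal{U}})$ is a rational polyhedral cone.
   Context: All graphs are finite and simple. For graphs $H,G$, $\operatorname{hom}(H;G)$ is the number of graph homomorphisms from $H$ to $G$. For a finite collection $\mathcal{U}=\{H_1,\ldots,H_s\}$ of connected graphs, the number profile $\mathcal{N}_{\mathcal{U}}\subseteq\mathbb{Z}_{\geq 0}^s$ is the set of all vectors $(\operatorname{hom}(H_1;G),\ldots,\operatorname{hom}(H_s;G))$ as $G$ ranges over all graphs. For $S\subseteq\mathbb{R}^s_{\geq 0}$, let $\log(S)=\{(\ln x_1,\ldots,\ln x_s): \mathbf{x}\in S\cap\mathbb{R}^s_{>0}\}$; the tropicalization is $\operatorname{trop}(S)=\lim_{\tau\to\infty}\log(S)/\ln\tau$ (logarithmic limit set), which for sets closed under coordinatewise multiplication equals the closure of the conical hull of $\log(S)$. *)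

theory Defs
  imports "HOL-Analysis.Analysis" "Graph_Theory.Graph_Theory"
begin

text \<open>A finite simple graph is a \<open>pair_graph\<close>: a finite, loop-free, symmetric digraph without
  parallel arcs, every edge being represented by its two orientations.\<close>

definition homs :: "'a pair_pre_digraph \<Rightarrow> 'b pair_pre_digraph \<Rightarrow> ('a \<Rightarrow> 'b) set" where
  "homs H G = {f \<in> pverts H \<rightarrow>\<^sub>E pverts G. \<forall>(u, v) \<in> parcs H. (f u, f v) \<in> parcs G}"

definition hom :: "'a pair_pre_digraph \<Rightarrow> 'b pair_pre_digraph \<Rightarrow> nat" where
  "hom H G = card (homs H G)"

text \<open>A cycle is given by its list of arcs, so its length is that of the list and its vertices are
  the tails of its arcs. The back-and-forth walks along one edge, which the library counts as
  cycles, have length 2.\<close>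

definition chordal :: "'a pair_pre_digraph \<Rightarrow> bool" where
  "chordal G \<longleftrightarrow> (\<forall>c. pre_digraph.cycle (with_proj G) c \<and> 4 \<le> length c \<longrightarrow>
     (\<exists>u \<in> fst ` set c. \<exists>v \<in> fst ` set c.
        (u, v) \<in> parcs G \<and> (u, v) \<notin> set c \<and> (v, u) \<notin> set c))"

text \<open>\<open>B\<close> assigns to each vertex of \<open>K\<close> its branch set; contracting the branch sets gives a graph
  containing \<open>K\<close>. Connected graphs are nonempty in the library.\<close>

definition has_minor :: "'a pair_pre_digraph \<Rightarrow> 'b pair_pre_digraph \<Rightarrow> bool" where
  "has_minor G K \<longleftrightarrow> (\<exists>B :: 'b \<Rightarrow> 'a set.
     (\<forall>x \<in> pverts K. B x \<subseteq> pverts G \<and>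
        Digraph_Component.connected (induce_subgraph (with_proj G) (B x))) \<and>
     (\<forall>x \<in> pverts K. \<forall>y \<in> pverts K. x \<noteq> y \<longrightarrow> B x \<inter> B y = {}) \<and>
     (\<forall>(x, y) \<in> parcs K. \<exists>u \<in> B x. \<exists>v \<in> B y. (u, v) \<in> parcs G))"

text \<open>Series-parallel in the sense of graphs without \<open>K\<^sub>4\<close> minor; no terminals are prescribed, so
  that all trees are included.\<close>

definition series_parallel :: "'a pair_pre_digraph \<Rightarrow> bool" where
  "series_parallel G \<longleftrightarrow>
     \<not> (\<exists>K :: nat pair_pre_digraph. complete_digraph 4 (with_proj K) \<and> has_minor G K)"

text \<open>Every finite graph is isomorphic to one with vertices in \<open>nat\<close>. A collection
  \<open>H\<^sub>1, \<dots>, H\<^sub>s\<close> is a family indexed by a finite type.\<close>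

definition number_profile :: "('n::finite \<Rightarrow> 'a pair_pre_digraph) \<Rightarrow> (real ^ 'n) set" where
  "number_profile H = {\<chi> i. real (hom (H i) G) |G :: nat pair_pre_digraph. pair_graph G}"

definition log_set :: "(real ^ 'n::finite) set \<Rightarrow> (real ^ 'n) set" where
  "log_set S = (\<lambda>x. \<chi> i. ln (x $ i)) ` {x \<in> S. \<forall>i. 0 < x $ i}"

text \<open>The logarithmic limit set: all limits of points of \<open>log S / ln \<tau>\<close> along some \<open>\<tau> \<rightarrow> \<infinity>\<close>
  (the Painleve-Kuratowski upper limit). By \<open>trop_eq_lower_limit\<close> and \<open>trop_eq_closure_conic_hull\<close>
  below, for \<open>S\<close> closed under coordinatewise multiplication this is also the lower limit, and it is
  the closure of the conical hull of \<open>log S\<close>.\<close>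

definition trop :: "(real ^ 'n::finite) set \<Rightarrow> (real ^ 'n) set" where
  "trop S = {x. \<forall>e > 0. \<exists>\<^sub>F \<tau> in at_top. \<exists>y \<in> log_set S. dist (y /\<^sub>R ln \<tau>) x < e}"

definition rational_polyhedral_cone :: "(real ^ 'n::finite) set \<Rightarrow> bool" where
  "rational_polyhedral_cone C \<longleftrightarrow>
     (\<exists>A. finite A \<and> (\<forall>a \<in> A. \<forall>i. a $ i \<in> \<rat>) \<and> C = {x. \<forall>a \<in> A. 0 \<le> a \<bullet> x})"

definition mult_closed :: "(real ^ 'n::finite) set \<Rightarrow> bool" where
  "mult_closed S \<longleftrightarrow> (\<forall>x \<in> S. \<forall>y \<in> S. (\<chi> i. x $ i * y $ i) \<in> S)"

lemma log_set_add:
  assumes "mult_closed S" "x \<in> log_set S" "y \<in> log_set S"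
  shows "x + y \<in> log_set S"
proof -
  obtain a b where a: "a \<in> S" "\<And>i. 0 < a $ i" "x = (\<chi> i. ln (a $ i))"
    and b: "b \<in> S" "\<And>i. 0 < b $ i" "y = (\<chi> i. ln (b $ i))"
    using assms(2,3) by (auto simp: log_set_def)
  have "x + y = (\<chi> i. ln ((\<chi> i. a $ i * b $ i) $ i))"
    using a b(2,3) by (simp add: vec_eq_iff ln_mult less_imp_neq[symmetric])
  moreover have "(\<chi> i. a $ i * b $ i) \<in> {x \<in> S. \<forall>i. 0 < x $ i}"
    using assms(1) a b by (auto simp: mult_closed_def)
  ultimately show ?thesis unfolding log_set_def by blast
qed

lemma log_set_scale:
  assumes "mult_closed S" "x \<in> log_set S"
  shows "real (Suc k) *\<^sub>R x \<in> log_set S"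
proof (induction k)
  case (Suc k)
  have "real (Suc (Suc k)) *\<^sub>R x = x + real (Suc k) *\<^sub>R x"
    by (metis of_nat_Suc scaleR_add_left scaleR_one)
  then show ?case using log_set_add[OF assms Suc] by simp
qed (use assms in simp)

text \<open>Rescaling a point of \<open>log S\<close> by the integer \<open>\<lfloor>c ln \<tau>\<rfloor>\<close>.\<close>

lemma log_set_ray:
  assumes "mult_closed S" "y \<in> log_set S" "0 < c" "0 < e"
  shows "\<forall>\<^sub>F \<tau> in at_top. \<exists>z \<in> log_set S. dist (z /\<^sub>R ln \<tau>) (c *\<^sub>R y) < e"
proof -
  have lim: "((\<lambda>\<tau>. (of_int \<lfloor>c * ln \<tau>\<rfloor> / ln \<tau>) *\<^sub>R y) \<longlongrightarrow> c *\<^sub>R y) at_top"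
  proof (intro tendsto_intros)
    show "((\<lambda>\<tau>. of_int \<lfloor>c * ln \<tau>\<rfloor> / ln \<tau>) \<longlongrightarrow> c) at_top"
    proof (rule tendsto_sandwich)
      have ln: "\<forall>\<^sub>F \<tau> in at_top. 0 < ln (\<tau>::real)"
        using eventually_gt_at_top[of 1] by eventually_elim simp
      show "\<forall>\<^sub>F \<tau> in at_top. c - 1 / ln \<tau> \<le> of_int \<lfloor>c * ln \<tau>\<rfloor> / ln \<tau>"
        using ln
      proof eventually_elim
        case (elim \<tau>)
        have "c * ln \<tau> - 1 \<le> of_int \<lfloor>c * ln \<tau>\<rfloor>" by linarith
        then have "(c * ln \<tau> - 1) / ln \<tau> \<le> of_int \<lfloor>c * ln \<tau>\<rfloor> / ln \<tau>"
          using elim by (intro divide_right_mono) auto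
        with elim show ?case by (simp add: diff_divide_distrib)
      qed
      show "\<forall>\<^sub>F \<tau> in at_top. of_int \<lfloor>c * ln \<tau>\<rfloor> / ln \<tau> \<le> c"
        using ln by eventually_elim (simp add: field_simps)
      have "((\<lambda>\<tau>. c - 1 / ln \<tau>) \<longlongrightarrow> c - 0) at_top"
        by (intro tendsto_intros tendsto_divide_0[OF tendsto_const]
              filterlim_at_top_imp_at_infinity ln_at_top)
      then show "((\<lambda>\<tau>. c - 1 / ln \<tau>) \<longlongrightarrow> c) at_top" by simp
    qed simp
  qed
  have "\<forall>\<^sub>F \<tau> in at_top. 1 / c \<le> ln (\<tau>::real)"
    using ln_at_top by (simp add: filterlim_at_top)
  with tendstoD[OF lim \<open>0 < e\<close>] eventually_gt_at_top[of 1] show ?thesis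
  proof eventually_elim
    case (elim \<tau>)
    have "1 \<le> c * ln \<tau>" using elim(3) \<open>0 < c\<close> by (simp add: field_simps)
    then have "1 \<le> \<lfloor>c * ln \<tau>\<rfloor>" by simp
    then obtain k where "\<lfloor>c * ln \<tau>\<rfloor> = int (Suc k)"
      by (metis int_one_le_iff_zero_less pos_int_cases Suc_pred)
    then have "of_int \<lfloor>c * ln \<tau>\<rfloor> *\<^sub>R y \<in> log_set S"
      using log_set_scale[OF assms(1,2)] by (metis of_int_of_nat_eq)
    moreover have "(of_int \<lfloor>c * ln \<tau>\<rfloor> *\<^sub>R y) /\<^sub>R ln \<tau> = (of_int \<lfloor>c * ln \<tau>\<rfloor> / ln \<tau>) *\<^sub>R y"
      by (simp add: divide_inverse mult.commute)
    ultimately show ?case using elim(1) by metis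
  qed
qed

lemma trop_eq_lower_limit:
  assumes "mult_closed S"
  shows "trop S = {x. \<forall>e > 0. \<forall>\<^sub>F \<tau> in at_top. \<exists>y \<in> log_set S. dist (y /\<^sub>R ln \<tau>) x < e}"
proof (intro set_eqI iffI)
  fix x assume x: "x \<in> trop S"
  have "\<forall>\<^sub>F \<tau> in at_top. \<exists>y \<in> log_set S. dist (y /\<^sub>R ln \<tau>) x < e" if "0 < e" for e
  proof -
    have "\<exists>\<^sub>F \<tau> in at_top. \<exists>y \<in> log_set S. dist (y /\<^sub>R ln \<tau>) x < e / 2"
      using x half_gt_zero[OF \<open>0 < e\<close>] unfolding trop_def by blast
    from frequently_eventually_frequently[OF this eventually_gt_at_top[of 1]]
    obtain \<tau> y where y: "y \<in> log_set S" "dist (y /\<^sub>R ln \<tau>) x < e / 2" "1 < \<tau>"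
      by (auto dest!: frequently_ex)
    have "\<forall>\<^sub>F \<sigma> in at_top. \<exists>z \<in> log_set S. dist (z /\<^sub>R ln \<sigma>) (inverse (ln \<tau>) *\<^sub>R y) < e / 2"
      using y \<open>0 < e\<close> by (intro log_set_ray[OF assms]) auto
    then show ?thesis
      by eventually_elim (metis y(2) dist_triangle_half_r dist_commute)
  qed
  then show "x \<in> {x. \<forall>e > 0. \<forall>\<^sub>F \<tau> in at_top. \<exists>y \<in> log_set S. dist (y /\<^sub>R ln \<tau>) x < e}" by simp
qed (auto simp: trop_def intro!: eventually_frequently)

lemma trop_eq_closure_conic_hull:
  assumes S: "mult_closed S" and ne: "log_set S \<noteq> {}"
  shows "trop S = closure (convex_cone hull (log_set S))"
proof (intro subset_antisym subsetI)
  fix x assume x: "x \<in> trop S"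
  show "x \<in> closure (convex_cone hull (log_set S))"
    unfolding closure_approachable
  proof (intro allI impI)
    fix e :: real assume "0 < e"
    then have "\<exists>\<^sub>F \<tau> in at_top. \<exists>y \<in> log_set S. dist (y /\<^sub>R ln \<tau>) x < e"
      using x by (simp add: trop_def)
    from frequently_eventually_frequently[OF this eventually_gt_at_top[of 1]]
    obtain \<tau> y where y: "y \<in> log_set S" "dist (y /\<^sub>R ln \<tau>) x < e" "1 < \<tau>"
      by (auto dest!: frequently_ex)
    moreover have "y /\<^sub>R ln \<tau> \<in> convex_cone hull (log_set S)"
      using y by (intro convex_cone_hull_mul hull_inc) auto
    ultimately show "\<exists>y \<in> convex_cone hull (log_set S). dist y x < e" by blast
  qed
next
  let ?L = "log_set S"
  have add: "x + y \<in> trop S" if "x \<in> trop S" "y \<in> trop S" for x y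
    unfolding trop_eq_lower_limit[OF S]
  proof (intro CollectI allI impI)
    fix e :: real assume "0 < e"
    with that have "\<forall>\<^sub>F \<tau> in at_top. \<exists>z \<in> ?L. dist (z /\<^sub>R ln \<tau>) x < e / 2"
      "\<forall>\<^sub>F \<tau> in at_top. \<exists>z \<in> ?L. dist (z /\<^sub>R ln \<tau>) y < e / 2"
      using half_gt_zero[OF \<open>0 < e\<close>] unfolding trop_eq_lower_limit[OF S] by blast+
    then show "\<forall>\<^sub>F \<tau> in at_top. \<exists>z \<in> ?L. dist (z /\<^sub>R ln \<tau>) (x + y) < e"
    proof eventually_elim
      case (elim \<tau>)
      then obtain a b where ab: "a \<in> ?L" "b \<in> ?L"
        "dist (a /\<^sub>R ln \<tau>) x < e / 2" "dist (b /\<^sub>R ln \<tau>) y < e / 2" by blast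
      have "dist ((a + b) /\<^sub>R ln \<tau>) (x + y) \<le> dist (a /\<^sub>R ln \<tau>) x + dist (b /\<^sub>R ln \<tau>) y"
        unfolding scaleR_add_right by (rule dist_triangle_add)
      with ab log_set_add[OF S ab(1,2)] show ?case by (intro bexI[of _ "a + b"]) auto
    qed
  qed
  have closed: "x \<in> trop S" if x: "x \<in> closure (trop S)" for x
    unfolding trop_eq_lower_limit[OF S]
  proof (intro CollectI allI impI)
    fix e :: real assume "0 < e"
    then obtain y where y: "y \<in> trop S" "dist y x < e / 2"
      using x unfolding closure_approachable by (meson half_gt_zero)
    then have "\<forall>\<^sub>F \<tau> in at_top. \<exists>z \<in> ?L. dist (z /\<^sub>R ln \<tau>) y < e / 2"
      using half_gt_zero[OF \<open>0 < e\<close>] unfolding trop_eq_lower_limit[OF S] by blast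
    then show "\<forall>\<^sub>F \<tau> in at_top. \<exists>z \<in> ?L. dist (z /\<^sub>R ln \<tau>) x < e"
      by eventually_elim (metis y(2) dist_triangle_half_r dist_commute)
  qed
  have ray: "c *\<^sub>R y \<in> trop S" if "y \<in> ?L" "0 < c" for y c
    using log_set_ray[OF S that] by (simp add: trop_eq_lower_limit[OF S])
  have pos: "c *\<^sub>R x \<in> trop S" if "x \<in> trop S" "0 < c" for x c
  proof (rule closed, unfold closure_approachable, intro allI impI)
    fix e :: real assume "0 < e"
    then have "\<exists>\<^sub>F \<tau> in at_top. \<exists>y \<in> ?L. dist (y /\<^sub>R ln \<tau>) x < e / c"
      using that by (simp add: trop_def)
    from frequently_eventually_frequently[OF this eventually_gt_at_top[of 1]]
    obtain \<tau> y where y: "y \<in> ?L" "dist (y /\<^sub>R ln \<tau>) x < e / c" "1 < \<tau>"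
      by (auto dest!: frequently_ex)
    have "dist (c *\<^sub>R (y /\<^sub>R ln \<tau>)) (c *\<^sub>R x) = c * dist (y /\<^sub>R ln \<tau>) x"
      using \<open>0 < c\<close> unfolding dist_norm scaleR_diff_right[symmetric] by simp
    also have "\<dots> < e"
      using y(2) \<open>0 < c\<close> by (simp only: pos_less_divide_eq mult.commute)
    finally have "dist (c *\<^sub>R (y /\<^sub>R ln \<tau>)) (c *\<^sub>R x) < e" .
    moreover have "c *\<^sub>R (y /\<^sub>R ln \<tau>) \<in> trop S"
      using ray[OF y(1), of "c / ln \<tau>"] y \<open>0 < c\<close> by (simp add: divide_inverse)
    ultimately show "\<exists>y \<in> trop S. dist y (c *\<^sub>R x) < e" by blast
  qed
  have zero: "0 \<in> trop S"
  proof -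
    obtain y where "y \<in> ?L" using ne by blast
    show ?thesis
    proof (rule closed, unfold closure_approachable, intro allI impI)
      fix e :: real assume "0 < e"
      define c where "c = e / (norm y + 1)"
      have "0 < c" using \<open>0 < e\<close> by (simp add: c_def add_nonneg_pos)
      moreover have "norm (c *\<^sub>R y) < e"
        using \<open>0 < e\<close> by (simp add: c_def divide_less_eq add_nonneg_pos)
      ultimately show "\<exists>y \<in> trop S. dist y 0 < e"
        using ray[OF \<open>y \<in> ?L\<close>] by (metis dist_0_norm dist_commute)
    qed
  qed
  have "convex_cone (trop S)"
    unfolding convex_cone_iff
    using add pos zero by (metis order_le_less scaleR_zero_left)
  moreover have "?L \<subseteq> trop S" using ray[of _ 1] by auto
  ultimately have "convex_cone hull ?L \<subseteq> trop S" by (simp add: hull_minimal)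
  then show "x \<in> trop S" if "x \<in> closure (convex_cone hull ?L)" for x
    using that closure_mono closed by blast
qed

text \<open>The tensor product of \<open>G\<close> and \<open>G'\<close>, relabelled by \<open>prod_encode\<close>.\<close>

lemma number_profile_mult_closed:
  fixes H :: "'n::finite \<Rightarrow> 'a pair_pre_digraph"
  assumes H: "\<And>i. pair_graph (H i)"
  shows "mult_closed (number_profile H)"
  unfolding mult_closed_def
proof (intro ballI)
  fix x y assume "x \<in> number_profile H" "y \<in> number_profile H"
  then obtain G G' :: "nat pair_pre_digraph" where
    G: "pair_graph G" "x = (\<chi> i. real (hom (H i) G))" and
    G': "pair_graph G'" "y = (\<chi> i. real (hom (H i) G'))"
    by (auto simp: number_profile_def)
  interpret G: pair_graph G by (rule G)
  interpret G': pair_graph G' by (rule G')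
  define P where "P = \<lparr>pverts = prod_encode ` (pverts G \<times> pverts G'),
    parcs = {(prod_encode (u, u'), prod_encode (v, v')) |u u' v v'.
      (u, v) \<in> parcs G \<and> (u', v') \<in> parcs G'}\<rparr>"
  have inj: "prod_encode a = prod_encode b \<longleftrightarrow> a = b" for a b
    by (metis prod_encode_inverse)
  have P: "pair_graph P"
  proof
    have "parcs P \<subseteq> pverts P \<times> pverts P"
      unfolding P_def by (auto dest: G.in_arcsD1 G.in_arcsD2 G'.in_arcsD1 G'.in_arcsD2)
    then show "\<And>e. e \<in> parcs P \<Longrightarrow> fst e \<in> pverts P" "\<And>e. e \<in> parcs P \<Longrightarrow> snd e \<in> pverts P"
      by auto
    show fin: "finite (pverts P)"
      by (simp add: P_def G.pair_finite_verts G'.pair_finite_verts)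
    show "finite (parcs P)"
      using \<open>parcs P \<subseteq> _\<close> fin finite_subset by blast
    show "symmetric (with_proj P)"
      using G.pair_sym_arcs G'.pair_sym_arcs
      unfolding symmetric_def with_proj_simps sym_def P_def by auto
    show "fst e \<noteq> snd e" if "e \<in> parcs P" for e
      using that G.pair_no_loops by (fastforce simp: P_def inj)
  qed
  have "hom (H i) P = hom (H i) G * hom (H i) G'" for i
  proof -
    interpret Hi: pair_graph "H i" by (rule H)
    let ?V = "pverts (H i)"
    let ?f = "\<lambda>(f, g). \<lambda>v \<in> ?V. prod_encode (f v, g v)"
    let ?p = "\<lambda>h. (\<lambda>v \<in> ?V. fst (prod_decode (h v)), \<lambda>v \<in> ?V. snd (prod_decode (h v)))"
    have arc: "u \<in> ?V" "v \<in> ?V" if "(u, v) \<in> parcs (H i)" for u v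
      using that Hi.in_arcsD1 Hi.in_arcsD2 by auto
    have arcP: "(a, b) \<in> parcs P \<longleftrightarrow>
        (fst (prod_decode a), fst (prod_decode b)) \<in> parcs G \<and>
        (snd (prod_decode a), snd (prod_decode b)) \<in> parcs G'" for a b
    proof -
      obtain p q p' q' where "a = prod_encode (p, q)" "b = prod_encode (p', q')"
        by (metis prod_decode_inverse surj_pair)
      then show ?thesis by (simp add: P_def inj)
    qed
    have vertP: "a \<in> pverts P \<longleftrightarrow>
        fst (prod_decode a) \<in> pverts G \<and> snd (prod_decode a) \<in> pverts G'" for a
    proof -
      obtain p q where "a = prod_encode (p, q)"
        by (metis prod_decode_inverse surj_pair)
      then show ?thesis by (auto simp: P_def inj)
    qed
    have "bij_betw ?f (homs (H i) G \<times> homs (H i) G') (homs (H i) P)"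
    proof (rule bij_betwI[where g = ?p])
      show "?f \<in> homs (H i) G \<times> homs (H i) G' \<rightarrow> homs (H i) P"
        by (auto simp: homs_def arc arcP vertP PiE_iff)
      show "?p \<in> homs (H i) P \<rightarrow> homs (H i) G \<times> homs (H i) G'"
        by (auto simp: homs_def arc arcP vertP PiE_iff)
      show "?p (?f fg) = fg" if "fg \<in> homs (H i) G \<times> homs (H i) G'" for fg
        using that by (auto simp: homs_def PiE_iff extensional_def fun_eq_iff)
      show "?f (?p h) = h" if "h \<in> homs (H i) P" for h
        using that by (auto simp: homs_def PiE_iff extensional_def fun_eq_iff)
    qed
    from bij_betw_same_card[OF this] show ?thesis
      unfolding hom_def card_cartesian_product by (rule sym)
  qed
  then have "(\<chi> i. x $ i * y $ i) = (\<chi> i. real (hom (H i) P))"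
    by (simp add: G G' vec_eq_iff)
  with P show "(\<chi> i. x $ i * y $ i) \<in> number_profile H"
    unfolding number_profile_def by blast
qed

text \<open>All \<open>hom (H i) G\<close> are positive for a large complete graph \<open>G\<close>.\<close>

lemma log_set_number_profile_nonempty:
  fixes H :: "'n::finite \<Rightarrow> 'a pair_pre_digraph"
  assumes H: "\<And>i. pair_graph (H i)"
  shows "log_set (number_profile H) \<noteq> {}"
proof -
  define N where "N = (\<Sum>i\<in>UNIV. card (pverts (H i)))"
  define G :: "nat pair_pre_digraph" where
    "G = \<lparr>pverts = {..<N}, parcs = {(u, v). u < N \<and> v < N \<and> u \<noteq> v}\<rparr>"
  have "complete_digraph N (with_proj G)"
    by (auto simp: complete_digraph_pair_def G_def)
  then have G: "pair_graph G" by (rule pair_graphI_complete)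
  have "0 < hom (H i) G" for i
  proof -
    interpret Hi: pair_graph "H i" by (rule H)
    have "card (pverts (H i)) \<le> card {..<N}"
      unfolding N_def card_lessThan by (rule member_le_sum) auto
    then obtain f where f: "f ` pverts (H i) \<subseteq> {..<N}" "inj_on f (pverts (H i))"
      using card_le_inj[OF Hi.pair_finite_verts] by blast
    have "restrict f (pverts (H i)) \<in> homs (H i) G"
      unfolding homs_def
    proof (intro CollectI conjI ballI, goal_cases)
      case 1
      show ?case using f(1) by (auto simp: G_def)
    next
      case (2 e)
      then obtain u v where e: "e = (u, v)" "(u, v) \<in> parcs (H i)" by (metis surj_pair)
      then have uv: "u \<in> pverts (H i)" "v \<in> pverts (H i)" "u \<noteq> v"
        using Hi.in_arcsD1 Hi.in_arcsD2 Hi.pair_no_loops by (blast, blast, force)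
      then have "f u \<noteq> f v" using f(2) by (simp add: inj_on_eq_iff)
      with uv f(1) show ?case by (auto simp: e G_def)
    qed
    moreover have "finite (homs (H i) G)"
    proof (rule finite_subset)
      show "homs (H i) G \<subseteq> pverts (H i) \<rightarrow>\<^sub>E pverts G" by (auto simp: homs_def)
      show "finite (pverts (H i) \<rightarrow>\<^sub>E pverts G)"
        by (intro finite_PiE Hi.pair_finite_verts) (simp add: G_def)
    qed
    ultimately show ?thesis unfolding hom_def by (auto simp: card_gt_0_iff)
  qed
  with G have "(\<chi> i. real (hom (H i) G)) \<in> {x \<in> number_profile H. \<forall>i. 0 < x $ i}"
    unfolding number_profile_def by auto
  then show ?thesis unfolding log_set_def by blast
qed

corollary trop_number_profile:
  assumes "\<And>i. pair_graph (H i)"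
  shows "trop (number_profile H) = closure (convex_cone hull (log_set (number_profile H)))"
  by (rule trop_eq_closure_conic_hull[OF number_profile_mult_closed[OF assms]
        log_set_number_profile_nonempty[OF assms]])

end

theory Submission
  imports Defs "HOL-Real_Asymp.Real_Asymp"
begin

text \<open>For a function \<open>q\<close> on the cliques of a chordal graph \<open>H\<close> let \<open>L\<^sub>H(q)\<close> be the sum of
  \<open>q (K \<union> {w}) - q K\<close> over the vertices \<open>w\<close> of a perfect elimination ordering, \<open>K\<close> being the set of
  later neighbours of \<open>w\<close>. The tropicalization turns out to be the cone of all \<open>y\<close> for which there
  are polymatroids \<open>p\<^sub>j\<close> on the cliques of \<open>H\<^sub>j\<close> with \<open>y\<^sub>j \<le> L\<^sub>H\<^sub>j(p\<^sub>j)\<close> and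
  \<open>L\<^sub>H\<^sub>i(p\<^sub>j \<circ> \<phi>) \<le> y\<^sub>i\<close> for all homomorphisms \<open>\<phi>\<close> from \<open>H\<^sub>i\<close> to \<open>H\<^sub>j\<close>. This is a projection of a rational
  polyhedral cone.

  For a target graph \<open>G\<close>, the entropies of the marginals of a uniform homomorphism from \<open>H\<^sub>j\<close> to \<open>G\<close> are
  such polymatroids: the first inequality is the chain rule, and the second one holds because
  the marginals pulled back along \<open>\<phi>\<close> glue to a Markov distribution on the homomorphisms from \<open>H\<^sub>i\<close>
  to \<open>G\<close> with entropy \<open>L\<^sub>H\<^sub>i(p\<^sub>j \<circ> \<phi>)\<close>.

  Conversely, an integral polymatroid on the cliques of a \<open>K\<^sub>4\<close>-free chordal graph \<open>H\<close> is realised by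
  sets of coordinates on the vertices, where on each triangle some coordinates are sums of two
  others. Letting the free coordinates range over an interval of length \<open>n\<close> gives a blow-up of \<open>H\<close>, and
  Behrend's trick passes to a subgraph of density \<open>n\<^sup>-\<^sup>o\<^sup>(\<^sup>1\<^sup>)\<close> whose triangles all satisfy these linear
  relations. Its homomorphism counts have the required exponents, and a disjoint union over \<open>j\<close>
  realises the maximum over \<open>j\<close>.\<close>

section \<open>Perfect elimination orderings of chordal graphs\<close>

text \<open>Cliques of at most three vertices are what makes every polymatroid usable: on four
  elements some violate the Zhang-Yeung inequality and are not even limits of scaled entropy
  functions. On three elements, free coordinates alone do not suffice either: if single elements
  have rank 1 and all larger sets have rank 2, the co-information is -1, whereas for coordinate sets
  it is the size of the common intersection. Sums of two coordinates repair this, but they create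
  the main obstacle. An edge of a blow-up sees two vertices at a time, so a triangle may combine
  edges of three different valuations, violate its sum relation and produce too many homomorphisms.
  Behrend's trick excludes such triangles, at the cost of a power of the range \<open>n\<close> that
  depends only on the graph. Therefore the polymatroid is multiplied by \<open>k\<close> and the
  range is \<open>n = k\<close>: the count of valuations has logarithm of order
  \<open>k ln k\<close>, while the number of level classes is polynomial in \<open>k\<close>. Sums
  also enlarge the range by a constant factor, which costs a factor exponential in \<open>k\<close>.
  Both losses vanish on division by \<open>k ln k\<close>.\<close>

lemma pair_graph_sym: "pair_graph H \<Longrightarrow> (u, v) \<in> parcs H \<Longrightarrow> (v, u) \<in> parcs H"
proof -
  assume H: "pair_graph H" "(u, v) \<in> parcs H"
  interpret pair_graph H by fact
  have "sym (parcs H)" using pair_sym_arcs by (simp add: symmetric_def)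
  then show ?thesis using H(2) by (rule symD)
qed

lemma pair_graph_irrefl: "pair_graph H \<Longrightarrow> (u, u) \<notin> parcs H"
proof -
  assume H: "pair_graph H"
  interpret pair_graph H by fact
  show ?thesis using pair_no_loops[of "(u, u)"] by auto
qed

lemma pair_graph_verts:
  assumes "pair_graph H" "(u, v) \<in> parcs H"
  shows "u \<in> pverts H" "v \<in> pverts H"
proof -
  interpret pair_graph H by fact
  show "u \<in> pverts H" "v \<in> pverts H" by (rule in_arcsD1[OF assms(2)], rule in_arcsD2[OF assms(2)])
qed

lemma pair_graph_finite: "pair_graph H \<Longrightarrow> finite (pverts H)"
proof -
  assume H: "pair_graph H"
  interpret pair_graph H by fact
  show ?thesis by (rule pair_finite_verts)
qed

lemma finite_homs:
  assumes "pair_graph H" "pair_graph G"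
  shows "finite (homs H G)"
  by (rule finite_subset[of _ "pverts H \<rightarrow>\<^sub>E pverts G"])
     (auto simp: homs_def intro!: finite_PiE pair_graph_finite[OF assms(1)] pair_graph_finite[OF assms(2)])

definition clique :: "'a pair_pre_digraph \<Rightarrow> 'a set \<Rightarrow> bool" where
  "clique H S \<longleftrightarrow> S \<subseteq> pverts H \<and> (\<forall>u \<in> S. \<forall>v \<in> S. u \<noteq> v \<longrightarrow> (u, v) \<in> parcs H)"

definition nbrs :: "'a pair_pre_digraph \<Rightarrow> 'a set \<Rightarrow> 'a \<Rightarrow> 'a set" where
  "nbrs H W w = {u \<in> W. (w, u) \<in> parcs H}"

fun peo :: "'a pair_pre_digraph \<Rightarrow> 'a list \<Rightarrow> bool" where
  "peo H [] \<longleftrightarrow> True"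
| "peo H (w # vs) \<longleftrightarrow> w \<in> pverts H \<and> w \<notin> set vs \<and> clique H (nbrs H (set vs) w) \<and> peo H vs"

text \<open>The junction tree formula. For the entropies of consistent clique marginals it is the
  entropy of their Markov extension to all of \<open>H\<close>.\<close>

fun chain_rank :: "'a pair_pre_digraph \<Rightarrow> ('a set \<Rightarrow> real) \<Rightarrow> 'a list \<Rightarrow> real" where
  "chain_rank H q [] = 0"
| "chain_rank H q (w # vs) =
     q (insert w (nbrs H (set vs) w)) - q (nbrs H (set vs) w) + chain_rank H q vs"

lemma clique_subset: "clique H S \<Longrightarrow> T \<subseteq> S \<Longrightarrow> clique H T"
  by (auto simp: clique_def)

lemma peo_subset: "peo H vs \<Longrightarrow> set vs \<subseteq> pverts H"
  by (induction vs) auto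

lemma clique_insert_nbrs:
  assumes H: "pair_graph H" "peo H (w # vs)"
  shows "clique H (insert w (nbrs H (set vs) w))"
proof -
  have K: "clique H (nbrs H (set vs) w)" "w \<in> pverts H" using H(2) by auto
  have "(w, u) \<in> parcs H \<and> (u, w) \<in> parcs H" if "u \<in> nbrs H (set vs) w" for u
    using that pair_graph_sym[OF H(1), of w u] by (simp add: nbrs_def)
  with K show ?thesis unfolding clique_def by blast
qed

section \<open>Shortest walks and chordless cycles\<close>

definition walk_through :: "'a rel \<Rightarrow> 'a set \<Rightarrow> nat \<Rightarrow> (nat \<Rightarrow> 'a) \<Rightarrow> bool" where
  "walk_through E C n f \<longleftrightarrow> (\<forall>i<n. (f i, f (Suc i)) \<in> E) \<and> (\<forall>i. 0 < i \<and> i < n \<longrightarrow> f i \<in> C)"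

lemma walk_through_shortcut:
  assumes w: "walk_through E C n f" and "i + d \<le> n"
    and jump: "i + d < n \<Longrightarrow> (f i, f (Suc (i + d))) \<in> E" and last: "i + d = n \<Longrightarrow> f i = f n"
  shows "\<exists>g. walk_through E C (n - d) g \<and> g 0 = f 0 \<and> g (n - d) = f n"
proof -
  have E: "(f k, f (Suc k)) \<in> E" if "k < n" for k using w that unfolding walk_through_def by blast
  have C: "f k \<in> C" if "0 < k" "k < n" for k using w that unfolding walk_through_def by blast
  define g where "g k = (if k \<le> i then f k else f (k + d))" for k
  have step: "(g k, g (Suc k)) \<in> E" if "k < n - d" for k
  proof -
    consider "k < i" | "k = i" | "k > i" by linarith
    then show ?thesis
    proof cases
      case 1
      then have "g k = f k" "g (Suc k) = f (Suc k)" "k < n" using that by (auto simp: g_def)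
      then show ?thesis using E by metis
    next
      case 2
      then have "g k = f i" "g (Suc k) = f (Suc (i + d))" "i + d < n" using that by (auto simp: g_def)
      then show ?thesis using jump by metis
    next
      case 3
      then have "g k = f (k + d)" "g (Suc k) = f (Suc (k + d))" "k + d < n" using that by (auto simp: g_def)
      then show ?thesis using E by metis
    qed
  qed
  have "g k \<in> C" if "0 < k" "k < n - d" for k
  proof -
    have "\<exists>m. g k = f m \<and> 0 < m \<and> m < n" using that by (auto simp: g_def)
    then show ?thesis using C by metis
  qed
  moreover have "g 0 = f 0" by (simp add: g_def)
  moreover have "g (n - d) = f n"
    using \<open>i + d \<le> n\<close> last by (cases "i + d = n") (auto simp: g_def)
  ultimately show ?thesis using step unfolding walk_through_def by blast
qed

lemma shortest_walk_induced:
  assumes "walk_through E C n0 f0" "f0 0 = x" "f0 n0 = y"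
  obtains n f where "walk_through E C n f" "f 0 = x" "f n = y"
    "\<And>i j. i < j \<Longrightarrow> j \<le> n \<Longrightarrow> f i \<noteq> f j"
    "\<And>i j. Suc i < j \<Longrightarrow> j \<le> n \<Longrightarrow> (f i, f j) \<notin> E"
proof -
  define P where "P n \<longleftrightarrow> (\<exists>f. walk_through E C n f \<and> f 0 = x \<and> f n = y)" for n
  define n where "n = (LEAST n. P n)"
  have "P n" unfolding n_def by (rule LeastI[of P n0]) (use assms in \<open>auto simp: P_def\<close>)
  then obtain f where f: "walk_through E C n f" "f 0 = x" "f n = y" by (auto simp: P_def)
  have min: "\<not> P m" if "m < n" for m using not_less_Least that unfolding n_def by blast
  have short: False if "0 < d" "i + d \<le> n" "i + d < n \<Longrightarrow> (f i, f (Suc (i + d))) \<in> E"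
    "i + d = n \<Longrightarrow> f i = f n" for i d
  proof -
    have "P (n - d)" using walk_through_shortcut[OF f(1) that(2-4)] f by (auto simp: P_def)
    then show False using min[of "n - d"] that by auto
  qed
  have ne: "f i \<noteq> f j" if "i < j" "j \<le> n" for i j
  proof
    assume eq: "f i = f j"
    have "(f j, f (Suc j)) \<in> E" if "j < n" using f(1) that by (simp add: walk_through_def)
    moreover have "i + (j - i) = j" "0 < j - i" using that by auto
    ultimately show False using short[of "j - i" i] that(2) eq by metis
  qed
  have ind: "(f i, f j) \<notin> E" if "Suc i < j" "j \<le> n" for i j
  proof
    assume "(f i, f j) \<in> E"
    moreover have "Suc (i + (j - Suc i)) = j" "0 < j - Suc i" "i + (j - Suc i) < n" using that by auto
    ultimately show False using short[of "j - Suc i" i] by (metis less_imp_le_nat less_irrefl)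
  qed
  show thesis using that f ne ind by blast
qed

lemma pcas_append: "pcas u (xs @ ys) v \<longleftrightarrow> (\<exists>w. pcas u xs w \<and> pcas w ys v)"
  by (induction xs arbitrary: u) simp_all

lemma pcas_path: "pcas (f 0) (map (\<lambda>i. (f i, f (Suc i))) [0..<n]) (f n)"
  by (induction n) (simp_all add: pcas_append)

text \<open>A shortest path through \<open>C\<close> between two neighbours of \<open>v\<close> closes up with \<open>v\<close> to a
  chordless cycle.\<close>

lemma chordal_nbrs_adjacent:
  assumes H: "pair_graph H" and ch: "chordal H"
    and xy: "(v, x) \<in> parcs H" "(v, y) \<in> parcs H" "x \<noteq> y"
    and C: "\<And>c. c \<in> C \<Longrightarrow> c \<noteq> v \<and> (v, c) \<notin> parcs H"
    and walk: "walk_through (parcs H) C n0 f0" "f0 0 = x" "f0 n0 = y"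
  shows "(x, y) \<in> parcs H"
proof (rule ccontr)
  assume nxy: "(x, y) \<notin> parcs H"
  note sym = pair_graph_sym[OF H]
  interpret pair_graph H by (rule H)
  obtain n f where f: "walk_through (parcs H) C n f" "f 0 = x" "f n = y"
    and ne: "\<And>i j. i < j \<Longrightarrow> j \<le> n \<Longrightarrow> f i \<noteq> f j"
    and ind: "\<And>i j. Suc i < j \<Longrightarrow> j \<le> n \<Longrightarrow> (f i, f j) \<notin> parcs H"
    using shortest_walk_induced[OF walk] by metis
  have n2: "2 \<le> n"
  proof (rule ccontr)
    assume "\<not> 2 \<le> n"
    then have "n = 0 \<or> n = 1" by linarith
    then show False using f xy(3) nxy by (auto simp: walk_through_def)
  qed
  have vf: "f i \<noteq> v" if "i \<le> n" for i
  proof -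
    have "i = 0 \<or> i = n \<or> (0 < i \<and> i < n)" using that by auto
    then show ?thesis
      using f C xy(1,2) pair_graph_irrefl[OF H] by (auto simp: walk_through_def)
  qed
  define c where "c = (v, f 0) # map (\<lambda>i. (f i, f (Suc i))) [0..<n] @ [(f n, v)]"
  have arcs: "set c \<subseteq> parcs H"
    using f xy sym by (auto simp: c_def walk_through_def)
  have cas: "pcas v c v"
    unfolding c_def pcas.simps pcas_append fst_conv snd_conv
    by (intro conjI exI[of _ "f n"] refl pcas_path)
  have vs: "tl (pawalk_verts v c) = map f [0..<Suc n] @ [v]"
  proof -
    have "pawalk_verts (f 0) (map (\<lambda>i. (f i, f (Suc i))) [0..<n] @ [(f n, v)]) = map f [0..<Suc n] @ [v]"
    proof -
      have "pawalk_verts u (xs @ [(a, b)]) = map fst xs @ [a, b]" for u a b and xs :: "('a \<times> 'a) list"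
        by (induction xs arbitrary: u) auto
      then show ?thesis by (simp add: comp_def)
    qed
    then show ?thesis by (simp add: c_def)
  qed
  have inj: "inj_on f {0..<Suc n}"
    by (rule inj_onI) (metis ne atLeastLessThan_iff less_Suc_eq_le linorder_neqE_nat)
  have "v \<notin> f ` {0..<Suc n}" using vf by (metis atLeastLessThan_iff imageE less_Suc_eq_le)
  then have "distinct (tl (pawalk_verts v c))"
    unfolding vs distinct_append distinct_map set_upt set_map using inj by simp
  moreover have "v \<in> pverts H" using pair_graph_verts[OF H xy(1)] by simp
  ultimately have "cycle c"
    unfolding cycle_def awalk_def using arcs cas by (auto simp: c_def)
  moreover have "4 \<le> length c" using n2 by (simp add: c_def)
  ultimately obtain a b where ab: "a \<in> fst ` set c" "b \<in> fst ` set c" "(a, b) \<in> parcs H"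
    "(a, b) \<notin> set c" "(b, a) \<notin> set c"
    using ch unfolding chordal_def by blast
  have tails: "fst ` set c = insert v (f ` {..n})"
    unfolding c_def by (auto simp: image_iff) (metis atLeastLessThan_iff le_neq_implies_less zero_le)
  \<comment> \<open>The last assumption orients the chord: its first end is \<open>v\<close> or does
    not come after the second one on the path. A chord at \<open>v\<close> ends in an interior
    vertex of the path, because the arcs from \<open>v\<close> to both ends of the path belong to
    the cycle; interior vertices lie in \<open>C\<close> and are not adjacent to \<open>v\<close>. A
    chord within the path contradicts inducedness unless it joins consecutive vertices.\<close>
  have key: False if "(a, b) \<in> parcs H" "(a, b) \<notin> set c" "(b, a) \<notin> set c"
    "a = v \<or> (\<exists>i\<le>n. a = f i)" "\<exists>j\<le>n. b = f j \<and> (\<forall>i\<le>n. a = f i \<longrightarrow> i \<le> j)" for a b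
  proof -
    from that(5) obtain j where j: "j \<le> n" "b = f j" "\<And>i. i \<le> n \<Longrightarrow> a = f i \<Longrightarrow> i \<le> j"
      by blast
    show False
    proof (cases "a = v")
      case True
      have "j \<noteq> 0" "j \<noteq> n" using that j True by (auto simp: c_def)
      then have "f j \<in> C" using j f(1) by (auto simp: walk_through_def)
      then show False using C that j True by auto
    next
      case False
      with that(4) obtain i where i: "i \<le> n" "a = f i" by blast
      then have "i \<le> j" using j by blast
      moreover have "i \<noteq> j" using that(1) i j pair_graph_irrefl[OF H] by auto
      moreover have "Suc i \<noteq> j" using that(2) i j by (auto simp: c_def)
      ultimately have "Suc i < j" by linarith
      then show False using ind[of i j] i(2) j(1,2) that(1) by metis
    qed
  qed
  have "a = v \<or> (\<exists>i\<le>n. a = f i)" "b = v \<or> (\<exists>i\<le>n. b = f i)" using ab tails by auto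
  moreover have "\<not> (a = v \<and> b = v)" using ab(3) pair_graph_irrefl[OF H] by auto
  moreover have uniq: "i = j" if "f i = f j" "i \<le> n" "j \<le> n" for i j
    using ne that by (metis linorder_neqE_nat)
  ultimately consider j where "a = v" "j \<le> n" "b = f j" | i where "b = v" "i \<le> n" "a = f i"
    | i j where "i \<le> n" "a = f i" "j \<le> n" "b = f j" by blast
  then show False
  proof cases
    case 1
    then show False using key[OF ab(3-5)] vf by metis
  next
    case 2
    then show False using key[OF sym[OF ab(3)] ab(5,4)] vf by metis
  next
    case 3
    show False
    proof (cases "i \<le> j")
      case True
      then show False using key[OF ab(3-5)] 3 uniq by blast
    next
      case False
      then show False using key[OF sym[OF ab(3)] ab(5,4)] 3 uniq by (metis nle_le)
    qed
  qed
qed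

section \<open>Simplicial vertices\<close>

definition simplicial_in :: "'a pair_pre_digraph \<Rightarrow> 'a set \<Rightarrow> 'a \<Rightarrow> bool" where
  "simplicial_in H W s \<longleftrightarrow> (\<forall>x \<in> nbrs H W s. \<forall>y \<in> nbrs H W s. x \<noteq> y \<longrightarrow> (x, y) \<in> parcs H)"

lemma walk_through_rtrancl:
  assumes "(a, b) \<in> (E \<inter> C \<times> C)\<^sup>*" "a \<in> C" "(x, a) \<in> E" "(b, y) \<in> E"
  shows "\<exists>n f. walk_through E C n f \<and> f 0 = x \<and> f n = y"
  using assms
proof (induction arbitrary: y rule: rtrancl_induct)
  case base
  then show ?case
    by (intro exI[of _ 2] exI[of _ "\<lambda>i. if i = 0 then x else if i = 1 then a else y"])
       (auto simp: walk_through_def less_Suc_eq numeral_2_eq_2)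
next
  case (step b c)
  have "(b, c) \<in> E" "c \<in> C" using step.hyps by auto
  from step.IH[OF step.prems(1,2) this(1)]
  obtain n f where f: "walk_through E C n f" "f 0 = x" "f n = c" by blast
  have "n \<noteq> 0 \<Longrightarrow> 0 < n" by simp
  then show ?case using f step.prems(3) \<open>c \<in> C\<close>
    by (intro exI[of _ "Suc n"] exI[of _ "f(Suc n := y)"])
       (auto simp: walk_through_def less_Suc_eq)
qed

text \<open>With \<open>C\<close> a component of \<open>W - N[v]\<close> and \<open>S\<close> its boundary, \<open>S\<close> is a clique inside \<open>N(v)\<close>;
  a simplicial vertex of \<open>C \<union> S\<close> lying in \<open>C\<close> is simplicial in \<open>W\<close>.\<close>

lemma chordal_simplicial_nonadjacent:
  assumes H: "pair_graph H" and ch: "chordal H" and "finite W"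
    and "v \<in> W" "u \<in> W" "u \<noteq> v" "(v, u) \<notin> parcs H"
  shows "\<exists>s \<in> W. s \<noteq> v \<and> (v, s) \<notin> parcs H \<and> simplicial_in H W s"
  using assms(3-)
proof (induction "card W" arbitrary: W v u rule: less_induct)
  case less
  note sym = pair_graph_sym[OF H]
  let ?E = "parcs H"
  define R where "R = W - insert v {x. (v, x) \<in> ?E}"
  define C where "C = {c. (u, c) \<in> (?E \<inter> R \<times> R)\<^sup>*}"
  define S where "S = {s \<in> W. s \<notin> C \<and> (\<exists>c \<in> C. (s, c) \<in> ?E)}"
  have uR: "u \<in> R" using less by (auto simp: R_def)
  have uC: "u \<in> C" by (auto simp: C_def)
  have CR: "C \<subseteq> R"
    using uR by (auto simp: C_def elim: rtranclE)
  have symR: "sym (?E \<inter> R \<times> R)" using sym by (auto intro!: symI)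
  have conn: "(a, b) \<in> (?E \<inter> C \<times> C)\<^sup>*" if "a \<in> C" "b \<in> C" for a b
  proof -
    have up: "(u, c) \<in> (?E \<inter> C \<times> C)\<^sup>*" if "c \<in> C" for c
    proof -
      have "(u, c) \<in> (?E \<inter> R \<times> R)\<^sup>*" using that by (simp add: C_def)
      then show ?thesis
      proof (induction rule: rtrancl_induct)
        case (step y z)
        then have "(u, z) \<in> (?E \<inter> R \<times> R)\<^sup>*" by (meson rtrancl_into_rtrancl)
        then have "y \<in> C" "z \<in> C" using step by (auto simp: C_def)
        with step show ?case by (meson IntD1 IntI SigmaI rtrancl_into_rtrancl)
      qed simp
    qed
    have "sym ((?E \<inter> C \<times> C)\<^sup>*)" by (rule sym_rtrancl) (use sym in \<open>auto intro!: symI\<close>)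
    then have "(a, u) \<in> (?E \<inter> C \<times> C)\<^sup>*" using up[OF that(1)] by (auto elim: symE)
    then show ?thesis using up[OF that(2)] by (rule rtrancl_trans)
  qed
  have nC: "x \<in> C \<union> S" if "c \<in> C" "(c, x) \<in> ?E" "x \<in> W" for c x
    using that sym by (auto simp: S_def)
  have Sv: "(v, s) \<in> ?E" if s: "s \<in> S" for s
  proof (rule ccontr)
    assume n: "(v, s) \<notin> ?E"
    obtain c where c: "c \<in> C" "(s, c) \<in> ?E" "s \<in> W" "s \<notin> C" using s by (auto simp: S_def)
    have "s \<noteq> v" using c CR by (auto simp: R_def)
    then have "s \<in> R" using n c by (auto simp: R_def)
    then have "(c, s) \<in> ?E \<inter> R \<times> R" using c CR sym by auto
    then have "s \<in> C" using c(1) by (auto simp: C_def intro: rtrancl_into_rtrancl)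
    then show False using c by simp
  qed
  have Scl: "(x, y) \<in> ?E" if xy: "x \<in> S" "y \<in> S" "x \<noteq> y" for x y
  proof -
    obtain a where a: "a \<in> C" "(x, a) \<in> ?E" using xy by (auto simp: S_def)
    obtain b where b: "b \<in> C" "(y, b) \<in> ?E" using xy by (auto simp: S_def)
    obtain n f where "walk_through ?E C n f" "f 0 = x" "f n = y"
      using walk_through_rtrancl[OF conn[OF a(1) b(1)] a(1) a(2) sym[OF b(2)]] by blast
    then show ?thesis
      using chordal_nbrs_adjacent[OF H ch Sv[OF xy(1)] Sv[OF xy(2)] xy(3), of C n f] CR
      by (auto simp: R_def)
  qed
  let ?W = "C \<union> S"
  have sub: "?W \<subseteq> W" using CR by (auto simp: S_def R_def)
  have "v \<notin> ?W" using CR Sv pair_graph_irrefl[OF H] by (auto simp: R_def)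
  then have lt: "card ?W < card W"
    using sub less.prems by (intro psubset_card_mono) auto
  have fin: "finite ?W" using sub less.prems finite_subset by blast
  have fin_case: ?case if "c \<in> C" "simplicial_in H ?W c" for c
  proof (intro bexI[of _ c] conjI)
    show "simplicial_in H W c"
      using that nC by (auto simp: simplicial_in_def nbrs_def)
  qed (use that CR in \<open>auto simp: R_def\<close>)
  \<comment> \<open>The induction hypothesis is applied with a vertex in the role of
    \<open>v\<close> whose non-neighbours in \<open>C \<union> S\<close> all lie in
    \<open>C\<close>: a vertex of \<open>S\<close> if one has a non-neighbour, as \<open>S\<close>
    is a clique; otherwise a vertex of \<open>C\<close>, as every vertex of \<open>S\<close> is then
    adjacent to all others. If neither has non-neighbours, \<open>C \<union> S\<close> is complete
    and \<open>u\<close> will do.\<close>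
  show ?case
  proof (cases "\<exists>s \<in> S. \<exists>x \<in> ?W. x \<noteq> s \<and> (s, x) \<notin> ?E")
    case True
    then obtain s x where "s \<in> S" "x \<in> ?W" "x \<noteq> s" "(s, x) \<notin> ?E" by blast
    then obtain t where "t \<in> ?W" "t \<noteq> s" "(s, t) \<notin> ?E" "simplicial_in H ?W t"
      using less.hyps[OF lt fin, of s x] by auto
    then show ?thesis using fin_case[of t] Scl \<open>s \<in> S\<close> by auto
  next
    case univ: False
    show ?thesis
    proof (cases "\<exists>c \<in> C. \<exists>x \<in> ?W. x \<noteq> c \<and> (c, x) \<notin> ?E")
      case True
      then obtain c x where "c \<in> C" "x \<in> ?W" "x \<noteq> c" "(c, x) \<notin> ?E" by blast
      then obtain t where "t \<in> ?W" "t \<noteq> c" "(c, t) \<notin> ?E" "simplicial_in H ?W t"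
        using less.hyps[OF lt fin, of c x] by auto
      moreover have "t \<notin> S"
      proof
        assume "t \<in> S"
        then have "(t, c) \<in> ?E" using univ \<open>c \<in> C\<close> \<open>t \<noteq> c\<close> by (metis UnI1)
        then show False using sym \<open>(c, t) \<notin> ?E\<close> by blast
      qed
      ultimately show ?thesis using fin_case[of t] by blast
    next
      case False
      then have "(x, y) \<in> ?E" if "x \<in> ?W" "y \<in> ?W" "x \<noteq> y" for x y
        using that univ by (metis UnE)
      then have "simplicial_in H ?W u"
        unfolding simplicial_in_def nbrs_def by simp
      then show ?thesis using fin_case uC by blast
    qed
  qed
qed

lemma chordal_simplicial:
  assumes "pair_graph H" "chordal H" "finite W" "W \<noteq> {}"
  shows "\<exists>s \<in> W. simplicial_in H W s"
proof (cases "\<exists>v \<in> W. \<exists>u \<in> W. u \<noteq> v \<and> (v, u) \<notin> parcs H")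
  case True
  then show ?thesis using chordal_simplicial_nonadjacent[OF assms(1-3)] by blast
next
  case False
  then have "simplicial_in H W s" if "s \<in> W" for s
    unfolding simplicial_in_def nbrs_def by simp metis
  then show ?thesis using assms(4) by blast
qed

lemma chordal_peo:
  assumes H: "pair_graph H" "chordal H"
  shows "\<exists>vs. peo H vs \<and> set vs = pverts H"
proof -
  have "\<exists>vs. peo H vs \<and> set vs = W" if "finite W" "W \<subseteq> pverts H" for W
    using that
  proof (induction "card W" arbitrary: W)
    case 0
    then show ?case by (intro exI[of _ "[]"]) auto
  next
    case (Suc n)
    then have "W \<noteq> {}" by auto
    then obtain s where s: "s \<in> W" "simplicial_in H W s"
      using chordal_simplicial[OF H] Suc by blast
    then have "n = card (W - {s})" using Suc by simp
    from Suc(1)[OF this] obtain vs where vs: "peo H vs" "set vs = W - {s}"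
      using Suc(3,4) by auto
    have "peo H (s # vs)"
      using s vs Suc(4) by (auto simp: clique_def simplicial_in_def nbrs_def)
    then show ?case using s vs by (intro exI[of _ "s # vs"]) auto
  qed
  then show ?thesis using pair_graph_finite[OF H(1)] by blast
qed

text \<open>Four vertices of a clique are a K4 minor with singleton branch sets. This is the form in
  which series-parallelity enters the later sections.\<close>

lemma series_parallel_clique_card:
  assumes H: "pair_graph H" "series_parallel H" and Q: "clique H Q"
  shows "card Q \<le> 3"
proof (rule ccontr)
  assume "\<not> card Q \<le> 3"
  then have "4 \<le> card Q" by simp
  then obtain Q' where Q': "Q' \<subseteq> Q" "card Q' = 4" "finite Q'"
    by (rule obtain_subset_with_card_n)
  obtain g where g: "bij_betw g {0..<4::nat} Q'"
    using ex_bij_betw_nat_finite[OF Q'(3)] Q'(2) by auto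
  define K :: "nat pair_pre_digraph" where
    "K = \<lparr>pverts = {0..<4}, parcs = {(u, v). u < 4 \<and> v < 4 \<and> u \<noteq> v}\<rparr>"
  have "complete_digraph 4 (with_proj K)"
    by (auto simp: complete_digraph_pair_def K_def)
  moreover have "has_minor H K"
    unfolding has_minor_def
  proof (intro exI[of _ "\<lambda>x. {g x}"] conjI ballI impI)
    fix x assume x: "x \<in> pverts K"
    then have "g x \<in> Q'" using g by (auto simp: K_def bij_betw_def)
    then show "{g x} \<subseteq> pverts H" using Q Q' by (auto simp: clique_def)
    show "Digraph_Component.connected (with_proj H \<restriction> {g x})"
      by (auto simp: Digraph_Component.connected_def strongly_connected_def mk_symmetric_def
          induce_subgraph_def reachable_def intro: rtrancl_on_refl)
  next
    fix x y assume "x \<in> pverts K" "y \<in> pverts K" "x \<noteq> y"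
    then show "{g x} \<inter> {g y} = {}" using g by (auto simp: K_def bij_betw_def inj_on_def)
  next
    fix e assume "e \<in> parcs K"
    then obtain x y where e: "e = (x, y)" "x < 4" "y < 4" "x \<noteq> y" by (auto simp: K_def)
    then have "g x \<in> Q'" "g y \<in> Q'" "g x \<noteq> g y" using g by (auto simp: bij_betw_def inj_on_def)
    then show "case e of (x, y) \<Rightarrow> \<exists>u\<in>{g x}. \<exists>v\<in>{g y}. (u, v) \<in> parcs H"
      using Q Q' e by (auto simp: clique_def)
  qed
  ultimately show False using H(2) by (auto simp: series_parallel_def)
qed

section \<open>Entropy of uniform homomorphisms\<close>

definition fibre :: "('b \<Rightarrow> 'c) set \<Rightarrow> 'b set \<Rightarrow> ('b \<Rightarrow> 'c) \<Rightarrow> ('b \<Rightarrow> 'c) set" where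
  "fibre \<Omega> S f = {g \<in> \<Omega>. \<forall>u \<in> S. g u = f u}"

text \<open>Shannon entropy, in nats, of the restriction to \<open>S\<close> of a uniform element of
  \<open>\<Omega>\<close>. The average is taken over \<open>\<Omega>\<close> instead of over the
  restrictions, whose probabilities are
  \<open>card (fibre \<Omega> S f) / card \<Omega>\<close>.\<close>

definition ent :: "('b \<Rightarrow> 'c) set \<Rightarrow> 'b set \<Rightarrow> real" where
  "ent \<Omega> S = (\<Sum>f\<in>\<Omega>. ln (card \<Omega>) - ln (card (fibre \<Omega> S f))) / card \<Omega>"

lemma finite_fibre: "finite \<Omega> \<Longrightarrow> finite (fibre \<Omega> S f)"
  by (simp add: fibre_def)

lemma card_fibre_pos: "finite \<Omega> \<Longrightarrow> f \<in> \<Omega> \<Longrightarrow> 0 < card (fibre \<Omega> S f)"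
  using finite_fibre[of \<Omega> S f] by (auto simp: card_gt_0_iff fibre_def)

lemma fibre_antimono: "S \<subseteq> T \<Longrightarrow> fibre \<Omega> T f \<subseteq> fibre \<Omega> S f"
  by (auto simp: fibre_def)

lemma fibre_cong: "(\<And>u. u \<in> S \<Longrightarrow> f u = g u) \<Longrightarrow> fibre \<Omega> S f = fibre \<Omega> S g"
  by (auto simp: fibre_def)

lemma ent_empty [simp]: "ent \<Omega> {} = 0"
  by (simp add: ent_def fibre_def)

lemma ent_mono:
  assumes "finite \<Omega>" "S \<subseteq> T"
  shows "ent \<Omega> S \<le> ent \<Omega> T"
proof -
  have "ln (card (fibre \<Omega> T f)) \<le> ln (card (fibre \<Omega> S f))" if "f \<in> \<Omega>" for f
    using card_fibre_pos[OF assms(1) that, of T] card_mono[OF finite_fibre[OF assms(1)] fibre_antimono[OF assms(2)]]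
    by (simp add: ln_mono)
  then show ?thesis unfolding ent_def by (intro divide_right_mono sum_mono) auto
qed

lemma sum_fibre_inverse:
  assumes "finite \<Omega>" "f \<in> \<Omega>"
  shows "(\<Sum>g\<in>fibre \<Omega> S f. 1 / real (card (fibre \<Omega> S g))) = 1"
proof -
  have "card (fibre \<Omega> S g) = card (fibre \<Omega> S f)" if "g \<in> fibre \<Omega> S f" for g
    using that fibre_cong[of S g f \<Omega>] by (simp add: fibre_def)
  then have "(\<Sum>g\<in>fibre \<Omega> S f. 1 / real (card (fibre \<Omega> S g)))
      = (\<Sum>g\<in>fibre \<Omega> S f. 1 / real (card (fibre \<Omega> S f)))" by simp
  also have "\<dots> = 1" using card_fibre_pos[OF assms] by simp
  finally show ?thesis .
qed

lemma sum_of_bool_fibre: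
  assumes "finite \<Omega>"
  shows "(\<Sum>a\<in>\<Omega>. of_bool (a \<in> fibre \<Omega> S f)) = real (card (fibre \<Omega> S f))"
proof -
  have "\<Omega> \<inter> {a. a \<in> fibre \<Omega> S f} = fibre \<Omega> S f" by (auto simp: fibre_def)
  then show ?thesis using assms sum_of_bool_eq[of \<Omega> "\<lambda>a. a \<in> fibre \<Omega> S f", where 'a = real] by simp
qed

text \<open>After normalisation: coupling the marginals on \<open>S\<close> and \<open>T\<close>
  independently over \<open>S \<inter> T\<close> gives the restrictions of \<open>\<Omega>\<close>
  to \<open>S \<union> T\<close> mass at most one. Mass is lost on pairs that do not glue to an
  element of \<open>\<Omega>\<close>.\<close>

lemma fibre_ratio_sum:
  assumes fin: "finite \<Omega>"
  shows "(\<Sum>f\<in>\<Omega>. real (card (fibre \<Omega> S f)) * card (fibre \<Omega> T f)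
      / (card (fibre \<Omega> (S \<union> T) f) * card (fibre \<Omega> (S \<inter> T) f))) \<le> card \<Omega>"
proof -
  let ?c = "\<lambda>S f. real (card (fibre \<Omega> S f))"
  let ?I = "\<lambda>f a b. of_bool (a \<in> fibre \<Omega> S f \<and> b \<in> fibre \<Omega> T f) :: real"
  have prod: "?c S f * ?c T f = (\<Sum>a\<in>\<Omega>. \<Sum>b\<in>\<Omega>. ?I f a b)" for f
  proof -
    have "?c A f = (\<Sum>a\<in>\<Omega>. of_bool (a \<in> fibre \<Omega> A f))" for A
      by (rule sum_of_bool_fibre[OF fin, symmetric])
    then show ?thesis by (simp only: sum_product of_bool_conj)
  qed
  \<comment> \<open>The \<open>f\<close> agreeing with \<open>a\<close> on \<open>S\<close> and with
    \<open>b\<close> on \<open>T\<close> form a single fibre over \<open>S \<union> T\<close> or do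
    not exist. In the first case \<open>a\<close> and \<open>b\<close> agree on
    \<open>S \<inter> T\<close>, and the weights \<open>1 / card\<close> add up to 1 over the
    fibre.\<close>
  have inner: "(\<Sum>f\<in>\<Omega>. ?I f a b / (?c (S \<union> T) f * ?c (S \<inter> T) f))
      \<le> of_bool (b \<in> fibre \<Omega> (S \<inter> T) a) / ?c (S \<inter> T) a" if ab: "a \<in> \<Omega>" "b \<in> \<Omega>" for a b
  proof (cases "\<exists>f \<in> \<Omega>. a \<in> fibre \<Omega> S f \<and> b \<in> fibre \<Omega> T f")
    case True
    then obtain f0 where f0: "f0 \<in> \<Omega>" "\<And>u. u \<in> S \<Longrightarrow> a u = f0 u" "\<And>u. u \<in> T \<Longrightarrow> b u = f0 u"
      by (auto simp: fibre_def)
    have W: "a \<in> fibre \<Omega> S f \<and> b \<in> fibre \<Omega> T f \<longleftrightarrow> f \<in> fibre \<Omega> (S \<union> T) f0" if "f \<in> \<Omega>" for f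
      unfolding fibre_def using f0(2,3) ab that by (simp add: Ball_def) metis
    have c: "?c (S \<inter> T) f = ?c (S \<inter> T) a" if "f \<in> fibre \<Omega> (S \<union> T) f0" for f
    proof -
      have "f u = a u" if "u \<in> S \<inter> T" for u
        using \<open>f \<in> fibre \<Omega> (S \<union> T) f0\<close> f0(2)[of u] that by (simp add: fibre_def)
      then show ?thesis by (metis fibre_cong)
    qed
    have "(\<Sum>f\<in>\<Omega>. ?I f a b / (?c (S \<union> T) f * ?c (S \<inter> T) f))
      = (\<Sum>f\<in>\<Omega>. if f \<in> fibre \<Omega> (S \<union> T) f0 then 1 / ?c (S \<union> T) f * (1 / ?c (S \<inter> T) a) else 0)"
    proof (rule sum.cong[OF refl])
      fix f assume "f \<in> \<Omega>"
      from W[OF this] c[of f] show "?I f a b / (?c (S \<union> T) f * ?c (S \<inter> T) f)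
        = (if f \<in> fibre \<Omega> (S \<union> T) f0 then 1 / ?c (S \<union> T) f * (1 / ?c (S \<inter> T) a) else 0)"
        by simp
    qed
    also have "\<dots> = (\<Sum>f\<in>fibre \<Omega> (S \<union> T) f0. 1 / ?c (S \<union> T) f * (1 / ?c (S \<inter> T) a))"
      using fin by (simp only: sum.inter_restrict[symmetric]) (rule sum.cong, auto simp: fibre_def)
    also have "\<dots> = 1 / ?c (S \<inter> T) a"
      using sum_fibre_inverse[OF fin f0(1), of "S \<union> T"] by (simp only: sum_distrib_right[symmetric])
    also have "b \<in> fibre \<Omega> (S \<inter> T) a" using f0 ab by (auto simp: fibre_def)
    then have "1 / ?c (S \<inter> T) a = of_bool (b \<in> fibre \<Omega> (S \<inter> T) a) / ?c (S \<inter> T) a" by simp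
    finally show ?thesis by simp
  next
    case False
    then have "?I f a b = 0" if "f \<in> \<Omega>" for f using that by simp
    then have "(\<Sum>f\<in>\<Omega>. ?I f a b / (?c (S \<union> T) f * ?c (S \<inter> T) f)) = (\<Sum>f\<in>\<Omega>. 0)"
      by (intro sum.cong refl) simp
    then show ?thesis by simp
  qed
  have "(\<Sum>f\<in>\<Omega>. ?c S f * ?c T f / (?c (S \<union> T) f * ?c (S \<inter> T) f))
      = (\<Sum>f\<in>\<Omega>. \<Sum>a\<in>\<Omega>. \<Sum>b\<in>\<Omega>. ?I f a b / (?c (S \<union> T) f * ?c (S \<inter> T) f))"
    by (simp only: prod sum_divide_distrib)
  also have "\<dots> = (\<Sum>a\<in>\<Omega>. \<Sum>f\<in>\<Omega>. \<Sum>b\<in>\<Omega>. ?I f a b / (?c (S \<union> T) f * ?c (S \<inter> T) f))"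
    by (rule sum.swap)
  also have "\<dots> = (\<Sum>a\<in>\<Omega>. \<Sum>b\<in>\<Omega>. \<Sum>f\<in>\<Omega>. ?I f a b / (?c (S \<union> T) f * ?c (S \<inter> T) f))"
    by (intro sum.cong refl sum.swap)
  also have "\<dots> \<le> (\<Sum>a\<in>\<Omega>. \<Sum>b\<in>\<Omega>. of_bool (b \<in> fibre \<Omega> (S \<inter> T) a) / ?c (S \<inter> T) a)"
    by (intro sum_mono inner)
  also have "\<dots> = (\<Sum>a\<in>\<Omega>. 1)"
  proof (rule sum.cong[OF refl])
    fix a assume a: "a \<in> \<Omega>"
    have "(\<Sum>b\<in>\<Omega>. of_bool (b \<in> fibre \<Omega> (S \<inter> T) a) :: real) = ?c (S \<inter> T) a"
      by (rule sum_of_bool_fibre[OF fin])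
    then show "(\<Sum>b\<in>\<Omega>. of_bool (b \<in> fibre \<Omega> (S \<inter> T) a) / ?c (S \<inter> T) a) = 1"
      using card_fibre_pos[OF fin a] by (simp add: sum_divide_distrib[symmetric])
  qed
  finally show ?thesis by simp
qed

text \<open>Relative entropy with respect to the coupling of \<open>fibre_ratio_sum\<close> is
  nonnegative, by \<open>ln r \<le> r - 1\<close> applied to the ratio of the two densities.\<close>

lemma ent_submodular:
  assumes fin: "finite \<Omega>"
  shows "ent \<Omega> (S \<union> T) + ent \<Omega> (S \<inter> T) \<le> ent \<Omega> S + ent \<Omega> T"
proof -
  let ?c = "\<lambda>S f. real (card (fibre \<Omega> S f))"
  have pos: "0 < ?c A f" if "f \<in> \<Omega>" for A f using card_fibre_pos[OF fin that] by simp
  have "(\<Sum>f\<in>\<Omega>. ln (?c S f) + ln (?c T f) - ln (?c (S \<union> T) f) - ln (?c (S \<inter> T) f))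
      \<le> (\<Sum>f\<in>\<Omega>. ?c S f * ?c T f / (?c (S \<union> T) f * ?c (S \<inter> T) f) - 1)"
  proof (rule sum_mono)
    fix f assume f: "f \<in> \<Omega>"
    let ?r = "?c S f * ?c T f / (?c (S \<union> T) f * ?c (S \<inter> T) f)"
    have "ln ?r \<le> ?r - 1"
      by (rule ln_le_minus_one) (intro divide_pos_pos mult_pos_pos pos f)
    moreover have "ln ?r = ln (?c S f) + ln (?c T f) - ln (?c (S \<union> T) f) - ln (?c (S \<inter> T) f)"
      using pos[OF f] by (simp add: ln_div ln_mult less_imp_neq[symmetric])
    ultimately show "ln (?c S f) + ln (?c T f) - ln (?c (S \<union> T) f) - ln (?c (S \<inter> T) f) \<le> ?r - 1"
      by simp
  qed
  also have "\<dots> \<le> 0" using fibre_ratio_sum[OF fin, of S T] by (simp add: sum_subtractf)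
  finally have "(\<Sum>f\<in>\<Omega>. ln (?c S f) + ln (?c T f) - ln (?c (S \<union> T) f) - ln (?c (S \<inter> T) f)) \<le> 0" .
  then have "(\<Sum>f\<in>\<Omega>. ln (card \<Omega>) - ln (?c (S \<union> T) f)) + (\<Sum>f\<in>\<Omega>. ln (card \<Omega>) - ln (?c (S \<inter> T) f))
     \<le> (\<Sum>f\<in>\<Omega>. ln (card \<Omega>) - ln (?c S f)) + (\<Sum>f\<in>\<Omega>. ln (card \<Omega>) - ln (?c T f))"
    by (simp add: sum_subtractf sum.distrib)
  then show ?thesis
    unfolding ent_def add_divide_distrib[symmetric] by (intro divide_right_mono) auto
qed

text \<open>Conditioning \<open>w\<close> on its later neighbours only, instead of on all later
  vertices, cannot decrease the conditional entropy.\<close>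

lemma ent_le_chain_rank:
  assumes "finite \<Omega>" "peo H vs"
  shows "ent \<Omega> (set vs) \<le> chain_rank H (ent \<Omega>) vs"
  using assms(2)
proof (induction vs)
  case (Cons w vs)
  let ?K = "nbrs H (set vs) w"
  have "insert w ?K \<union> set vs = set (w # vs)" "insert w ?K \<inter> set vs = ?K"
    using Cons.prems by (auto simp: nbrs_def)
  then have "ent \<Omega> (set (w # vs)) + ent \<Omega> ?K \<le> ent \<Omega> (insert w ?K) + ent \<Omega> (set vs)"
    using ent_submodular[OF assms(1), of "insert w ?K" "set vs"] by simp
  with Cons show ?case by simp
qed simp

lemma ent_determined:
  assumes "finite \<Omega>" "\<Omega> \<noteq> {}" "\<And>f g. f \<in> \<Omega> \<Longrightarrow> g \<in> \<Omega> \<Longrightarrow> (\<And>u. u \<in> S \<Longrightarrow> f u = g u) \<Longrightarrow> f = g"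
  shows "ent \<Omega> S = ln (card \<Omega>)"
proof -
  have "fibre \<Omega> S f = {f}" if "f \<in> \<Omega>" for f
    using assms(3)[OF _ that] that by (auto simp: fibre_def)
  then have "ent \<Omega> S = (\<Sum>f\<in>\<Omega>. ln (card \<Omega>)) / card \<Omega>" by (simp add: ent_def)
  then show ?thesis using assms(1,2) by simp
qed

section \<open>Gluing clique marginals to a Markov distribution\<close>

lemma sum_PiE_insert:
  assumes "w \<notin> A"
  shows "(\<Sum>g\<in>PiE (insert w A) (\<lambda>_. B). F g) = (\<Sum>g\<in>PiE A (\<lambda>_. B). \<Sum>z\<in>B. F (g(w := z)))"
proof -
  have "PiE (insert w A) (\<lambda>_. B) = (\<lambda>(z, g). g(w := z)) ` (B \<times> PiE A (\<lambda>_. B))"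
    by (rule PiE_insert_eq)
  moreover have "inj_on (\<lambda>(z, g). g(w := z)) (B \<times> PiE A (\<lambda>_. B))"
    using inj_combinator[OF assms, of "\<lambda>_. B"] by simp
  ultimately have "(\<Sum>g\<in>PiE (insert w A) (\<lambda>_. B). F g)
      = (\<Sum>(z, g)\<in>B \<times> PiE A (\<lambda>_. B). F (g(w := z)))"
    by (simp add: sum.reindex case_prod_unfold)
  also have "\<dots> = (\<Sum>z\<in>B. \<Sum>g\<in>PiE A (\<lambda>_. B). F (g(w := z)))"
    by (simp add: sum.cartesian_product)
  finally show ?thesis by (simp add: sum.swap[of _ B])
qed

definition depends_on :: "'a set \<Rightarrow> (('a \<Rightarrow> 'c) \<Rightarrow> real) \<Rightarrow> bool" where
  "depends_on C F \<longleftrightarrow> (\<forall>g g'. (\<forall>u \<in> C. g u = g' u) \<longrightarrow> F g = F g')"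

lemma depends_onD: "depends_on C F \<Longrightarrow> (\<And>u. u \<in> C \<Longrightarrow> g u = g' u) \<Longrightarrow> F g = F g'"
  unfolding depends_on_def by blast

lemma depends_onI: "(\<And>g g'. (\<And>u. u \<in> C \<Longrightarrow> g u = g' u) \<Longrightarrow> F g = F g') \<Longrightarrow> depends_on C F"
  unfolding depends_on_def by blast

text \<open>An unnormalised marginal of the pullbacks \<open>\<omega> \<circ> \<phi>\<close>.
  Quotients of two of these are conditional probabilities, and over the empty set the value is
  \<open>card \<Omega>\<close>, so a vertex without later neighbours is normalised as well.\<close>

definition pcnt :: "('b \<Rightarrow> 'c) set \<Rightarrow> ('a \<Rightarrow> 'b) \<Rightarrow> 'a set \<Rightarrow> ('a \<Rightarrow> 'c) \<Rightarrow> real" where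
  "pcnt \<Omega> \<phi> S g = real (card {\<omega> \<in> \<Omega>. \<forall>u \<in> S. \<omega> (\<phi> u) = g u})"

text \<open>The Markov distribution with the clique marginals of the pullbacks \<open>\<omega> \<circ> \<phi>\<close>, where
  \<open>\<omega> \<in> \<Omega>\<close> is uniform.\<close>

fun markov :: "'a pair_pre_digraph \<Rightarrow> ('b \<Rightarrow> 'c) set \<Rightarrow> ('a \<Rightarrow> 'b) \<Rightarrow> 'a list \<Rightarrow> ('a \<Rightarrow> 'c) \<Rightarrow> real" where
  "markov H \<Omega> \<phi> [] g = 1"
| "markov H \<Omega> \<phi> (w # vs) g =
     pcnt \<Omega> \<phi> (insert w (nbrs H (set vs) w)) g / pcnt \<Omega> \<phi> (nbrs H (set vs) w) g * markov H \<Omega> \<phi> vs g"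

text \<open>Minus the logarithm of \<open>markov\<close> wherever that is positive. As a sum, each
  of its terms depends on one clique, so the expectation can be read off the clique
  marginals.\<close>

fun markov_info :: "'a pair_pre_digraph \<Rightarrow> ('b \<Rightarrow> 'c) set \<Rightarrow> ('a \<Rightarrow> 'b) \<Rightarrow> 'a list \<Rightarrow> ('a \<Rightarrow> 'c) \<Rightarrow> real" where
  "markov_info H \<Omega> \<phi> [] g = 0"
| "markov_info H \<Omega> \<phi> (w # vs) g =
     ln (pcnt \<Omega> \<phi> (nbrs H (set vs) w) g) - ln (pcnt \<Omega> \<phi> (insert w (nbrs H (set vs) w)) g)
       + markov_info H \<Omega> \<phi> vs g"

lemma pcnt_cong: "(\<And>u. u \<in> S \<Longrightarrow> f u = g u) \<Longrightarrow> pcnt \<Omega> \<phi> S f = pcnt \<Omega> \<phi> S g"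
  by (simp add: pcnt_def)

lemma pcnt_nonneg [simp]: "0 \<le> pcnt \<Omega> \<phi> S g"
  by (simp add: pcnt_def)

lemma pcnt_pullback: "pcnt \<Omega> \<phi> S (\<omega> \<circ> \<phi>) = card (fibre \<Omega> (\<phi> ` S) \<omega>)"
  by (simp add: pcnt_def fibre_def)

text \<open>Positivity of the denominator relies on the convention \<open>a / 0 = 0\<close>.\<close>

lemma pos_factors:
  assumes "0 \<le> a" "0 \<le> b" "0 \<le> c" "0 < a / b * (c :: real)"
  shows "0 < a \<and> 0 < b \<and> 0 < c"
  using assms by (metis divide_eq_0_iff less_eq_real_def less_irrefl mult_eq_0_iff)

lemma markov_cong: "(\<And>u. u \<in> set vs \<Longrightarrow> f u = g u) \<Longrightarrow> markov H \<Omega> \<phi> vs f = markov H \<Omega> \<phi> vs g"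
proof (induction vs)
  case (Cons w vs)
  have "pcnt \<Omega> \<phi> (insert w (nbrs H (set vs) w)) f = pcnt \<Omega> \<phi> (insert w (nbrs H (set vs) w)) g"
    "pcnt \<Omega> \<phi> (nbrs H (set vs) w) f = pcnt \<Omega> \<phi> (nbrs H (set vs) w) g"
    using Cons.prems by (auto simp: nbrs_def intro!: pcnt_cong)
  with Cons show ?case by simp
qed simp

lemma markov_nonneg: "0 \<le> markov H \<Omega> \<phi> vs g"
  by (induction vs) auto

lemma markov_Cons_pos:
  assumes "0 < markov H \<Omega> \<phi> (w # vs) g"
  shows "0 < pcnt \<Omega> \<phi> (insert w (nbrs H (set vs) w)) g \<and> 0 < pcnt \<Omega> \<phi> (nbrs H (set vs) w) g
    \<and> 0 < markov H \<Omega> \<phi> vs g"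
  by (rule pos_factors) (use assms markov_nonneg in simp_all)

text \<open>Elements of \<open>\<Omega>\<close> are sorted by their value at
  \<open>\<phi> w\<close>. With \<open>F = 1\<close> this is summing out one variable; for general
  \<open>F\<close>, division by the marginal on \<open>K\<close> gives a conditional
  expectation.\<close>

lemma sum_pcnt_extend:
  assumes fin: "finite \<Omega>" "finite B" and B: "\<forall>\<omega>\<in>\<Omega>. \<omega> (\<phi> w) \<in> B" and w: "w \<notin> K"
    and F: "depends_on (insert w K) F"
  shows "(\<Sum>z\<in>B. pcnt \<Omega> \<phi> (insert w K) (h(w := z)) * F (h(w := z)))
    = (\<Sum>\<omega>\<in>{\<omega> \<in> \<Omega>. \<forall>u \<in> K. \<omega> (\<phi> u) = h u}. F (\<omega> \<circ> \<phi>))"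
proof -
  let ?W = "{\<omega> \<in> \<Omega>. \<forall>u \<in> K. \<omega> (\<phi> u) = h u}"
  have "(\<Sum>\<omega>\<in>?W. F (\<omega> \<circ> \<phi>)) = (\<Sum>z\<in>B. \<Sum>\<omega>\<in>{\<omega> \<in> ?W. \<omega> (\<phi> w) = z}. F (\<omega> \<circ> \<phi>))"
    using fin B by (intro sum.group[symmetric]) auto
  also have "\<dots> = (\<Sum>z\<in>B. pcnt \<Omega> \<phi> (insert w K) (h(w := z)) * F (h(w := z)))"
  proof (rule sum.cong[OF refl])
    fix z
    have "(\<Sum>\<omega>\<in>{\<omega> \<in> ?W. \<omega> (\<phi> w) = z}. F (\<omega> \<circ> \<phi>)) = (\<Sum>\<omega>\<in>{\<omega> \<in> ?W. \<omega> (\<phi> w) = z}. F (h(w := z)))"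
      using w by (intro sum.cong[OF refl] depends_onD[OF F]) auto
    moreover have "{\<omega> \<in> ?W. \<omega> (\<phi> w) = z} = {\<omega> \<in> \<Omega>. \<forall>u \<in> insert w K. \<omega> (\<phi> u) = (h(w := z)) u}"
      using w by auto
    ultimately show "(\<Sum>\<omega>\<in>{\<omega> \<in> ?W. \<omega> (\<phi> w) = z}. F (\<omega> \<circ> \<phi>))
        = pcnt \<Omega> \<phi> (insert w K) (h(w := z)) * F (h(w := z))"
      unfolding pcnt_def by (simp only: sum_constant)
  qed
  finally show ?thesis by simp
qed

text \<open>The clique marginals are those of the pullbacks. The first vertex \<open>w\<close> is
  summed out: if it lies in \<open>C\<close>, then \<open>C\<close> is contained in \<open>w\<close>
  and its later neighbours \<open>?K\<close>, and a function of the clique \<open>?K\<close>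
  remains, to which the induction hypothesis applies; this is why \<open>C\<close> and
  \<open>F\<close> are arbitrary. If not, the conditional probabilities of \<open>w\<close> sum to 1
  and \<open>F\<close> is unchanged.\<close>

lemma markov_marginal:
  fixes F :: "('a \<Rightarrow> 'c) \<Rightarrow> real"
  assumes fin: "finite \<Omega>" "\<Omega> \<noteq> {}" "finite B"
    and B: "\<forall>\<omega>\<in>\<Omega>. \<forall>u\<in>set vs. \<omega> (\<phi> u) \<in> B"
    and peo: "peo H vs" and C: "clique H C" "C \<subseteq> set vs" and F: "depends_on C F"
  shows "(\<Sum>g\<in>PiE (set vs) (\<lambda>_. B). markov H \<Omega> \<phi> vs g * F g) = (\<Sum>\<omega>\<in>\<Omega>. F (\<omega> \<circ> \<phi>)) / card \<Omega>"
  using B peo C F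
proof (induction vs arbitrary: C F)
  case Nil
  have "F (\<omega> \<circ> \<phi>) = F (\<lambda>x. undefined)" for \<omega>
    by (rule depends_onD[OF Nil.prems(5)]) (use Nil.prems(4) in auto)
  then have "(\<Sum>\<omega>\<in>\<Omega>. F (\<omega> \<circ> \<phi>)) = (\<Sum>\<omega>\<in>\<Omega>. F (\<lambda>x. undefined))" by (simp only:)
  then show ?case using fin by (simp only: PiE_empty_domain list.set(1)) simp
next
  case (Cons w vs)
  let ?A = "set vs" and ?K = "nbrs H (set vs) w" and ?c = "pcnt \<Omega> \<phi>" and ?Q = "markov H \<Omega> \<phi> vs"
  let ?P = "PiE ?A (\<lambda>_. B)"
  have w: "w \<notin> ?A" "w \<notin> ?K" and KA: "?K \<subseteq> ?A" and Kcl: "clique H ?K" and peo: "peo H vs"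
    using Cons.prems(2) by (auto simp: nbrs_def)
  have B': "\<forall>\<omega>\<in>\<Omega>. \<forall>u\<in>set vs. \<omega> (\<phi> u) \<in> B" and Bw: "\<forall>\<omega>\<in>\<Omega>. \<omega> (\<phi> w) \<in> B"
    using Cons.prems(1) by simp_all
  note IH = Cons.IH[OF B' peo]
  define F' where "F' g = (\<Sum>z\<in>B. ?c (insert w ?K) (g(w := z)) / ?c ?K g * F (g(w := z)))" for g
  have step: "markov H \<Omega> \<phi> (w # vs) (g(w := z)) = ?c (insert w ?K) (g(w := z)) / ?c ?K g * ?Q g" for g z
  proof -
    have "?c ?K (g(w := z)) = ?c ?K g" using w by (intro pcnt_cong) auto
    moreover have "?Q (g(w := z)) = ?Q g" using w by (intro markov_cong) auto
    ultimately show ?thesis by simp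
  qed
  have "(\<Sum>g\<in>PiE (set (w # vs)) (\<lambda>_. B). markov H \<Omega> \<phi> (w # vs) g * F g) = (\<Sum>g\<in>?P. ?Q g * F' g)"
    unfolding list.set(2) sum_PiE_insert[OF w(1)] step F'_def sum_distrib_left
    by (intro sum.cong refl) (simp add: mult_ac)
  also have "\<dots> = (\<Sum>\<omega>\<in>\<Omega>. F (\<omega> \<circ> \<phi>)) / card \<Omega>"
  proof (cases "w \<in> C")
    case True
    have CK: "C \<subseteq> insert w ?K" using True Cons.prems(3,4) by (auto simp: clique_def nbrs_def)
    have FK: "depends_on (insert w ?K) F"
      using Cons.prems(5) CK unfolding depends_on_def by blast
    have F'K: "depends_on ?K F'"
    proof (rule depends_onI)
      fix g g' :: "'a \<Rightarrow> 'c" assume g: "\<And>u. u \<in> ?K \<Longrightarrow> g u = g' u"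
      have "?c (insert w ?K) (g(w := z)) = ?c (insert w ?K) (g'(w := z))" for z
        by (rule pcnt_cong) (use g in auto)
      moreover have "?c ?K g = ?c ?K g'" using g by (rule pcnt_cong)
      moreover have "F (g(w := z)) = F (g'(w := z))" for z by (rule depends_onD[OF FK]) (use g in auto)
      ultimately show "F' g = F' g'" by (simp add: F'_def)
    qed
    have F'eq: "F' h = (\<Sum>\<omega>\<in>{\<omega> \<in> \<Omega>. \<forall>u \<in> ?K. \<omega> (\<phi> u) = h u}. F (\<omega> \<circ> \<phi>)) / ?c ?K h" for h
      using sum_pcnt_extend[where F = F and w = w and K = ?K and \<phi> = \<phi>, OF fin(1,3) Bw w(2) FK, of h]
      by (simp add: F'_def sum_divide_distrib[symmetric])
    \<comment> \<open>\<open>F'\<close> at a pullback is the mean of \<open>F\<close> over a fibre;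
      exchanging the sums is the tower property of conditional expectations.\<close>
    let ?t = "\<lambda>\<omega> \<omega>'. if \<omega>' \<in> fibre \<Omega> (\<phi> ` ?K) \<omega> then F (\<omega>' \<circ> \<phi>) / card (fibre \<Omega> (\<phi> ` ?K) \<omega>) else 0"
    have "(\<Sum>\<omega>\<in>\<Omega>. F' (\<omega> \<circ> \<phi>)) = (\<Sum>\<omega>\<in>\<Omega>. \<Sum>\<omega>'\<in>\<Omega>. ?t \<omega> \<omega>')"
    proof (rule sum.cong[OF refl])
      fix \<omega> assume "\<omega> \<in> \<Omega>"
      have "{\<omega>' \<in> \<Omega>. \<forall>u \<in> ?K. \<omega>' (\<phi> u) = (\<omega> \<circ> \<phi>) u} = \<Omega> \<inter> fibre \<Omega> (\<phi> ` ?K) \<omega>"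
        by (auto simp: fibre_def)
      then have "F' (\<omega> \<circ> \<phi>) = (\<Sum>\<omega>'\<in>\<Omega> \<inter> fibre \<Omega> (\<phi> ` ?K) \<omega>. F (\<omega>' \<circ> \<phi>) / card (fibre \<Omega> (\<phi> ` ?K) \<omega>))"
        unfolding F'eq pcnt_pullback by (simp add: sum_divide_distrib)
      then show "F' (\<omega> \<circ> \<phi>) = (\<Sum>\<omega>'\<in>\<Omega>. ?t \<omega> \<omega>')"
        using fin(1) by (simp add: sum.inter_restrict)
    qed
    also have "\<dots> = (\<Sum>\<omega>'\<in>\<Omega>. \<Sum>\<omega>\<in>\<Omega>. ?t \<omega> \<omega>')"
      by (rule sum.swap)
    also have "\<dots> = (\<Sum>\<omega>'\<in>\<Omega>. F (\<omega>' \<circ> \<phi>))"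
    proof (rule sum.cong[OF refl])
      fix \<omega>' assume \<omega>': "\<omega>' \<in> \<Omega>"
      have "(\<Sum>\<omega>\<in>\<Omega>. ?t \<omega> \<omega>')
        = (\<Sum>\<omega>\<in>\<Omega>. if \<omega> \<in> fibre \<Omega> (\<phi> ` ?K) \<omega>' then F (\<omega>' \<circ> \<phi>) * (1 / card (fibre \<Omega> (\<phi> ` ?K) \<omega>)) else 0)"
        using \<omega>' by (intro sum.cong) (auto simp: fibre_def)
      also have "\<dots> = (\<Sum>\<omega>\<in>\<Omega> \<inter> fibre \<Omega> (\<phi> ` ?K) \<omega>'. F (\<omega>' \<circ> \<phi>) * (1 / card (fibre \<Omega> (\<phi> ` ?K) \<omega>)))"
        using fin(1) by (simp only: sum.inter_restrict)
      also have "\<Omega> \<inter> fibre \<Omega> (\<phi> ` ?K) \<omega>' = fibre \<Omega> (\<phi> ` ?K) \<omega>'" by (auto simp: fibre_def)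
      finally show "(\<Sum>\<omega>\<in>\<Omega>. ?t \<omega> \<omega>')
        = F (\<omega>' \<circ> \<phi>)"
        using sum_fibre_inverse[OF fin(1) \<omega>', of "\<phi> ` ?K"] by (simp only: sum_distrib_left[symmetric])
    qed
    finally show ?thesis by (simp only: IH[OF Kcl KA F'K])
  next
    case False
    \<comment> \<open>Where the marginal on \<open>?K\<close> vanishes, the quotients are 0 and do
      not sum to 1. The induction hypothesis for the indicator of this event shows that it carries
      no mass.\<close>
    have zero: "?Q g = 0" if "g \<in> ?P" "?c ?K g = 0" for g
    proof -
      let ?Z = "\<lambda>g. of_bool (?c ?K g = 0) :: real"
      have "(\<Sum>g\<in>?P. ?Q g * ?Z g) = (\<Sum>\<omega>\<in>\<Omega>. ?Z (\<omega> \<circ> \<phi>)) / card \<Omega>"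
      proof (rule IH[OF Kcl KA], rule depends_onI)
        fix g g' :: "'a \<Rightarrow> 'c" assume "\<And>u. u \<in> ?K \<Longrightarrow> g u = g' u"
        then have "?c ?K g = ?c ?K g'" by (rule pcnt_cong)
        then show "?Z g = ?Z g'" by simp
      qed
      also have "\<dots> = 0"
        using card_fibre_pos[OF fin(1)] by (auto simp: pcnt_pullback sum_nonneg_eq_0_iff[OF fin(1)])
      finally have "(\<Sum>g\<in>?P. ?Q g * ?Z g) = 0" .
      moreover have "finite ?P" using fin(3) by (simp add: finite_PiE)
      ultimately have "?Q g * ?Z g = 0"
        using that(1) markov_nonneg by (subst (asm) sum_nonneg_eq_0_iff) auto
      then show ?thesis using that(2) by simp
    qed
    have "?Q g * F' g = ?Q g * F g" if g: "g \<in> ?P" for g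
    proof (cases "?c ?K g = 0")
      case True
      then show ?thesis using zero[OF g] by simp
    next
      case nz: False
      have "F (g(w := z)) = F g" for z by (rule depends_onD[OF Cons.prems(5)]) (use False in auto)
      then have "F' g = (\<Sum>z\<in>B. ?c (insert w ?K) (g(w := z)) * 1) / ?c ?K g * F g"
        by (simp add: F'_def sum_divide_distrib sum_distrib_right)
      also have "(\<Sum>z\<in>B. ?c (insert w ?K) (g(w := z)) * 1) = ?c ?K g"
        using sum_pcnt_extend[where F = "\<lambda>_. 1" and w = w and K = ?K and \<phi> = \<phi>, OF fin(1,3) Bw w(2), of g]
        by (simp only: depends_on_def) (simp add: pcnt_def)
      finally show ?thesis using nz by simp
    qed
    then have "(\<Sum>g\<in>?P. ?Q g * F' g) = (\<Sum>g\<in>?P. ?Q g * F g)" by (rule sum.cong[OF refl])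
    also have "\<dots> = (\<Sum>\<omega>\<in>\<Omega>. F (\<omega> \<circ> \<phi>)) / card \<Omega>"
      by (rule IH[OF Cons.prems(3) _ Cons.prems(5)]) (use False Cons.prems(4) in auto)
    finally show ?thesis .
  qed
  finally show ?case .
qed

text \<open>Comparison with the uniform distribution on \<open>M\<close>, by
  \<open>ln t \<le> t - 1\<close> at \<open>t = 1 / (Q g * card M)\<close>.\<close>

lemma gibbs_support:
  fixes Q :: "'x \<Rightarrow> real"
  assumes fin: "finite P" and nn: "\<And>g. g \<in> P \<Longrightarrow> 0 \<le> Q g" and one: "(\<Sum>g\<in>P. Q g) = 1"
    and M: "{g \<in> P. 0 < Q g} \<subseteq> M" "finite M"
  shows "(\<Sum>g\<in>P. - (Q g * ln (Q g))) \<le> ln (card M)"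
proof -
  let ?P = "{g \<in> P. 0 < Q g}"
  have restr: "(\<Sum>g\<in>P. Q g * f g) = (\<Sum>g\<in>?P. Q g * f g)" for f
    using fin nn by (intro sum.mono_neutral_right) (auto simp: less_eq_real_def)
  have one': "(\<Sum>g\<in>?P. Q g) = 1" using restr[of "\<lambda>_. 1"] one by simp
  then have "?P \<noteq> {}" by force
  then have "M \<noteq> {}" using M(1) by blast
  then have m: "0 < card M" using M(2) by (simp add: card_gt_0_iff)
  have "(\<Sum>g\<in>P. - (Q g * ln (Q g))) - ln (card M) = (\<Sum>g\<in>?P. Q g * (- ln (Q g) - ln (card M)))"
    using restr[of "\<lambda>g. - ln (Q g)"] one'
    by (simp add: right_diff_distrib sum_subtractf sum_distrib_right[symmetric])
  also have "\<dots> \<le> (\<Sum>g\<in>?P. Q g * (1 / (Q g * card M) - 1))"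
  proof (intro sum_mono mult_left_mono)
    fix g assume g: "g \<in> ?P"
    then have "ln (1 / (Q g * card M)) \<le> 1 / (Q g * card M) - 1"
      using m by (intro ln_le_minus_one) simp
    then show "- ln (Q g) - ln (card M) \<le> 1 / (Q g * card M) - 1"
      using g m by (simp add: ln_div ln_mult)
  qed auto
  also have "\<dots> = (\<Sum>g\<in>?P. 1 / card M - Q g)"
    by (intro sum.cong) (auto simp: field_simps)
  also have "\<dots> = card ?P / card M - 1" using one' by (simp add: sum_subtractf)
  also have "\<dots> \<le> 0" using m card_mono[OF M(2,1)] by simp
  finally show ?thesis by simp
qed

lemma chain_rank_ent_le_hom:
  assumes H: "pair_graph H" "peo H vs" "set vs = pverts H"
    and H': "pair_graph H'" and G: "pair_graph G" and \<phi>: "\<phi> \<in> homs H H'" and ne: "homs H' G \<noteq> {}"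
  shows "chain_rank H (\<lambda>S. ent (homs H' G) (\<phi> ` S)) vs \<le> ln (hom H G)"
proof -
  let ?\<Omega> = "homs H' G" and ?B = "pverts G" and ?P = "PiE (set vs) (\<lambda>_. pverts G)"
  let ?Q = "markov H ?\<Omega> \<phi> vs" and ?c = "pcnt ?\<Omega> \<phi>"
  have finG: "finite ?B" using pair_graph_finite[OF G] .
  have \<phi>V: "\<phi> u \<in> pverts H'" if "u \<in> set vs" for u using \<phi> that H(3) by (auto simp: homs_def)
  have B: "\<forall>\<omega>\<in>?\<Omega>. \<forall>u\<in>set vs. \<omega> (\<phi> u) \<in> ?B"
    using \<phi>V by (auto simp: homs_def)
  note marg = markov_marginal[OF finite_homs[OF H' G] ne finG B H(2)]
  have finP: "finite ?P" by (simp add: finite_PiE finG)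
  have one: "(\<Sum>g\<in>?P. ?Q g) = 1"
    using marg[of "{}" "\<lambda>_. 1"] ne finite_homs[OF H' G] by (simp add: clique_def depends_on_def)
  \<comment> \<open>The weight stays that of the whole list \<open>vs\<close> while the information
    is that of \<open>us\<close>, so the induction merely splits a sum whose terms
    \<open>marg\<close> evaluates.\<close>
  have info: "(\<Sum>g\<in>?P. ?Q g * markov_info H ?\<Omega> \<phi> us g) = chain_rank H (\<lambda>S. ent ?\<Omega> (\<phi> ` S)) us"
    if "peo H us" "set us \<subseteq> set vs" for us
    using that
  proof (induction us)
    case (Cons w us)
    let ?K = "nbrs H (set us) w"
    let ?F = "\<lambda>g. ln (?c ?K g) - ln (?c (insert w ?K) g)"
    have "(\<Sum>g\<in>?P. ?Q g * ?F g) = (\<Sum>\<omega>\<in>?\<Omega>. ?F (\<omega> \<circ> \<phi>)) / card ?\<Omega>"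
    proof (rule marg[of "insert w ?K"])
      show "clique H (insert w ?K)" by (rule clique_insert_nbrs[OF H(1) Cons.prems(1)])
      show "insert w ?K \<subseteq> set vs" using Cons.prems by (auto simp: nbrs_def)
      show "depends_on (insert w ?K) ?F"
      proof (rule depends_onI)
        fix g g' :: "'a \<Rightarrow> 'c" assume g: "\<And>u. u \<in> insert w ?K \<Longrightarrow> g u = g' u"
        have "?c ?K g = ?c ?K g'" "?c (insert w ?K) g = ?c (insert w ?K) g'"
          by (intro pcnt_cong g; simp)+
        then show "?F g = ?F g'" by simp
      qed
    qed
    also have "\<dots> = ent ?\<Omega> (\<phi> ` insert w ?K) - ent ?\<Omega> (\<phi> ` ?K)"
      unfolding pcnt_pullback ent_def by (simp add: sum_subtractf diff_divide_distrib)
    finally show ?case using Cons by (simp add: distrib_left sum.distrib)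
  qed simp
  have ln_markov: "ln (markov H ?\<Omega> \<phi> us g) = - markov_info H ?\<Omega> \<phi> us g" if "0 < markov H ?\<Omega> \<phi> us g" for us g
    using that
  proof (induction us)
    case (Cons w us)
    let ?K = "nbrs H (set us) w"
    have "0 < ?c (insert w ?K) g" "0 < ?c ?K g" "0 < markov H ?\<Omega> \<phi> us g"
      using markov_Cons_pos[OF Cons.prems] by simp_all
    with Cons show ?case by (simp add: ln_mult ln_div)
  qed simp
  \<comment> \<open>Each edge of \<open>H\<close> lies in the clique formed by one vertex and its
    later neighbours. There a \<open>g\<close> of positive weight coincides with the pullback of
    some \<open>\<omega>\<close>, which preserves arcs since both \<open>\<omega>\<close> and
    \<open>\<phi>\<close> do.\<close>
  have supp: "g \<in> homs H G" if g: "g \<in> ?P" "0 < ?Q g" for g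
  proof -
    have "(u, v) \<in> parcs H \<longrightarrow> (g u, g v) \<in> parcs G"
      if "peo H us" "0 < markov H ?\<Omega> \<phi> us g" "u \<in> set us" "v \<in> set us" for us u v
      using that
    proof (induction us)
      case (Cons w us)
      let ?K = "nbrs H (set us) w"
      have pos: "0 < ?c (insert w ?K) g" "0 < markov H ?\<Omega> \<phi> us g"
        using markov_Cons_pos[OF Cons.prems(2)] by simp_all
      then obtain \<omega> where \<omega>: "\<omega> \<in> ?\<Omega>" "\<And>x. x \<in> insert w ?K \<Longrightarrow> \<omega> (\<phi> x) = g x"
        unfolding pcnt_def by (auto simp: card_gt_0_iff)
      have edge: "(g x, g y) \<in> parcs G" if "x \<in> insert w ?K" "y \<in> insert w ?K" "(x, y) \<in> parcs H" for x y
      proof -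
        have "(\<phi> x, \<phi> y) \<in> parcs H'" using \<phi> that by (auto simp: homs_def)
        then have "(\<omega> (\<phi> x), \<omega> (\<phi> y)) \<in> parcs G" using \<omega>(1) by (auto simp: homs_def)
        then show ?thesis using \<omega>(2) that by simp
      qed
      show ?case
      proof
        assume uv: "(u, v) \<in> parcs H"
        have "u \<noteq> v" using uv pair_graph_irrefl[OF H(1)] by auto
        then consider "u \<in> set us" "v \<in> set us" | "u = w" "v \<in> ?K" | "v = w" "u \<in> ?K"
          using Cons.prems(3,4) uv pair_graph_sym[OF H(1) uv] by (auto simp: nbrs_def)
        then show "(g u, g v) \<in> parcs G"
          using Cons.IH Cons.prems(1) pos edge uv by cases auto
      qed
    qed simp
    then show ?thesis
      using g H pair_graph_verts[OF H(1)] by (auto simp: homs_def)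
  qed
  have "chain_rank H (\<lambda>S. ent ?\<Omega> (\<phi> ` S)) vs = (\<Sum>g\<in>?P. ?Q g * markov_info H ?\<Omega> \<phi> vs g)"
    using info[OF H(2)] by simp
  also have "\<dots> = (\<Sum>g\<in>?P. - (?Q g * ln (?Q g)))"
  proof (rule sum.cong[OF refl])
    show "?Q g * markov_info H ?\<Omega> \<phi> vs g = - (?Q g * ln (?Q g))" for g
      using ln_markov[of vs g] markov_nonneg[of H ?\<Omega> \<phi> vs g] by (cases "?Q g = 0") auto
  qed
  also have "\<dots> \<le> ln (card (homs H G))"
    using supp markov_nonneg one by (intro gibbs_support finP finite_homs[OF H(1) G]) auto
  finally show ?thesis by (simp add: hom_def)
qed

section \<open>Fourier--Motzkin elimination over the rationals\<close>

text \<open>Functions of total valuations with a separate index set \<open>I\<close>: eliminating a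
  variable shrinks \<open>I\<close> and keeps the type.\<close>

definition ratlin :: "'k set \<Rightarrow> (('k \<Rightarrow> real) \<Rightarrow> real) \<Rightarrow> bool" where
  "ratlin I F \<longleftrightarrow> (\<exists>a. (\<forall>i. a i \<in> \<rat>) \<and> F = (\<lambda>x. \<Sum>i\<in>I. a i * x i))"

definition ratsys :: "'k set \<Rightarrow> (('k \<Rightarrow> real) \<Rightarrow> bool) \<Rightarrow> bool" where
  "ratsys I P \<longleftrightarrow> (\<exists>\<F>. finite \<F> \<and> (\<forall>F \<in> \<F>. ratlin I F) \<and> P = (\<lambda>x. \<forall>F \<in> \<F>. 0 \<le> F x))"

lemma ratlin_zero: "ratlin I (\<lambda>x. 0)"
  unfolding ratlin_def by (intro exI[of _ "\<lambda>_. 0"]) simp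

lemma ratlin_var: "finite I \<Longrightarrow> i \<in> I \<Longrightarrow> ratlin I (\<lambda>x. x i)"
  unfolding ratlin_def
  by (intro exI[of _ "\<lambda>j. if j = i then 1 else 0"]) (auto simp: if_distrib[of "\<lambda>a. a * _"] cong: if_cong)

lemma ratlin_add:
  assumes "ratlin I F" "ratlin I G"
  shows "ratlin I (\<lambda>x. F x + G x)"
proof -
  obtain a b where "\<forall>i. a i \<in> \<rat>" "F = (\<lambda>x. \<Sum>i\<in>I. a i * x i)" "\<forall>i. b i \<in> \<rat>" "G = (\<lambda>x. \<Sum>i\<in>I. b i * x i)"
    using assms unfolding ratlin_def by blast
  then show ?thesis unfolding ratlin_def
    by (intro exI[of _ "\<lambda>i. a i + b i"]) (auto simp: sum.distrib distrib_right)
qed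

lemma ratlin_scale:
  assumes "ratlin I F" "c \<in> \<rat>"
  shows "ratlin I (\<lambda>x. c * F x)"
proof -
  obtain a where "\<forall>i. a i \<in> \<rat>" "F = (\<lambda>x. \<Sum>i\<in>I. a i * x i)"
    using assms unfolding ratlin_def by blast
  then show ?thesis unfolding ratlin_def using assms(2)
    by (intro exI[of _ "\<lambda>i. c * a i"]) (auto simp: sum_distrib_left mult.assoc)
qed

lemma ratlin_diff: "ratlin I F \<Longrightarrow> ratlin I G \<Longrightarrow> ratlin I (\<lambda>x. F x - G x)"
  using ratlin_add[of I F "\<lambda>x. -1 * G x"] ratlin_scale[of I G "-1"] by simp

lemma ratsys_le:
  assumes "ratlin I F" "ratlin I G"
  shows "ratsys I (\<lambda>x. F x \<le> G x)"
  unfolding ratsys_def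
  by (intro exI[of _ "{\<lambda>x. G x - F x}"]) (use ratlin_diff[OF assms(2,1)] in auto)

lemma ratsys_True: "ratsys I (\<lambda>x. True)"
  unfolding ratsys_def by (intro exI[of _ "{}"]) simp

lemma ratsys_conj:
  assumes "ratsys I P" "ratsys I Q"
  shows "ratsys I (\<lambda>x. P x \<and> Q x)"
proof -
  obtain A B where "finite A" "\<forall>F \<in> A. ratlin I F" "P = (\<lambda>x. \<forall>F \<in> A. 0 \<le> F x)"
    "finite B" "\<forall>F \<in> B. ratlin I F" "Q = (\<lambda>x. \<forall>F \<in> B. 0 \<le> F x)"
    using assms unfolding ratsys_def by blast
  then show ?thesis unfolding ratsys_def by (intro exI[of _ "A \<union> B"]) auto
qed

lemma ratsys_ball:
  assumes "finite A" "\<And>a. a \<in> A \<Longrightarrow> ratsys I (P a)"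
  shows "ratsys I (\<lambda>x. \<forall>a \<in> A. P a x)"
  using assms
proof (induction rule: finite_induct)
  case (insert a A)
  then have "ratsys I (\<lambda>x. P a x \<and> (\<forall>a \<in> A. P a x))" by (intro ratsys_conj) auto
  then show ?case by simp
qed (simp add: ratsys_True)

lemma ratlin_split:
  assumes "finite I" "i \<notin> I" "ratlin (insert i I) F"
  shows "\<exists>c R. c \<in> \<rat> \<and> ratlin I R \<and> (\<forall>x t. F (x(i := t)) = c * t + R x)"
proof -
  obtain a where a: "\<forall>i. a i \<in> \<rat>" "F = (\<lambda>x. \<Sum>j\<in>insert i I. a j * x j)"
    using assms(3) unfolding ratlin_def by blast
  have "F (x(i := t)) = a i * t + (\<Sum>j\<in>I. a j * x j)" for x t
  proof -
    have "(\<Sum>j\<in>I. a j * (x(i := t)) j) = (\<Sum>j\<in>I. a j * x j)"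
      using assms(2) by (intro sum.cong) auto
    then show ?thesis using assms a by simp
  qed
  moreover have "ratlin I (\<lambda>x. \<Sum>j\<in>I. a j * x j)" using a unfolding ratlin_def by blast
  ultimately show ?thesis using a(1) by blast
qed

lemma ratsys_split:
  fixes P :: "('k \<Rightarrow> real) \<Rightarrow> bool"
  assumes "finite I" "i \<notin> I" "ratsys (insert i I) P"
  obtains \<F> :: "(('k \<Rightarrow> real) \<Rightarrow> real) set" and c R where "finite \<F>" "\<And>F. F \<in> \<F> \<Longrightarrow> c F \<in> \<rat>" "\<And>F. F \<in> \<F> \<Longrightarrow> ratlin I (R F)"
    "\<And>x t. P (x(i := t)) \<longleftrightarrow> (\<forall>F \<in> \<F>. 0 \<le> c F * t + R F x)"
proof -
  obtain \<F> where \<F>: "finite \<F>" "\<forall>F \<in> \<F>. ratlin (insert i I) F" "P = (\<lambda>x. \<forall>F \<in> \<F>. 0 \<le> F x)"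
    using assms(3) unfolding ratsys_def by blast
  have "\<forall>F \<in> \<F>. \<exists>cR. fst cR \<in> \<rat> \<and> ratlin I (snd cR) \<and> (\<forall>x t. F (x(i := t)) = fst cR * t + snd cR x)"
  proof
    fix F assume "F \<in> \<F>"
    with \<F>(2) have "ratlin (insert i I) F" by blast
    from ratlin_split[OF assms(1,2) this] obtain c R
      where "c \<in> \<rat>" "ratlin I R" "\<forall>x t. F (x(i := t)) = c * t + R x" by blast
    then show "\<exists>cR. fst cR \<in> \<rat> \<and> ratlin I (snd cR) \<and> (\<forall>x t. F (x(i := t)) = fst cR * t + snd cR x)"
      by (intro exI[of _ "(c, R)"]) simp
  qed
  from bchoice[OF this] obtain f where f: "\<forall>F \<in> \<F>. fst (f F) \<in> \<rat> \<and> ratlin I (snd (f F))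
      \<and> (\<forall>x t. F (x(i := t)) = fst (f F) * t + snd (f F) x)"
    by (rule exE)
  show thesis
  proof (rule that[of \<F> "\<lambda>F. fst (f F)" "\<lambda>F. snd (f F)"])
    show "P (x(i := t)) \<longleftrightarrow> (\<forall>F \<in> \<F>. 0 \<le> fst (f F) * t + snd (f F) x)" for x t
      unfolding \<F>(3) using f by simp
  qed (use \<F>(1) f in simp_all)
qed

lemma between_finite_sets:
  fixes L U :: "real set"
  assumes "finite L" "finite U" "\<And>l u. l \<in> L \<Longrightarrow> u \<in> U \<Longrightarrow> l \<le> u"
  shows "\<exists>t. (\<forall>l \<in> L. l \<le> t) \<and> (\<forall>u \<in> U. t \<le> u)"
proof (cases "L = {}")
  case True
  show ?thesis
  proof (cases "U = {}")
    case False
    with True assms show ?thesis by (intro exI[of _ "Min U"]) simp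
  qed (use True in simp)
next
  case False
  with assms show ?thesis by (intro exI[of _ "Max L"]) auto
qed

text \<open>A rational number from the interval is clamped to the range between \<open>Max L\<close>
  and \<open>Min U\<close>; the strict inequalities with \<open>a\<close> and \<open>b\<close> keep
  the clamped value inside the interval.\<close>

lemma rational_between_finite_sets:
  fixes L U :: "real set"
  assumes fin: "finite L" "finite U" and rat: "L \<subseteq> \<rat>" "U \<subseteq> \<rat>"
    and LU: "\<And>l u. l \<in> L \<Longrightarrow> u \<in> U \<Longrightarrow> l \<le> u"
    and ab: "a < b" "\<And>l. l \<in> L \<Longrightarrow> l < b" "\<And>u. u \<in> U \<Longrightarrow> a < u"
  shows "\<exists>t \<in> \<rat>. a < t \<and> t < b \<and> (\<forall>l \<in> L. l \<le> t) \<and> (\<forall>u \<in> U. t \<le> u)"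
proof -
  obtain r where r: "r \<in> \<rat>" "a < r" "r < b" using Rats_dense_in_real[OF ab(1)] by blast
  consider l where "l \<in> L" "r < l" | u where "u \<in> U" "u < r"
    | "\<forall>l \<in> L. l \<le> r" "\<forall>u \<in> U. r \<le> u" by force
  then show ?thesis
  proof cases
    case 1
    then have M: "Max L \<in> L" "r < Max L" using fin Max_in Max_ge by (blast, metis Max_ge order_less_le_trans)
    then have "a < Max L" "Max L < b" "Max L \<in> \<rat>" using r ab rat by auto
    then show ?thesis using M fin LU by (intro bexI[of _ "Max L"]) auto
  next
    case 2
    then have M: "Min U \<in> U" "Min U < r" using fin Min_in Min_le by (blast, metis Min_le order_le_less_trans)
    then have "a < Min U" "Min U < b" "Min U \<in> \<rat>" using r ab rat by auto
    then show ?thesis using M fin LU by (intro bexI[of _ "Min U"]) auto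
  next
    case 3
    then show ?thesis using r by blast
  qed
qed

lemma affine_pos: "0 < c \<Longrightarrow> 0 \<le> c * t + r \<longleftrightarrow> - r / c \<le> (t :: real)"
  by (simp only: pos_divide_le_eq mult.commute[of t]) linarith

lemma affine_neg: "c < 0 \<Longrightarrow> 0 \<le> c * t + r \<longleftrightarrow> (t :: real) \<le> - r / c"
  by (simp only: neg_le_divide_eq mult.commute[of t]) linarith

lemma fourier_motzkin_eliminate:
  fixes c r :: "'f \<Rightarrow> real"
  assumes "finite \<F>"
  shows "(\<exists>t. \<forall>F \<in> \<F>. 0 \<le> c F * t + r F) \<longleftrightarrow> (\<forall>F \<in> \<F>. c F = 0 \<longrightarrow> 0 \<le> r F) \<and>
    (\<forall>F \<in> \<F>. \<forall>G \<in> \<F>. 0 < c F \<and> c G < 0 \<longrightarrow> - r F / c F \<le> - r G / c G)" (is "?L \<longleftrightarrow> ?R")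
proof
  assume ?L
  then obtain t where t: "\<And>F. F \<in> \<F> \<Longrightarrow> 0 \<le> c F * t + r F" by blast
  show ?R
  proof (intro conjI ballI impI)
    fix F assume "F \<in> \<F>" "c F = 0"
    then show "0 \<le> r F" using t[of F] by simp
  next
    fix F G assume FG: "F \<in> \<F>" "G \<in> \<F>" "0 < c F \<and> c G < 0"
    have "- r F / c F \<le> t" using FG t[OF FG(1)] affine_pos by blast
    also have "t \<le> - r G / c G" using FG t[OF FG(2)] affine_neg by blast
    finally show "- r F / c F \<le> - r G / c G" .
  qed
next
  assume R: ?R
  let ?lo = "(\<lambda>F. - r F / c F) ` {F \<in> \<F>. 0 < c F}" and ?up = "(\<lambda>F. - r F / c F) ` {F \<in> \<F>. c F < 0}"
  have "\<exists>t. (\<forall>l \<in> ?lo. l \<le> t) \<and> (\<forall>u \<in> ?up. t \<le> u)"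
    by (rule between_finite_sets) (use assms R in auto)
  then obtain t where t: "\<And>F. F \<in> \<F> \<Longrightarrow> 0 < c F \<Longrightarrow> - r F / c F \<le> t" "\<And>F. F \<in> \<F> \<Longrightarrow> c F < 0 \<Longrightarrow> t \<le> - r F / c F"
    by auto
  have "0 \<le> c F * t + r F" if F: "F \<in> \<F>" for F
  proof -
    consider "c F = 0" | "0 < c F" | "c F < 0" by linarith
    then show ?thesis
    proof cases
      case 1
      then show ?thesis using R F by simp
    next
      case 2
      then show ?thesis using t(1)[OF F 2] affine_pos by blast
    next
      case 3
      then show ?thesis using t(2)[OF F 3] affine_neg by blast
    qed
  qed
  then show ?L by blast
qed

lemma ratsys_ex:
  assumes I: "finite I" "i \<notin> I" and P: "ratsys (insert i I) P"
  shows "ratsys I (\<lambda>x. \<exists>t. P (x(i := t)))"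
proof -
  obtain \<F> :: "(('a \<Rightarrow> real) \<Rightarrow> real) set" and c R
    where \<F>: "finite \<F>" "\<And>F. F \<in> \<F> \<Longrightarrow> c F \<in> \<rat>" "\<And>F. F \<in> \<F> \<Longrightarrow> ratlin I (R F)"
    "\<And>x t. P (x(i := t)) \<longleftrightarrow> (\<forall>F \<in> \<F>. 0 \<le> c F * t + R F x)"
    using ratsys_split[OF I P] by metis
  have eq: "(\<exists>t. P (x(i := t))) \<longleftrightarrow> (\<forall>F \<in> {F \<in> \<F>. c F = 0}. 0 \<le> R F x) \<and>
    (\<forall>FG \<in> {F \<in> \<F>. 0 < c F} \<times> {G \<in> \<F>. c G < 0}.
      - 1 / c (fst FG) * R (fst FG) x \<le> - 1 / c (snd FG) * R (snd FG) x)" for x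
    unfolding \<F>(4) fourier_motzkin_eliminate[OF \<F>(1)] by auto
  have "ratsys I (\<lambda>x. (\<forall>F \<in> {F \<in> \<F>. c F = 0}. 0 \<le> R F x) \<and>
    (\<forall>FG \<in> {F \<in> \<F>. 0 < c F} \<times> {G \<in> \<F>. c G < 0}.
      - 1 / c (fst FG) * R (fst FG) x \<le> - 1 / c (snd FG) * R (snd FG) x))"
    using \<F>(1-3) by (intro ratsys_conj ratsys_ball ratsys_le ratlin_zero ratlin_scale Rats_divide) auto
  then show ?thesis by (simp only: eq)
qed

lemma ratsys_ex_many:
  assumes "finite I" "finite J" "I \<inter> J = {}" "ratsys (J \<union> I) P"
  shows "ratsys I (\<lambda>x. \<exists>z. P (\<lambda>k. if k \<in> J then z k else x k))"
  using assms(2,1,3,4)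
proof (induction arbitrary: I P rule: finite_induct)
  case empty
  then show ?case by simp
next
  case (insert j J)
  have "ratsys (insert j I) (\<lambda>x. \<exists>z. P (\<lambda>k. if k \<in> J then z k else x k))"
    using insert by (intro insert.IH) auto
  then have "ratsys I (\<lambda>x. \<exists>t z. P (\<lambda>k. if k \<in> J then z k else (x(j := t)) k))"
    using insert by (intro ratsys_ex) auto
  moreover have eq: "(\<exists>t z. P (\<lambda>k. if k \<in> J then z k else (x(j := t)) k))
    \<longleftrightarrow> (\<exists>z. P (\<lambda>k. if k \<in> insert j J then z k else x k))" for x
  proof
    assume "\<exists>t z. P (\<lambda>k. if k \<in> J then z k else (x(j := t)) k)"
    then obtain t z where "P (\<lambda>k. if k \<in> J then z k else (x(j := t)) k)" by blast
    moreover have "(\<lambda>k. if k \<in> J then z k else (x(j := t)) k) = (\<lambda>k. if k \<in> insert j J then (z(j := t)) k else x k)"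
      using insert.hyps by auto
    ultimately show "\<exists>z. P (\<lambda>k. if k \<in> insert j J then z k else x k)" by metis
  next
    assume "\<exists>z. P (\<lambda>k. if k \<in> insert j J then z k else x k)"
    then obtain z where "P (\<lambda>k. if k \<in> insert j J then z k else x k)" by blast
    moreover have "(\<lambda>k. if k \<in> insert j J then z k else x k) = (\<lambda>k. if k \<in> J then z k else (x(j := z j)) k)"
      by auto
    ultimately show "\<exists>t z. P (\<lambda>k. if k \<in> J then z k else (x(j := t)) k)" by metis
  qed
  ultimately show ?case by (simp only: eq)
qed

section \<open>Density of rational points\<close>

lemma ratlin_continuous:
  assumes "ratlin I F" "0 < e"
  shows "\<exists>d>0. \<forall>x'. (\<forall>i \<in> I. \<bar>x' i - x i\<bar> < d) \<longrightarrow> \<bar>F x' - F x\<bar> < e"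
proof -
  obtain a where a: "F = (\<lambda>x. \<Sum>i\<in>I. a i * x i)" using assms(1) unfolding ratlin_def by blast
  define M where "M = (\<Sum>i\<in>I. \<bar>a i\<bar>) + 1"
  have M: "0 < M" by (simp add: M_def sum_nonneg add_nonneg_pos)
  show ?thesis
  proof (intro exI[of _ "e / M"] conjI allI impI)
    fix x' assume x': "\<forall>i \<in> I. \<bar>x' i - x i\<bar> < e / M"
    have "\<bar>F x' - F x\<bar> = \<bar>\<Sum>i\<in>I. a i * (x' i - x i)\<bar>"
      by (simp add: a sum_subtractf right_diff_distrib)
    also have "\<dots> \<le> (\<Sum>i\<in>I. \<bar>a i * (x' i - x i)\<bar>)" by (rule sum_abs)
    also have "\<dots> \<le> (\<Sum>i\<in>I. \<bar>a i\<bar> * (e / M))"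
    proof (rule sum_mono)
      fix i assume "i \<in> I"
      then have "\<bar>x' i - x i\<bar> \<le> e / M" using x' by (simp add: less_imp_le)
      then show "\<bar>a i * (x' i - x i)\<bar> \<le> \<bar>a i\<bar> * (e / M)"
        unfolding abs_mult by (rule mult_left_mono) simp
    qed
    also have "\<dots> = (M - 1) * (e / M)" by (simp only: M_def sum_distrib_right add_diff_cancel)
    also have "\<dots> < e" using M \<open>0 < e\<close> by (simp add: field_simps)
    finally show "\<bar>F x' - F x\<bar> < e" .
  qed (use M \<open>0 < e\<close> in simp)
qed

lemma uniform_radius:
  assumes "finite A" "\<And>a. a \<in> A \<Longrightarrow> \<exists>d>0. Q a (d::real)" "\<And>a d d'. Q a d \<Longrightarrow> 0 < d' \<Longrightarrow> d' \<le> d \<Longrightarrow> Q a d'"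
  shows "\<exists>d>0. \<forall>a \<in> A. Q a d"
  using assms(1,2)
proof (induction rule: finite_induct)
  case empty
  show ?case by (intro exI[of _ 1]) simp
next
  case (insert a A)
  then obtain d where "0 < d" "\<forall>b \<in> A. Q b d" by auto
  obtain d' where "0 < d'" "Q a d'" using insert.prems[of a] by auto
  have "Q b (min d d')" if "b \<in> insert a A" for b
  proof (cases "b = a")
    case True
    then show ?thesis using assms(3)[OF \<open>Q a d'\<close>, of "min d d'"] \<open>0 < d\<close> \<open>0 < d'\<close> by simp
  next
    case False
    then have "Q b d" using that \<open>\<forall>b \<in> A. Q b d\<close> by simp
    then show ?thesis using assms(3)[of b d "min d d'"] \<open>0 < d\<close> \<open>0 < d'\<close> by simp
  qed
  then show ?case using \<open>0 < d\<close> \<open>0 < d'\<close> by (intro exI[of _ "min d d'"]) simp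
qed

text \<open>The solution set may have empty interior, so perturbing all coordinates independently
  fails. Instead, the system with \<open>i\<close> eliminated is approximated by a rational point so
  close that the Fourier-Motzkin bounds on coordinate \<open>i\<close> move by less than
  \<open>e\<close>; between the new bounds, which are rational, a rational value near
  \<open>x i\<close> remains.\<close>

lemma ratsys_rational_dense:
  assumes "finite I" "ratsys I P" "P x" "0 < e"
  shows "\<exists>x'. P x' \<and> (\<forall>i \<in> I. x' i \<in> \<rat> \<and> \<bar>x' i - x i\<bar> < e)"
  using assms
proof (induction arbitrary: P e rule: finite_induct)
  case empty
  then show ?case by auto
next
  case (insert i I)
  obtain \<F> :: "(('a \<Rightarrow> real) \<Rightarrow> real) set" and c R
    where \<F>: "finite \<F>" "\<And>F. F \<in> \<F> \<Longrightarrow> c F \<in> \<rat>" "\<And>F. F \<in> \<F> \<Longrightarrow> ratlin I (R F)"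
    and PF: "\<And>x t. P (x(i := t)) \<longleftrightarrow> (\<forall>F \<in> \<F>. 0 \<le> c F * t + R F x)"
    using ratsys_split[OF insert.hyps insert.prems(1)] by metis
  define B where "B F x = - R F x / c F" for F x
  have Blin: "ratlin I (B F)" if "F \<in> \<F>" for F
    using ratlin_scale[OF \<F>(3)[OF that], of "- 1 / c F"] \<F>(2)[OF that] by (simp add: B_def[abs_def] Rats_divide)
  have "\<exists>d>0. \<forall>F \<in> \<F>. \<forall>x'. (\<forall>j \<in> I. \<bar>x' j - x j\<bar> < d) \<longrightarrow> \<bar>B F x' - B F x\<bar> < e"
  proof (rule uniform_radius[OF \<F>(1)])
    show "\<exists>d>0. \<forall>x'. (\<forall>j \<in> I. \<bar>x' j - x j\<bar> < d) \<longrightarrow> \<bar>B F x' - B F x\<bar> < e" if "F \<in> \<F>" for F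
      by (rule ratlin_continuous[OF Blin[OF that] \<open>0 < e\<close>])
  next
    fix F and d d' :: real
    assume *: "\<forall>x'. (\<forall>j \<in> I. \<bar>x' j - x j\<bar> < d) \<longrightarrow> \<bar>B F x' - B F x\<bar> < e" and "d' \<le> d"
    show "\<forall>x'. (\<forall>j \<in> I. \<bar>x' j - x j\<bar> < d') \<longrightarrow> \<bar>B F x' - B F x\<bar> < e"
    proof (intro allI impI)
      fix x' assume "\<forall>j \<in> I. \<bar>x' j - x j\<bar> < d'"
      then have "\<forall>j \<in> I. \<bar>x' j - x j\<bar> < d" using \<open>d' \<le> d\<close> by fastforce
      with * show "\<bar>B F x' - B F x\<bar> < e" by blast
    qed
  qed
  then obtain d where d: "0 < d"
    "\<And>F x'. F \<in> \<F> \<Longrightarrow> (\<And>j. j \<in> I \<Longrightarrow> \<bar>x' j - x j\<bar> < d) \<Longrightarrow> \<bar>B F x' - B F x\<bar> < e" by metis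
  have "\<exists>t. P (x(i := t))" using insert.prems(2) by (metis fun_upd_triv)
  then obtain x' where x': "\<exists>t. P (x'(i := t))" "\<And>j. j \<in> I \<Longrightarrow> x' j \<in> \<rat> \<and> \<bar>x' j - x j\<bar> < min d e"
  proof -
    have "0 < min d e" using d(1) \<open>0 < e\<close> by simp
    from insert.IH[OF ratsys_ex[OF insert.hyps insert.prems(1)] \<open>\<exists>t. P (x(i := t))\<close> this] that
    show thesis by blast
  qed
  have Px: "0 \<le> c F * x i + R F x" if "F \<in> \<F>" for F
    using PF[of x "x i"] insert.prems(2) that by simp
  have close: "\<bar>B F x' - B F x\<bar> < e" if "F \<in> \<F>" for F using d(2)[OF that, of x'] x'(2) by auto
  have FM: "\<And>F. F \<in> \<F> \<Longrightarrow> c F = 0 \<Longrightarrow> 0 \<le> R F x'"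
    "\<And>F G. F \<in> \<F> \<Longrightarrow> G \<in> \<F> \<Longrightarrow> 0 < c F \<Longrightarrow> c G < 0 \<Longrightarrow> B F x' \<le> B G x'"
    using x'(1) unfolding PF fourier_motzkin_eliminate[OF \<F>(1)] B_def by blast+
  have Brat: "B F x' \<in> \<rat>" if "F \<in> \<F>" for F
  proof -
    obtain a where a: "\<forall>i. a i \<in> \<rat>" "B F = (\<lambda>x. \<Sum>j\<in>I. a j * x j)"
      using Blin[OF \<open>F \<in> \<F>\<close>] unfolding ratlin_def by blast
    have "(\<Sum>j\<in>J. a j * x' j) \<in> \<rat>" if "finite J" "J \<subseteq> I" for J
      using that a(1) x'(2) by (induction rule: finite_induct) (auto intro!: Rats_add Rats_mult)
    then show ?thesis using a(2) insert.hyps(1) by simp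
  qed
  let ?L = "(\<lambda>F. B F x') ` {F \<in> \<F>. 0 < c F}" and ?U = "(\<lambda>F. B F x') ` {F \<in> \<F>. c F < 0}"
  have "\<exists>t \<in> \<rat>. x i - e < t \<and> t < x i + e \<and> (\<forall>l \<in> ?L. l \<le> t) \<and> (\<forall>u \<in> ?U. t \<le> u)"
  proof (rule rational_between_finite_sets)
    show "l < x i + e" if "l \<in> ?L" for l
    proof -
      obtain F where F: "F \<in> \<F>" "0 < c F" "l = B F x'" using \<open>l \<in> ?L\<close> by auto
      have "B F x \<le> x i" using Px[OF F(1)] affine_pos[OF F(2)] by (simp only: B_def)
      then show ?thesis using close[OF F(1)] F(3) by linarith
    qed
    show "x i - e < u" if "u \<in> ?U" for u
    proof -
      obtain F where F: "F \<in> \<F>" "c F < 0" "u = B F x'" using \<open>u \<in> ?U\<close> by auto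
      have "x i \<le> B F x" using Px[OF F(1)] affine_neg[OF F(2)] by (simp only: B_def)
      then show ?thesis using close[OF F(1)] F(3) by linarith
    qed
  qed (use \<F>(1) Brat FM(2) \<open>0 < e\<close> in auto)
  then obtain t where t: "t \<in> \<rat>" "x i - e < t" "t < x i + e"
    "\<And>F. F \<in> \<F> \<Longrightarrow> 0 < c F \<Longrightarrow> B F x' \<le> t" "\<And>F. F \<in> \<F> \<Longrightarrow> c F < 0 \<Longrightarrow> t \<le> B F x'" by auto
  have "0 \<le> c F * t + R F x'" if F: "F \<in> \<F>" for F
  proof -
    consider "c F = 0" | "0 < c F" | "c F < 0" by linarith
    then show ?thesis
    proof cases
      case 1
      then show ?thesis using FM(1) F by simp
    next
      case 2
      then show ?thesis using t(4)[OF F 2] affine_pos[OF 2] by (simp only: B_def)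
    next
      case 3
      then show ?thesis using t(5)[OF F 3] affine_neg[OF 3] by (simp only: B_def)
    qed
  qed
  then have "P (x'(i := t))" by (simp add: PF)
  moreover have "(x'(i := t)) j \<in> \<rat> \<and> \<bar>(x'(i := t)) j - x j\<bar> < e" if "j \<in> insert i I" for j
    using t(1-3) x'(2)[of j] that by (auto simp: abs_less_iff)
  ultimately show ?case by blast
qed

lemma common_denominator:
  assumes "finite I" "\<And>i. i \<in> I \<Longrightarrow> x i \<in> \<rat>"
  shows "\<exists>m::nat. 0 < m \<and> (\<forall>i \<in> I. real m * x i \<in> \<int>)"
  using assms
proof (induction rule: finite_induct)
  case empty
  then show ?case by auto
next
  case (insert i I)
  then obtain m where m: "0 < m" "\<forall>j \<in> I. real m * x j \<in> \<int>" by auto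
  obtain p q where pq: "q > 0" "x i = of_int p / of_int q"
    using insert.prems[of i] by (auto elim: Rats_cases')
  have "real (nat q * m) * x j = of_int q * (real m * x j)" for j using pq by simp
  then have "real (nat q * m) * x j \<in> \<int>" if "j \<in> I" for j using m that by (simp only: Ints_mult Ints_of_int)
  moreover have "real (nat q * m) * x i = real m * of_int p" using pq by simp
  then have "real (nat q * m) * x i \<in> \<int>" by (metis Ints_mult Ints_of_int Ints_of_nat)
  ultimately show ?case using m pq by (intro exI[of _ "nat q * m"]) simp
qed

text \<open>The summand \<open>'k\<close> belongs to eliminated variables. Their value 0 is a dummy,
  as the system reads only \<open>range Inl\<close>.\<close>

lemma ratsys_rational_polyhedral_cone:
  fixes P :: "('n::finite + 'k \<Rightarrow> real) \<Rightarrow> bool"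
  assumes "ratsys (range Inl) P"
  shows "rational_polyhedral_cone {y :: real ^ 'n. P (case_sum (($) y) (\<lambda>_. 0))}"
proof -
  obtain \<F> where \<F>: "finite \<F>" "\<forall>F \<in> \<F>. ratlin (range Inl) F" "P = (\<lambda>x. \<forall>F \<in> \<F>. 0 \<le> F x)"
    using assms unfolding ratsys_def by blast
  have "\<forall>F \<in> \<F>. \<exists>v :: real ^ 'n. (\<forall>i. v $ i \<in> \<rat>) \<and> (\<forall>y :: real ^ 'n. F (case_sum (($) y) (\<lambda>_. 0)) = v \<bullet> y)"
  proof
    fix F assume "F \<in> \<F>"
    then obtain a where a: "\<forall>i. a i \<in> \<rat>" "F = (\<lambda>x. \<Sum>i\<in>range Inl. a i * x i)"
      using \<F>(2) unfolding ratlin_def by blast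
    show "\<exists>v :: real ^ 'n. (\<forall>i. v $ i \<in> \<rat>) \<and> (\<forall>y :: real ^ 'n. F (case_sum (($) y) (\<lambda>_. 0)) = v \<bullet> y)"
      using a by (intro exI[of _ "\<chi> i. a (Inl i)"]) (simp add: inner_vec_def sum.reindex)
  qed
  from bchoice[OF this] obtain v where v: "\<forall>F \<in> \<F>. (\<forall>i. (v F :: real ^ 'n) $ i \<in> \<rat>) \<and> (\<forall>y :: real ^ 'n. F (case_sum (($) y) (\<lambda>_. 0)) = v F \<bullet> y)"
    by (rule exE)
  show ?thesis
    unfolding rational_polyhedral_cone_def
  proof (intro exI[of _ "v ` \<F>"] conjI)
    show "finite (v ` \<F>)" using \<F>(1) by simp
    show "\<forall>a \<in> v ` \<F>. \<forall>i. a $ i \<in> \<rat>" using v by simp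
    show "{y. P (case_sum (($) y) (\<lambda>_. 0))} = {x. \<forall>a \<in> v ` \<F>. 0 \<le> a \<bullet> x}"
      unfolding \<F>(3) using v by simp
  qed
qed

section \<open>Blow-ups realising integral polymatroids\<close>

text \<open>Generic in the values, since the ranks are real in the cone and natural numbers in the
  blow-ups.\<close>

definition clique_polymatroid :: "'a pair_pre_digraph \<Rightarrow> ('a set \<Rightarrow> 'r::{ord,plus,zero}) \<Rightarrow> bool" where
  "clique_polymatroid H q \<longleftrightarrow> q {} = 0 \<and> (\<forall>S T. clique H (S \<union> T) \<longrightarrow>
     q S \<le> q (S \<union> T) \<and> q (S \<union> T) + q (S \<inter> T) \<le> q S + q T)"

lemma clique_polymatroid_mono:
  assumes "clique_polymatroid H q" "clique H T" "S \<subseteq> T"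
  shows "q S \<le> q T"
proof -
  have "S \<union> T = T" using assms(3) by blast
  then show ?thesis using assms(1,2) unfolding clique_polymatroid_def by metis
qed

lemma clique_polymatroid_submod:
  assumes "clique_polymatroid H q" "clique H Q" "S \<union> T = Q" "S \<inter> T = R"
  shows "q Q + q R \<le> q S + q T"
  using assms unfolding clique_polymatroid_def by metis

lemma subset_card_lessThan:
  assumes "finite A" "m + d \<le> card A"
  shows "\<exists>B i. B \<subseteq> A \<and> card B = m \<and> inj_on i {..<d} \<and> i ` {..<d} \<subseteq> A - B"
proof -
  obtain B where B: "B \<subseteq> A" "card B = m" "finite B"
    using obtain_subset_with_card_n[of m A] assms(2) by auto
  then have "d \<le> card (A - B)" using assms by (simp add: card_Diff_subset)
  then obtain D where D: "D \<subseteq> A - B" "card D = d" "finite D"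
    by (rule obtain_subset_with_card_n)
  obtain i where "bij_betw i {0..<card D} D" using ex_bij_betw_nat_finite[OF D(3)] by blast
  then have "inj_on i {..<d}" "i ` {..<d} = D" using D(2) by (auto simp: bij_betw_def lessThan_atLeast0)
  then show ?thesis using B D by blast
qed

text \<open>The numbers \<open>p\<^sub>w, p\<^sub>u\<^sub>w, p\<^sub>v\<^sub>w, p\<^sub>u\<^sub>v\<^sub>w\<close> complete the cardinalities of \<open>U\<close> and \<open>V\<close> to a
  polymatroid on three elements. According to the sign of the co-information, the third element
  shares coordinates with \<open>U \<inter> V\<close>, or carries \<open>d\<close> sums of a coordinate of \<open>U - V\<close> and
  one of \<open>V - U\<close>.\<close>

lemma split_third_element:
  fixes pw puw pvw puvw :: nat
  assumes fin: "finite U" "finite V"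
    and mono: "puw \<le> puvw" "pvw \<le> puvw" "card (U \<union> V) \<le> puvw"
    and sub: "puvw + card U \<le> card (U \<union> V) + puw" "puvw + card V \<le> card (U \<union> V) + pvw"
      "puvw + pw \<le> puw + pvw" "puw \<le> card U + pw" "pvw \<le> card V + pw"
  shows "\<exists>B a d i j. B \<subseteq> U \<union> V \<and> i ` {..<d} \<subseteq> U - V - B \<and> j ` {..<d} \<subseteq> V - U - B \<and>
    card B + a + d = pw \<and> card (U \<union> B) + a + d = puw \<and> card (V \<union> B) + a + d = pvw \<and>
    card (U \<union> V) + a = puvw \<and> card (U - (V \<union> B \<union> i ` {..<d})) + pvw = puvw \<and>
    card (V - (U \<union> B \<union> j ` {..<d})) + puw = puvw"
proof -
  define co where "co = int (card U) + card V + pw + puvw - card (U \<union> V) - puw - pvw"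
  define c where "c = nat co"
  define d where "d = nat (- co)"
  \<comment> \<open>\<open>b\<close> and \<open>b'\<close> are the numbers of coordinates that the
    third element shares with exactly one of \<open>U\<close> and \<open>V\<close>: the mutual
    information with that set, less the part \<open>c\<close> common to all three. \<open>a\<close>
    counts its fresh coordinates. The equations \<open>eqs\<close> confirm that no subtraction is
    truncated.\<close>
  define b where "b = card U + pw - puw - c"
  define b' where "b' = card V + pw - pvw - c"
  define a where "a = puvw - card (U \<union> V)"
  have cU: "card (U - V) + card V = card (U \<union> V)" "card (V - U) + card U = card (U \<union> V)"
    "card (U \<inter> V) + card (U \<union> V) = card U + card V"
  proof -
    have "(U - V) \<inter> V = {}" "(V - U) \<inter> U = {}" "(U - V) \<union> V = U \<union> V" "(V - U) \<union> U = U \<union> V" by auto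
    then show "card (U - V) + card V = card (U \<union> V)" "card (V - U) + card U = card (U \<union> V)"
      "card (U \<inter> V) + card (U \<union> V) = card U + card V"
      using fin card_Un_Int[OF fin] card_Un_disjoint[of "U - V" V] card_Un_disjoint[of "V - U" U] by simp_all
  qed
  have co: "co \<le> int (card U) + pw - puw" "co \<le> int (card V) + pw - pvw" "co \<le> int (card U) + card V - card (U \<union> V)"
    using sub unfolding co_def by linarith+
  have eqs: "int b = int (card U) + pw - puw - c" "int b' = int (card V) + pw - pvw - c"
    "int c - int d = co" "int a = int puvw - card (U \<union> V)"
    using co sub mono unfolding b_def b'_def c_def d_def a_def by linarith+
  have bd: "int b + d = int (card (U - V)) + pvw - puvw" "int b' + d = int (card (V - U)) + puw - puvw"
    using eqs cU unfolding co_def by linarith+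
  then have "b + d \<le> card (U - V)" "b' + d \<le> card (V - U)" using mono by linarith+
  then obtain B1 B2 i j where B1: "B1 \<subseteq> U - V" "card B1 = b" "inj_on i {..<d}" "i ` {..<d} \<subseteq> U - V - B1"
    and B2: "B2 \<subseteq> V - U" "card B2 = b'" "inj_on j {..<d}" "j ` {..<d} \<subseteq> V - U - B2"
    using subset_card_lessThan[of "U - V" b d] subset_card_lessThan[of "V - U" b' d] fin by auto
  have "c \<le> card (U \<inter> V)" using co(3) cU(3) unfolding c_def by linarith
  then obtain C where C: "C \<subseteq> U \<inter> V" "card C = c" "finite C" by (rule obtain_subset_with_card_n)
  have finB: "finite B1" "finite B2" using B1(1) B2(1) fin finite_subset by blast+
  define B where "B = B1 \<union> B2 \<union> C"
  have "card B = card (B1 \<union> B2) + card C"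
    unfolding B_def by (rule card_Un_disjoint) (use B1 B2 C finB in auto)
  also have "card (B1 \<union> B2) = card B1 + card B2"
    by (rule card_Un_disjoint) (use B1 B2 finB in auto)
  finally have cardB: "card B = b + b' + c" using B1 B2 C by simp
  have UB: "U \<union> B = U \<union> B2" "V \<union> B = V \<union> B1" using B1 B2 C by (auto simp: B_def)
  have cUB: "card (U \<union> B) = card U + b'" "card (V \<union> B) = card V + b"
    unfolding UB using B1 B2 fin finB by (subst card_Un_disjoint; auto)+
  have ci: "card (i ` {..<d}) = d" "card (j ` {..<d}) = d"
    using B1(3) B2(3) by (simp_all add: card_image)
  have "U - (V \<union> B \<union> i ` {..<d}) = (U - V) - (B1 \<union> i ` {..<d})"
    using B2 C by (auto simp: B_def)
  moreover have "B1 \<union> i ` {..<d} \<subseteq> U - V" using B1(1,4) by blast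
  moreover have "card (B1 \<union> i ` {..<d}) = b + d"
    using B1 finB ci by (subst card_Un_disjoint) auto
  ultimately have cUd: "card (U - (V \<union> B \<union> i ` {..<d})) + (b + d) = card (U - V)"
    using card_Diff_subset[of "B1 \<union> i ` {..<d}" "U - V"] finB \<open>b + d \<le> card (U - V)\<close> by simp
  have "V - (U \<union> B \<union> j ` {..<d}) = (V - U) - (B2 \<union> j ` {..<d})"
    using B1 C by (auto simp: B_def)
  moreover have "B2 \<union> j ` {..<d} \<subseteq> V - U" using B2(1,4) by blast
  moreover have "card (B2 \<union> j ` {..<d}) = b' + d"
    using B2 finB ci by (subst card_Un_disjoint) auto
  ultimately have cVd: "card (V - (U \<union> B \<union> j ` {..<d})) + (b' + d) = card (V - U)"
    using card_Diff_subset[of "B2 \<union> j ` {..<d}" "V - U"] finB \<open>b' + d \<le> card (V - U)\<close> by simp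
  have "B \<subseteq> U \<union> V" using B1 B2 C by (auto simp: B_def)
  moreover have "i ` {..<d} \<subseteq> U - V - B" using B1(4) B2(1) C(1) unfolding B_def by blast
  moreover have "j ` {..<d} \<subseteq> V - U - B" using B2(4) B1(1) C(1) unfolding B_def by blast
  moreover have "card B + a + d = pw" "card (U \<union> B) + a + d = puw" "card (V \<union> B) + a + d = pvw"
    using cardB cUB eqs unfolding co_def by linarith+
  moreover have "card (U \<union> V) + a = puvw" using mono by (simp add: a_def)
  moreover have "card (U - (V \<union> B \<union> i ` {..<d})) + pvw = puvw"
    "card (V - (U \<union> B \<union> j ` {..<d})) + puw = puvw"
    using cUd cVd bd by linarith+
  ultimately show ?thesis by blast
qed

section \<open>Coordinates, sum relations and valuations\<close>

type_synonym 'a name = "'a \<times> nat"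

text \<open>\<open>S u\<close> is the set of coordinates carried by the vertex \<open>u\<close>, and \<open>(i, j, k) \<in> rel w\<close> says
  that the coordinate \<open>k\<close>, born at the last vertex \<open>w\<close> of a triangle, is the sum of \<open>i\<close> and \<open>j\<close>.\<close>

definition triangle_names :: "('a set \<Rightarrow> nat) \<Rightarrow> ('a \<Rightarrow> 'a name set) \<Rightarrow> ('a \<Rightarrow> ('a name \<times> 'a name \<times> 'a name) set)
    \<Rightarrow> 'a \<Rightarrow> 'a \<Rightarrow> 'a \<Rightarrow> bool" where
  "triangle_names p S rel u v w \<longleftrightarrow> rel w \<subseteq> S u \<times> S v \<times> S w \<and>
     card (S u - (S v \<union> S w \<union> fst ` rel w)) + p {v, w} = p {u, v, w} \<and>
     card (S v - (S u \<union> S w \<union> (fst \<circ> snd) ` rel w)) + p {u, w} = p {u, v, w} \<and>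
     card (S w - (S u \<union> S v \<union> (snd \<circ> snd) ` rel w)) + p {u, v} = p {u, v, w}"

text \<open>In a triangle, the coordinates of each vertex that are not forced by the other two must
  have exactly the conditional rank as their number; this yields the upper bounds on homomorphism
  counts. The bound on \<open>card (rel w)\<close> limits the number of level classes. The first
  component of a name is the vertex where it is born, so new names are disjoint from old
  ones.\<close>

definition names_for :: "'a pair_pre_digraph \<Rightarrow> ('a set \<Rightarrow> nat) \<Rightarrow> 'a set \<Rightarrow> ('a \<Rightarrow> 'a name set)
    \<Rightarrow> ('a \<Rightarrow> ('a name \<times> 'a name \<times> 'a name) set) \<Rightarrow> bool" where
  "names_for H p A S rel \<longleftrightarrow>
     (\<forall>u \<in> A. finite (S u) \<and> S u \<subseteq> A \<times> UNIV \<and> card (S u) = p {u}) \<and>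
     (\<forall>u \<in> A. \<forall>v \<in> A. (u, v) \<in> parcs H \<longrightarrow> card (S u \<union> S v) = p {u, v}) \<and>
     (\<forall>Q \<subseteq> A. clique H Q \<and> card Q = 3 \<longrightarrow> (\<exists>u v w. Q = {u, v, w} \<and> triangle_names p S rel u v w)) \<and>
     (\<forall>w \<in> A. finite (rel w) \<and> card (rel w) \<le> p {w} \<and>
        (\<forall>(i, j, k) \<in> rel w. {i, j, k} \<subseteq> \<Union> (S ` A)))"

lemma names_for_vertex:
  "names_for H p A S rel \<Longrightarrow> u \<in> A \<Longrightarrow> finite (S u) \<and> S u \<subseteq> A \<times> UNIV \<and> card (S u) = p {u}"
  by (simp add: names_for_def)

lemma names_for_edge:
  "names_for H p A S rel \<Longrightarrow> u \<in> A \<Longrightarrow> v \<in> A \<Longrightarrow> (u, v) \<in> parcs H \<Longrightarrow> card (S u \<union> S v) = p {u, v}"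
  by (simp add: names_for_def)

lemma names_for_triangle:
  "names_for H p A S rel \<Longrightarrow> Q \<subseteq> A \<Longrightarrow> clique H Q \<Longrightarrow> card Q = 3 \<Longrightarrow>
    \<exists>u v w. Q = {u, v, w} \<and> triangle_names p S rel u v w"
  by (simp add: names_for_def)

lemma names_for_rel:
  "names_for H p A S rel \<Longrightarrow> w \<in> A \<Longrightarrow> finite (rel w) \<and> card (rel w) \<le> p {w}"
  "names_for H p A S rel \<Longrightarrow> w \<in> A \<Longrightarrow> (i, j, k) \<in> rel w \<Longrightarrow> {i, j, k} \<subseteq> \<Union> (S ` A)"
  by (simp add: names_for_def) (fastforce simp only: names_for_def)

text \<open>Free coordinates range below \<open>n\<close>, whereas \<open>N\<close> also bounds the
  sums. The exponent \<open>L\<close> will be the chain rank. By the last clause, distinct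
  valuations yield distinct homomorphisms into the blow-up.\<close>

definition valuations_for :: "nat \<Rightarrow> nat \<Rightarrow> real \<Rightarrow> 'a set \<Rightarrow> ('a \<Rightarrow> 'a name set)
    \<Rightarrow> ('a \<Rightarrow> ('a name \<times> 'a name \<times> 'a name) set) \<Rightarrow> ('a name \<Rightarrow> nat) set \<Rightarrow> bool" where
  "valuations_for n N L A S rel \<Omega> \<longleftrightarrow> finite \<Omega> \<and> real (card \<Omega>) = real n powr L \<and>
     (\<forall>\<omega> \<in> \<Omega>. \<forall>x \<in> \<Union> (S ` A). \<omega> x < N) \<and>
     (\<forall>\<omega> \<in> \<Omega>. \<forall>w \<in> A. \<forall>(i, j, k) \<in> rel w. \<omega> k = \<omega> i + \<omega> j) \<and>
     (\<forall>\<omega> \<in> \<Omega>. \<forall>\<omega>' \<in> \<Omega>. (\<forall>x \<in> \<Union> (S ` A). \<omega> x = \<omega>' x) \<longrightarrow> \<omega> = \<omega>')"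

lemma valuations_for_lt:
  "valuations_for n N L A S rel \<Omega> \<Longrightarrow> \<omega> \<in> \<Omega> \<Longrightarrow> x \<in> \<Union> (S ` A) \<Longrightarrow> \<omega> x < N"
  unfolding valuations_for_def by (elim conjE) (drule (1) bspec, drule (1) bspec)

lemma valuations_for_rel:
  "valuations_for n N L A S rel \<Omega> \<Longrightarrow> \<omega> \<in> \<Omega> \<Longrightarrow> w \<in> A \<Longrightarrow> (i, j, k) \<in> rel w \<Longrightarrow> \<omega> k = \<omega> i + \<omega> j"
  by (fastforce simp only: valuations_for_def)

lemma valuations_for_eq:
  assumes "valuations_for n N L A S rel \<Omega>" "\<omega> \<in> \<Omega>" "\<omega>' \<in> \<Omega>" "\<And>x. x \<in> \<Union> (S ` A) \<Longrightarrow> \<omega> x = \<omega>' x"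
  shows "\<omega> = \<omega>'"
proof -
  have "\<forall>\<omega> \<in> \<Omega>. \<forall>\<omega>' \<in> \<Omega>. (\<forall>x \<in> \<Union> (S ` A). \<omega> x = \<omega>' x) \<longrightarrow> \<omega> = \<omega>'"
    using assms(1) unfolding valuations_for_def by (elim conjE)
  then have "(\<forall>x \<in> \<Union> (S ` A). \<omega> x = \<omega>' x) \<longrightarrow> \<omega> = \<omega>'" using assms(2,3) by blast
  then show ?thesis using assms(4) by blast
qed

text \<open>A common interface for zero, one or two later neighbours, all that cliques of at most
  three vertices allow. The sizes one and two both come from
  \<open>split_third_element\<close>.\<close>

lemma new_vertex_names:
  fixes p :: "'a set \<Rightarrow> nat"
  assumes H: "pair_graph H" and p: "clique_polymatroid H p" and N: "names_for H p A S rel"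
    and K: "K \<subseteq> A" "w \<notin> K" "clique H (insert w K)" "card (insert w K) \<le> 3"
  shows "\<exists>B a d i j. B \<subseteq> \<Union> (S ` K) \<and> i ` {..<d} \<subseteq> \<Union> (S ` K) \<and> j ` {..<d} \<subseteq> \<Union> (S ` K) \<and>
    card B + a + d = p {w} \<and> p K + a = p (insert w K) \<and> (\<forall>u \<in> K. card (S u \<union> B) + a + d = p {u, w}) \<and>
    (card K = 2 \<longrightarrow> (\<exists>u v. K = {u, v} \<and> i ` {..<d} \<subseteq> S u \<and> j ` {..<d} \<subseteq> S v \<and>
      card (S u - (S v \<union> B \<union> i ` {..<d})) + p {v, w} = p {u, v, w} \<and>
      card (S v - (S u \<union> B \<union> j ` {..<d})) + p {u, w} = p {u, v, w}))"
proof -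
  have "K \<subseteq> pverts H" using K(3) by (simp add: clique_def)
  then have finK: "finite K" by (rule finite_subset) (rule pair_graph_finite[OF H])
  have mono: "p X \<le> p Y" if "X \<subseteq> Y" "Y \<subseteq> insert w K" for X Y
    using clique_polymatroid_mono[OF p clique_subset[OF K(3) that(2)] that(1)] .
  have sub: "p Q + p R \<le> p X + p Y" if "X \<union> Y = Q" "X \<inter> Y = R" "Q \<subseteq> insert w K" for X Y Q R
    using clique_polymatroid_submod[OF p clique_subset[OF K(3) that(3)] that(1,2)] .
  have p0: "p {} = 0" using p by (simp add: clique_polymatroid_def)
  have fS: "finite (S u)" "card (S u) = p {u}" if "u \<in> K" for u
    using names_for_vertex[OF N subsetD[OF K(1) that]] by simp_all
  have "card K \<le> 2" using K(2,4) finK by simp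
  then consider "K = {}" | u where "K = {u}" | u v where "K = {u, v}" "u \<noteq> v"
  proof -
    have "card K = 0 \<or> card K = 1 \<or> card K = 2" using \<open>card K \<le> 2\<close> by linarith
    then show thesis
    proof (elim disjE)
      assume "card K = 2"
      then obtain u v where "K = {u, v}" "u \<noteq> v" by (auto simp: card_2_iff)
      then show thesis by (rule that(3))
    qed (use that(1,2) finK in \<open>simp, metis card_1_singletonE\<close>)
  qed
  then show ?thesis
  proof cases
    case 1
    show ?thesis
      by (rule exI[of _ "{} :: 'a name set"], rule exI[of _ "p {w}"], rule exI[of _ "0 :: nat"],
          rule exI[of _ "\<lambda>_. undefined"], rule exI[of _ "\<lambda>_. undefined"]) (use 1 p0 in simp)
  next
    case 2
    have uw: "u \<noteq> w" using K(2) 2 by auto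
    have "p {u, w} + p {} \<le> p {u} + p {w}" by (rule sub) (use 2 uw in auto)
    moreover have "p {w} \<le> p {u, w}" "p {u} \<le> p {u, w}" by (rule mono; use 2 in auto)+
    ultimately have ineq: "p {u, w} \<le> card (S u) + p {w}" "p {w} \<le> p {u, w}" "card (S u \<union> {}) \<le> p {u, w}"
      using fS(2)[of u] 2 p0 by simp_all
    have "finite (S u)" using fS(1)[of u] 2 by simp
    \<comment> \<open>The second set is taken empty. As \<open>j\<close> maps into it, this forces
      \<open>d = 0\<close>: an edge alone carries no sums.\<close>
    have "\<exists>B a d i j. B \<subseteq> S u \<union> {} \<and> i ` {..<d} \<subseteq> S u - {} - B \<and> j ` {..<d} \<subseteq> {} - S u - B \<and>
      card B + a + d = p {w} \<and> card (S u \<union> B) + a + d = p {u, w} \<and> card ({} \<union> B) + a + d = p {w} \<and>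
      card (S u \<union> {}) + a = p {u, w} \<and> card (S u - ({} \<union> B \<union> i ` {..<d})) + p {w} = p {u, w} \<and>
      card ({} - (S u \<union> B \<union> j ` {..<d})) + p {u, w} = p {u, w}"
      by (rule split_third_element[OF \<open>finite (S u)\<close>]) (use ineq in auto)
    then obtain B a d i j where *: "B \<subseteq> S u \<union> {}" "i ` {..<d} \<subseteq> S u - {} - B" "j ` {..<d} \<subseteq> {} - S u - B"
      "card B + a + d = p {w}" "card (S u \<union> B) + a + d = p {u, w}" "card (S u \<union> {}) + a = p {u, w}"
      by (elim exE conjE)
    have e: "insert w {u} = {u, w}" by auto
    show ?thesis
    proof (rule exI[of _ B], rule exI[of _ a], rule exI[of _ d], rule exI[of _ i], rule exI[of _ j], intro conjI)
      show "p K + a = p (insert w K)" using * fS(2)[of u] unfolding 2 e by simp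
      show "i ` {..<d} \<subseteq> \<Union> (S ` K)" "j ` {..<d} \<subseteq> \<Union> (S ` K)" "B \<subseteq> \<Union> (S ` K)"
        using *(1-3) 2 by blast+
    qed (use * 2 in simp_all)
  next
    case 3
    have uw: "u \<noteq> w" "v \<noteq> w" using K(2) 3 by auto
    have uv: "(u, v) \<in> parcs H" "u \<in> A" "v \<in> A" using K 3 by (auto simp: clique_def)
    have cuv: "card (S u \<union> S v) = p {u, v}" by (rule names_for_edge[OF N uv(2,3,1)])
    have e: "insert w K = {u, v, w}" "insert w {u, v} = {u, v, w}" using 3 by auto
    have "p {u, v, w} + p {u} \<le> p {u, v} + p {u, w}" "p {u, v, w} + p {v} \<le> p {u, v} + p {v, w}"
      "p {u, v, w} + p {w} \<le> p {u, w} + p {v, w}" "p {u, w} + p {} \<le> p {u} + p {w}" "p {v, w} + p {} \<le> p {v} + p {w}"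
      by (rule sub; use 3 uw in auto)+
    moreover have "p {u, w} \<le> p {u, v, w}" "p {v, w} \<le> p {u, v, w}" "p {u, v} \<le> p {u, v, w}"
      by (rule mono; use 3 in auto)+
    ultimately have ineq: "p {u, w} \<le> p {u, v, w}" "p {v, w} \<le> p {u, v, w}" "card (S u \<union> S v) \<le> p {u, v, w}"
      "p {u, v, w} + card (S u) \<le> card (S u \<union> S v) + p {u, w}"
      "p {u, v, w} + card (S v) \<le> card (S u \<union> S v) + p {v, w}"
      "p {u, v, w} + p {w} \<le> p {u, w} + p {v, w}" "p {u, w} \<le> card (S u) + p {w}" "p {v, w} \<le> card (S v) + p {w}"
      using fS(2)[of u] fS(2)[of v] 3 p0 cuv by simp_all
    have "finite (S u)" "finite (S v)" using fS(1) 3 by simp_all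
    from split_third_element[OF this ineq]
    obtain B a d i j where *: "B \<subseteq> S u \<union> S v" "i ` {..<d} \<subseteq> S u - S v - B" "j ` {..<d} \<subseteq> S v - S u - B"
      "card B + a + d = p {w}" "card (S u \<union> B) + a + d = p {u, w}" "card (S v \<union> B) + a + d = p {v, w}"
      "card (S u \<union> S v) + a = p {u, v, w}" "card (S u - (S v \<union> B \<union> i ` {..<d})) + p {v, w} = p {u, v, w}"
      "card (S v - (S u \<union> B \<union> j ` {..<d})) + p {u, w} = p {u, v, w}"
      by (elim exE conjE)
    have **: "i ` {..<d} \<subseteq> S u" "j ` {..<d} \<subseteq> S v" using *(2,3) by blast+
    show ?thesis
    proof (rule exI[of _ B], rule exI[of _ a], rule exI[of _ d], rule exI[of _ i], rule exI[of _ j], intro conjI impI)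
      show "\<exists>u v. K = {u, v} \<and> i ` {..<d} \<subseteq> S u \<and> j ` {..<d} \<subseteq> S v \<and>
        card (S u - (S v \<union> B \<union> i ` {..<d})) + p {v, w} = p {u, v, w} \<and>
        card (S v - (S u \<union> B \<union> j ` {..<d})) + p {u, w} = p {u, v, w}"
        by (rule exI[of _ u], rule exI[of _ v]) (use *(8,9) ** 3(1) in simp)
      show "p K + a = p (insert w K)" unfolding e 3(1) using *(7) cuv by simp
      show "i ` {..<d} \<subseteq> \<Union> (S ` K)" "j ` {..<d} \<subseteq> \<Union> (S ` K)" "B \<subseteq> \<Union> (S ` K)"
        unfolding 3(1) image_insert image_empty Union_insert Union_empty Un_empty_right
        by (rule le_supI1[OF **(1)], rule le_supI2[OF **(2)], rule *(1))
      show "\<forall>u \<in> K. card (S u \<union> B) + a + d = p {u, w}" unfolding 3(1) using *(5,6) by simp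
    qed (rule *(4))
  qed
qed

text \<open>Of the \<open>a + d\<close> names born at \<open>w\<close>, the first \<open>a\<close>
  are free and the others are sums of two old ones. The free ones multiply the number of valuations
  by \<open>n ^ a\<close>, with \<open>a\<close> the term of \<open>w\<close> in the chain rank; the
  sums double the range.\<close>

lemma names_step:
  fixes p :: "'a set \<Rightarrow> nat"
  assumes H: "pair_graph H" and p: "clique_polymatroid H p" and N: "names_for H p (set vs) S rel"
    and V: "valuations_for n N L (set vs) S rel \<Omega>" and n: "0 < n" "n \<le> N"
    and peo: "peo H (w # vs)" and card3: "\<And>Q. clique H Q \<Longrightarrow> card Q \<le> 3"
  shows "\<exists>S' rel' \<Omega>'. names_for H p (set (w # vs)) S' rel' \<and>
    valuations_for n (2 * N) (real (p (insert w (nbrs H (set vs) w))) - p (nbrs H (set vs) w) + L)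
      (set (w # vs)) S' rel' \<Omega>'"
proof -
  let ?K = "nbrs H (set vs) w" and ?A = "set vs"
  have w: "w \<notin> ?A" and KA: "?K \<subseteq> ?A" and wK: "w \<notin> ?K" using peo by (auto simp: nbrs_def)
  have cl: "clique H (insert w ?K)" by (rule clique_insert_nbrs[OF H peo])
  obtain B a d i j where B: "B \<subseteq> \<Union> (S ` ?K)" "i ` {..<d} \<subseteq> \<Union> (S ` ?K)" "j ` {..<d} \<subseteq> \<Union> (S ` ?K)"
    and cB: "card B + a + d = p {w}" and a: "p ?K + a = p (insert w ?K)"
    and cE: "\<forall>u \<in> ?K. card (S u \<union> B) + a + d = p {u, w}"
    and tri: "card ?K = 2 \<longrightarrow> (\<exists>u v. ?K = {u, v} \<and> i ` {..<d} \<subseteq> S u \<and> j ` {..<d} \<subseteq> S v \<and>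
      card (S u - (S v \<union> B \<union> i ` {..<d})) + p {v, w} = p {u, v, w} \<and>
      card (S v - (S u \<union> B \<union> j ` {..<d})) + p {u, w} = p {u, v, w})"
    using new_vertex_names[OF H p N KA wK cl card3[OF cl]] by (elim exE conjE)
  have Sfin: "finite (S u)" and Ssub: "S u \<subseteq> ?A \<times> UNIV" and Sc: "card (S u) = p {u}" if "u \<in> ?A" for u
    using names_for_vertex[OF N that] by simp_all
  have UKA: "\<Union> (S ` ?K) \<subseteq> \<Union> (S ` ?A)" using KA by blast
  have UA: "\<Union> (S ` ?A) \<subseteq> ?A \<times> UNIV" using Ssub by blast
  have fB: "finite B" by (rule finite_subset[OF B(1)]) (use KA Sfin in \<open>auto intro: finite_subset\<close>)
  define New where "New = {w} \<times> {..<a + d}"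
  have New: "finite New" "card New = a + d" by (simp_all add: New_def)
  have disj: "New \<inter> X = {}" if "X \<subseteq> ?A \<times> UNIV" for X using that w by (auto simp: New_def)
  have BA: "B \<subseteq> ?A \<times> UNIV" using B(1) UKA UA by blast
  define S' where "S' = S(w := B \<union> New)"
  define rel' where "rel' = rel(w := (\<lambda>m. (i m, j m, (w, a + m))) ` {..<d})"
  have S'w: "S' w = B \<union> New" and S'u: "u \<in> ?A \<Longrightarrow> S' u = S u" for u using w by (auto simp: S'_def)
  have rel'w: "rel' w = (\<lambda>m. (i m, j m, (w, a + m))) ` {..<d}" and rel'u: "u \<in> ?A \<Longrightarrow> rel' u = rel u" for u
    using w by (auto simp: rel'_def)
  have US': "\<Union> (S' ` set (w # vs)) = New \<union> \<Union> (S ` ?A)"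
  proof -
    have "\<Union> (S' ` ?A) = \<Union> (S ` ?A)" using S'u by auto
    moreover have "B \<subseteq> \<Union> (S ` ?A)" using B(1) UKA by (rule subset_trans)
    ultimately show ?thesis by (simp add: S'w) blast
  qed
  have cE': "card (S u \<union> (B \<union> New)) = p {u, w}" if "u \<in> ?K" for u
  proof -
    have "u \<in> ?A" using that KA by blast
    have "card (New \<union> (S u \<union> B)) = card New + card (S u \<union> B)"
      using New(1) Sfin[OF \<open>u \<in> ?A\<close>] fB disj[of "S u \<union> B"] Ssub[OF \<open>u \<in> ?A\<close>] BA
      by (intro card_Un_disjoint) auto
    moreover have "New \<union> (S u \<union> B) = S u \<union> (B \<union> New)" by blast
    ultimately show ?thesis using cE that New(2) by (metis add.commute add.assoc)
  qed
  have names: "names_for H p (set (w # vs)) S' rel'"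
    unfolding names_for_def
  proof (intro conjI ballI allI impI)
    fix u assume u: "u \<in> set (w # vs)"
    show "finite (S' u)" using u fB New(1) Sfin by (cases "u = w") (auto simp: S'w S'u)
    show "S' u \<subseteq> set (w # vs) \<times> UNIV"
      using u BA Ssub by (cases "u = w") (auto simp: S'w S'u New_def)
    show "card (S' u) = p {u}"
    proof (cases "u = w")
      case True
      have "card (New \<union> B) = card New + card B" using New(1) fB disj[OF BA] by (intro card_Un_disjoint) auto
      then show ?thesis using True cB New(2) by (simp add: S'w Un_commute)
    next
      case False
      then show ?thesis using u Sc by (simp add: S'u)
    qed
  next
    fix u v assume uv: "u \<in> set (w # vs)" "v \<in> set (w # vs)" "(u, v) \<in> parcs H"
    have vu: "(v, u) \<in> parcs H" using pair_graph_sym[OF H uv(3)] .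
    have ne: "u \<noteq> v" using uv(3) pair_graph_irrefl[OF H] by blast
    consider "u \<in> ?A" "v \<in> ?A" | "u = w" "v \<in> ?K" | "v = w" "u \<in> ?K"
      using uv vu ne by (auto simp: nbrs_def)
    then show "card (S' u \<union> S' v) = p {u, v}"
    proof cases
      case 1
      then show ?thesis using names_for_edge[OF N _ _ uv(3)] by (simp add: S'u)
    next
      case 2
      have "v \<in> ?A" using 2 KA by blast
      then show ?thesis using cE'[OF 2(2)] 2(1) by (simp add: S'w S'u Un_commute insert_commute)
    next
      case 3
      have "u \<in> ?A" using 3 KA by blast
      then show ?thesis using cE'[OF 3(2)] 3(1) by (simp add: S'w S'u)
    qed
  next
    fix Q assume Q: "Q \<subseteq> set (w # vs)" "clique H Q \<and> card Q = 3"
    show "\<exists>u v x. Q = {u, v, x} \<and> triangle_names p S' rel' u v x"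
    proof (cases "w \<in> Q")
      case False
      then have QA: "Q \<subseteq> ?A" using Q by auto
      then obtain u v x where uvx: "Q = {u, v, x}" "triangle_names p S rel u v x"
        using names_for_triangle[OF N QA] Q(2) by blast
      then have "S' u = S u" "S' v = S v" "S' x = S x" "rel' x = rel x" using QA S'u rel'u by auto
      then have "triangle_names p S' rel' u v x" using uvx(2) unfolding triangle_names_def by simp
      then show ?thesis using uvx(1) by blast
    next
      case True
      have sub: "Q - {w} \<subseteq> ?K" using Q True by (auto simp: clique_def nbrs_def)
      have c2: "card (Q - {w}) = 2" using Q(2) True by simp
      have finK: "finite ?K" using KA finite_subset by blast
      have "card ?K \<le> 2" using card3[OF cl] wK finK by simp
      then have KQ: "?K = Q - {w}" using card_subset_eq[OF finK sub] card_mono[OF finK sub] c2 by simp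
      then obtain u v where uv: "?K = {u, v}" "i ` {..<d} \<subseteq> S u" "j ` {..<d} \<subseteq> S v"
        "card (S u - (S v \<union> B \<union> i ` {..<d})) + p {v, w} = p {u, v, w}"
        "card (S v - (S u \<union> B \<union> j ` {..<d})) + p {u, w} = p {u, v, w}"
        using tri c2 by auto
      have QQ: "Q = {u, v, w}" using KQ uv(1) True by auto
      have uA: "u \<in> ?A" "v \<in> ?A" using uv(1) KA by auto
      have im: "fst ` rel' w = i ` {..<d}" "(fst \<circ> snd) ` rel' w = j ` {..<d}"
        "(snd \<circ> snd) ` rel' w = (\<lambda>m. (w, a + m)) ` {..<d}"
        unfolding rel'w by (simp_all add: image_image)
      have newS: "S u - (S v \<union> (B \<union> New) \<union> X) = S u - (S v \<union> B \<union> X)"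
        "S v - (S u \<union> (B \<union> New) \<union> X) = S v - (S u \<union> B \<union> X)" for X
        using disj[OF Ssub[OF uA(1)]] disj[OF Ssub[OF uA(2)]] by blast+
      have rest: "(B \<union> New) - (S u \<union> S v \<union> (\<lambda>m. (w, a + m)) ` {..<d}) = {w} \<times> {..<a}"
      proof -
        have "B \<subseteq> S u \<union> S v" using B(1) uv(1) by simp
        moreover have "New - (\<lambda>m. (w, a + m)) ` {..<d} = {w} \<times> {..<a}"
        proof -
          have "(\<lambda>m. (w, a + m)) ` {..<d} = {w} \<times> {a..<a + d}"
            by (auto simp: image_iff) (metis add_less_cancel_left lessThan_iff nat_le_iff_add)
          then show ?thesis by (auto simp: New_def)
        qed
        moreover have "({w} \<times> {..<a}) \<inter> (S u \<union> S v) = {}"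
          using Ssub[OF uA(1)] Ssub[OF uA(2)] w by auto
        ultimately show ?thesis by blast
      qed
      have "triangle_names p S' rel' u v w"
        unfolding triangle_names_def im S'w S'u[OF uA(1)] S'u[OF uA(2)] newS rest
      proof (intro conjI)
        show "rel' w \<subseteq> S u \<times> S v \<times> (B \<union> New)"
          unfolding rel'w using uv(2,3) by (auto simp: New_def)
        have "p {u, v} + a = p {u, v, w}" using a uv(1) QQ KQ True by (metis insert_Diff)
        then show "card ({w} \<times> {..<a}) + p {u, v} = p {u, v, w}" by simp
      qed (use uv in simp_all)
      then show ?thesis using QQ by blast
    qed
  next
    fix u assume u: "u \<in> set (w # vs)"
    have "card (rel' w) \<le> d"
      unfolding rel'w using card_image_le[of "{..<d}" "\<lambda>m. (i m, j m, (w, a + m))"] by simp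
    then have cw: "card (rel' w) \<le> p {w}" using cB by linarith
    show "finite (rel' u)" "card (rel' u) \<le> p {u}"
      using u names_for_rel(1)[OF N, of u] cw by (cases "u = w"; auto simp: rel'u rel'w)+
    fix t assume t: "t \<in> rel' u"
    show "case t of (x, y, z) \<Rightarrow> {x, y, z} \<subseteq> \<Union> (S' ` set (w # vs))"
    proof (cases "u = w")
      case True
      then obtain m where m: "m < d" "t = (i m, j m, (w, a + m))" using t by (auto simp: rel'w)
      then have "i m \<in> \<Union> (S ` ?A)" "j m \<in> \<Union> (S ` ?A)" using B(2,3) UKA by blast+
      then show ?thesis unfolding US' using m by (auto simp: New_def)
    next
      case False
      then have "u \<in> ?A" "t \<in> rel u" using u t rel'u by auto
      then show ?thesis unfolding US' using names_for_rel(2)[OF N \<open>u \<in> ?A\<close>] by (cases t) blast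
    qed
  qed
  \<comment> \<open>The value 0 is a dummy for names at \<open>w\<close> that no vertex carries; it
    makes the extension a function of \<open>\<omega>\<close> and \<open>f\<close> alone.\<close>
  define ext where "ext = (\<lambda>(\<omega> :: 'a name \<Rightarrow> nat, f :: nat \<Rightarrow> nat) x. if fst x = w
     then (if snd x < a then f (snd x) else if snd x < a + d then \<omega> (i (snd x - a)) + \<omega> (j (snd x - a)) else 0)
     else \<omega> x)"
  define \<Omega>' where "\<Omega>' = ext ` (\<Omega> \<times> PiE {..<a} (\<lambda>_. {..<n}))"
  have old: "ext (\<omega>, f) x = \<omega> x" if "x \<in> \<Union> (S ` ?A)" for \<omega> f x
    using that UA w by (auto simp: ext_def)
  have ext_inj: "(\<omega>, f) = (\<omega>', f')"
    if o: "\<omega> \<in> \<Omega>" "\<omega>' \<in> \<Omega>" and f: "f \<in> PiE {..<a} (\<lambda>_. {..<n})" "f' \<in> PiE {..<a} (\<lambda>_. {..<n})"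
      and eq: "\<And>x. x \<in> New \<union> \<Union> (S ` ?A) \<Longrightarrow> ext (\<omega>, f) x = ext (\<omega>', f') x" for \<omega> \<omega>' f f'
  proof -
    have "\<omega> x = \<omega>' x" if "x \<in> \<Union> (S ` ?A)" for x using eq[of x] old that by simp
    then have "\<omega> = \<omega>'" by (rule valuations_for_eq[OF V o])
    moreover have "f m = f' m" if "m < a" for m using eq[of "(w, m)"] that by (simp add: New_def ext_def)
    then have "f = f'" by (intro PiE_ext[OF f]) auto
    ultimately show ?thesis by simp
  qed
  have inj: "inj_on ext (\<Omega> \<times> PiE {..<a} (\<lambda>_. {..<n}))"
    by (rule inj_onI) (use ext_inj in auto)
  have vals: "valuations_for n (2 * N) (real (p (insert w ?K)) - p ?K + L) (set (w # vs)) S' rel' \<Omega>'"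
    unfolding valuations_for_def US'
  proof (intro conjI ballI impI)
    have f\<Omega>: "finite \<Omega>" using V by (simp add: valuations_for_def)
    show "finite \<Omega>'" unfolding \<Omega>'_def using f\<Omega> by (intro finite_imageI finite_cartesian_product finite_PiE) auto
    have "real (card \<Omega>') = real (card \<Omega>) * real n ^ a"
      unfolding \<Omega>'_def card_image[OF inj] card_cartesian_product by (simp add: card_PiE)
    also have "\<dots> = real n powr L * real n powr real a"
      using V n by (simp add: valuations_for_def powr_realpow)
    also have "\<dots> = real n powr (real (p (insert w ?K)) - p ?K + L)"
      unfolding powr_add[symmetric] a[symmetric] by (simp add: add.commute)
    finally show "real (card \<Omega>') = real n powr (real (p (insert w ?K)) - p ?K + L)" .
  next
    fix \<omega>' x assume "\<omega>' \<in> \<Omega>'" and x: "x \<in> New \<union> \<Union> (S ` ?A)"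
    then obtain \<omega> f where o: "\<omega>' = ext (\<omega>, f)" "\<omega> \<in> \<Omega>" "f \<in> PiE {..<a} (\<lambda>_. {..<n})" by (auto simp: \<Omega>'_def)
    have lt: "\<omega> y < N" if "y \<in> \<Union> (S ` ?A)" for y by (rule valuations_for_lt[OF V o(2) that])
    show "\<omega>' x < 2 * N"
    proof (cases "x \<in> \<Union> (S ` ?A)")
      case True
      then show ?thesis using lt[OF True] by (simp only: o(1) old)
    next
      case False
      then obtain m where m: "x = (w, m)" "m < a + d" using x by (auto simp: New_def)
      show ?thesis
      proof (cases "m < a")
        case True
        then have "f m < n" using o(3) by auto
        then show ?thesis using True m n by (simp add: o(1) ext_def)
      next
        case False
        then have "m - a \<in> {..<d}" using m(2) by auto
        then have "i (m - a) \<in> \<Union> (S ` ?A)" "j (m - a) \<in> \<Union> (S ` ?A)"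
          using subset_trans[OF B(2) UKA] subset_trans[OF B(3) UKA] by blast+
        then show ?thesis using lt[of "i (m - a)"] lt[of "j (m - a)"] False m by (simp add: o(1) ext_def)
      qed
    qed
  next
    fix \<omega>' u t assume "\<omega>' \<in> \<Omega>'" and u: "u \<in> set (w # vs)" and t: "t \<in> rel' u"
    then obtain \<omega> f where o: "\<omega>' = ext (\<omega>, f)" "\<omega> \<in> \<Omega>" by (auto simp: \<Omega>'_def)
    show "case t of (x, y, z) \<Rightarrow> \<omega>' z = \<omega>' x + \<omega>' y"
    proof (cases "u = w")
      case True
      then obtain m where m: "m < d" "t = (i m, j m, (w, a + m))" using t by (auto simp: rel'w)
      then have "i m \<in> \<Union> (S ` ?A)" "j m \<in> \<Union> (S ` ?A)" using B(2,3) UKA by blast+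
      then have "\<omega>' (i m) = \<omega> (i m)" "\<omega>' (j m) = \<omega> (j m)" unfolding o(1) by (simp_all only: old)
      moreover have "\<omega>' (w, a + m) = \<omega> (i m) + \<omega> (j m)" using m(1) by (simp add: o(1) ext_def)
      ultimately show ?thesis using m(2) by simp
    next
      case False
      then have uA: "u \<in> ?A" "t \<in> rel u" using u t rel'u by auto
      obtain x y z where xyz: "t = (x, y, z)" by (metis surj_pair)
      then have "{x, y, z} \<subseteq> \<Union> (S ` ?A)" using names_for_rel(2)[OF N uA(1)] uA(2) by blast
      then have "\<omega>' x = \<omega> x" "\<omega>' y = \<omega> y" "\<omega>' z = \<omega> z" unfolding o(1) by (simp_all only: old insert_subset)
      moreover have "\<omega> z = \<omega> x + \<omega> y" using valuations_for_rel[OF V o(2) uA(1)] uA(2) xyz by blast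
      ultimately show ?thesis using xyz by simp
    qed
  next
    fix \<omega>1 \<omega>2 assume "\<omega>1 \<in> \<Omega>'" "\<omega>2 \<in> \<Omega>'" and eq: "\<forall>x\<in>New \<union> \<Union> (S ` ?A). \<omega>1 x = \<omega>2 x"
    then obtain \<omega> f \<omega>' f' where o: "\<omega>1 = ext (\<omega>, f)" "\<omega> \<in> \<Omega>" "f \<in> PiE {..<a} (\<lambda>_. {..<n})"
      "\<omega>2 = ext (\<omega>', f')" "\<omega>' \<in> \<Omega>" "f' \<in> PiE {..<a} (\<lambda>_. {..<n})" by (auto simp: \<Omega>'_def)
    have "(\<omega>, f) = (\<omega>', f')" by (rule ext_inj[OF o(2,5,3,6)]) (use eq o in simp)
    then show "\<omega>1 = \<omega>2" using o by simp
  qed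
  from names vals show ?thesis by blast
qed

lemma names_exist:
  fixes p :: "'a set \<Rightarrow> nat"
  assumes H: "pair_graph H" and p: "clique_polymatroid H p" and n: "0 < n"
    and card3: "\<And>Q. clique H Q \<Longrightarrow> card Q \<le> 3" and peo: "peo H vs"
  shows "\<exists>S rel \<Omega>. names_for H p (set vs) S rel \<and>
    valuations_for n (2 ^ length vs * n) (chain_rank H (\<lambda>Q. real (p Q)) vs) (set vs) S rel \<Omega>"
  using peo
proof (induction vs)
  case Nil
  have "names_for H p (set []) (\<lambda>_. {}) (\<lambda>_. {})" by (auto simp: names_for_def)
  moreover have "valuations_for n (2 ^ length [] * n) (chain_rank H (\<lambda>Q. real (p Q)) []) (set []) (\<lambda>_. {}) (\<lambda>_. {}) {\<lambda>_. 0}"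
    using n by (simp add: valuations_for_def)
  ultimately show ?case by blast
next
  case (Cons w vs)
  then obtain S rel \<Omega> where "names_for H p (set vs) S rel"
    "valuations_for n (2 ^ length vs * n) (chain_rank H (\<lambda>Q. real (p Q)) vs) (set vs) S rel \<Omega>" by auto
  from names_step[OF H p this n _ Cons.prems card3] show ?case by (simp add: mult.assoc)
qed

section \<open>Level classes of valuations\<close>

lemma pigeonhole_fibre:
  assumes fin: "finite \<Omega>" "\<Omega> \<noteq> {}" "finite R" and R: "\<sigma> ` \<Omega> \<subseteq> R"
  shows "\<exists>\<Omega>'\<subseteq>\<Omega>. \<Omega>' \<noteq> {} \<and> (\<forall>a \<in> \<Omega>'. \<forall>b \<in> \<Omega>'. \<sigma> a = \<sigma> b) \<and> card \<Omega> \<le> card R * card \<Omega>'"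
proof -
  let ?F = "\<lambda>c. {a \<in> \<Omega>. \<sigma> a = c}"
  have sum: "card \<Omega> = (\<Sum>c\<in>R. card (?F c))"
  proof -
    have "(\<Sum>c\<in>R. sum (\<lambda>_. 1) (?F c)) = sum (\<lambda>_. 1::nat) \<Omega>"
      by (rule sum.group) (use fin R in auto)
    then show ?thesis by simp
  qed
  have "\<exists>c \<in> R. ?F c \<noteq> {} \<and> card \<Omega> \<le> card R * card (?F c)"
  proof (rule ccontr)
    assume no: "\<not> ?thesis"
    have small: "card R * card (?F c) < card \<Omega>" if "c \<in> R" for c
    proof (cases "?F c = {}")
      case True
      have "0 < card \<Omega>" using fin(1,2) by (simp add: card_gt_0_iff)
      then show ?thesis unfolding True by simp
    next
      case False
      then show ?thesis using no that by (meson not_le)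
    qed
    have "R \<noteq> {}" using fin R by auto
    have "card R * card \<Omega> = (\<Sum>c\<in>R. card R * card (?F c))" by (simp add: sum sum_distrib_left)
    also have "\<dots> < (\<Sum>c\<in>R. card \<Omega>)" using small fin(3) \<open>R \<noteq> {}\<close> by (intro sum_strict_mono) auto
    finally show False by simp
  qed
  then obtain c where "?F c \<noteq> {}" "card \<Omega> \<le> card R * card (?F c)" by blast
  then show ?thesis by (intro exI[of _ "?F c"]) auto
qed

text \<open>The square \<open>(x\<^sub>i + y\<^sub>j - z\<^sub>k)\<^sup>2\<close> splits into three terms, each depending only on one edge of the
  triangle. Fixing the three sums therefore forces \<open>z\<^sub>k = x\<^sub>i + y\<^sub>j\<close> on all triangles, as in Behrend's
  construction.\<close>

definition level1 :: "('k \<times> 'k \<times> 'k) set \<Rightarrow> ('k \<Rightarrow> nat) \<Rightarrow> ('k \<Rightarrow> nat) \<Rightarrow> int" where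
  "level1 R x y = (\<Sum>(i, j, k)\<in>R. (int (x i) + int (y j))\<^sup>2)"

definition level2 :: "('k \<times> 'k \<times> 'k) set \<Rightarrow> ('k \<Rightarrow> nat) \<Rightarrow> ('k \<Rightarrow> nat) \<Rightarrow> int" where
  "level2 R y z = (\<Sum>(i, j, k)\<in>R. (int (z k))\<^sup>2 - 2 * int (y j) * int (z k))"

definition level3 :: "('k \<times> 'k \<times> 'k) set \<Rightarrow> ('k \<Rightarrow> nat) \<Rightarrow> ('k \<Rightarrow> nat) \<Rightarrow> int" where
  "level3 R x z = (\<Sum>(i, j, k)\<in>R. - 2 * int (x i) * int (z k))"

lemma level_sum:
  "level1 R x y + level2 R y z + level3 R x z = (\<Sum>(i, j, k)\<in>R. (int (x i) + int (y j) - int (z k))\<^sup>2)"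
  unfolding level1_def level2_def level3_def sum.distrib[symmetric]
  by (intro sum.cong refl) (auto simp: power2_eq_square algebra_simps)

lemma level_sum_eq_0:
  assumes "finite R" "level1 R x y + level2 R y z + level3 R x z = 0" "(i, j, k) \<in> R"
  shows "z k = x i + y j"
proof -
  have "(\<Sum>t\<in>R. (\<lambda>(i, j, k). (int (x i) + int (y j) - int (z k))\<^sup>2) t) = 0"
    using assms(2) unfolding level_sum by simp
  then have "\<forall>t \<in> R. (\<lambda>(i, j, k). (int (x i) + int (y j) - int (z k))\<^sup>2) t = 0"
    by (subst (asm) sum_nonneg_eq_0_iff[OF assms(1)]) auto
  then have "(int (x i) + int (y j) - int (z k))\<^sup>2 = 0" using assms(3) by force
  then show ?thesis by simp
qed

lemma level_bounds:
  assumes R: "finite R" "card R \<le> P" and lt: "\<And>i j k. (i, j, k) \<in> R \<Longrightarrow> x i \<le> N \<and> x j \<le> N \<and> x k \<le> N"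
  shows "\<bar>level1 R x x\<bar> \<le> 4 * int P * (int N)\<^sup>2" "\<bar>level2 R x x\<bar> \<le> 4 * int P * (int N)\<^sup>2"
    "\<bar>level3 R x x\<bar> \<le> 4 * int P * (int N)\<^sup>2"
proof -
  have bound: "\<bar>\<Sum>t\<in>R. f t\<bar> \<le> 4 * int P * (int N)\<^sup>2" if "\<And>t. t \<in> R \<Longrightarrow> \<bar>f t\<bar> \<le> 4 * (int N)\<^sup>2" for f
  proof -
    have "\<bar>\<Sum>t\<in>R. f t\<bar> \<le> (\<Sum>t\<in>R. \<bar>f t\<bar>)" by (rule sum_abs)
    also have "\<dots> \<le> (\<Sum>t\<in>R. 4 * (int N)\<^sup>2)" using that by (rule sum_mono)
    also have "\<dots> = int (card R) * (4 * (int N)\<^sup>2)" by simp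
    also have "\<dots> \<le> int P * (4 * (int N)\<^sup>2)" using R(2) by (intro mult_right_mono) auto
    finally show ?thesis by (simp add: mult_ac)
  qed
  have prod: "int a * int b \<le> (int N)\<^sup>2" if "a \<le> N" "b \<le> N" for a b
    unfolding power2_eq_square using that by (intro mult_mono) auto
  show "\<bar>level1 R x x\<bar> \<le> 4 * int P * (int N)\<^sup>2"
    unfolding level1_def
  proof (rule bound, clarify)
    fix i j k assume "(i, j, k) \<in> R"
    then have "(int (x i) + int (x j))\<^sup>2 \<le> (2 * int N)\<^sup>2"
      using lt by (intro power_mono) force+
    then show "\<bar>(int (x i) + int (x j))\<^sup>2\<bar> \<le> 4 * (int N)\<^sup>2" by (simp add: power_mult_distrib)
  qed
  show "\<bar>level2 R x x\<bar> \<le> 4 * int P * (int N)\<^sup>2"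
    unfolding level2_def
  proof (rule bound, clarify)
    fix i j k assume "(i, j, k) \<in> R"
    then have "int (x k) * int (x k) \<le> (int N)\<^sup>2" "int (x j) * int (x k) \<le> (int N)\<^sup>2"
      using prod lt by simp_all
    moreover have "0 \<le> int (x k) * int (x k)" "0 \<le> int (x j) * int (x k)" by simp_all
    ultimately show "\<bar>(int (x k))\<^sup>2 - 2 * int (x j) * int (x k)\<bar> \<le> 4 * (int N)\<^sup>2"
      unfolding power2_eq_square[of "int (x k)"] mult.assoc by linarith
  qed
  show "\<bar>level3 R x x\<bar> \<le> 4 * int P * (int N)\<^sup>2"
    unfolding level3_def
  proof (rule bound, clarify)
    fix i j k assume "(i, j, k) \<in> R"
    then have "int (x i) * int (x k) \<le> (int N)\<^sup>2" using prod lt by simp_all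
    moreover have "0 \<le> int (x i) * int (x k)" by simp
    ultimately show "\<bar>- 2 * int (x i) * int (x k)\<bar> \<le> 4 * (int N)\<^sup>2"
      unfolding mult.assoc by linarith
  qed
qed

section \<open>The blow-up graph of a level class\<close>

locale blowup =
  fixes H :: "'a pair_pre_digraph" and p :: "'a set \<Rightarrow> nat" and S :: "'a \<Rightarrow> 'a name set"
    and rel :: "'a \<Rightarrow> ('a name \<times> 'a name \<times> 'a name) set" and N :: nat and \<Omega> :: "('a name \<Rightarrow> nat) set"
  assumes H: "pair_graph H" and poly: "clique_polymatroid H p"
    and names: "names_for H p (pverts H) S rel"
    and card3: "\<And>Q. clique H Q \<Longrightarrow> card Q \<le> 3"
    and fin: "finite \<Omega>"
    and lt: "\<And>\<omega> x. \<omega> \<in> \<Omega> \<Longrightarrow> x \<in> \<Union> (S ` pverts H) \<Longrightarrow> \<omega> x < N"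
    and rel_sum: "\<And>\<omega> w i j k. \<omega> \<in> \<Omega> \<Longrightarrow> w \<in> pverts H \<Longrightarrow> (i, j, k) \<in> rel w \<Longrightarrow> \<omega> k = \<omega> i + \<omega> j"
    and eqI: "\<And>\<omega> \<omega>'. \<omega> \<in> \<Omega> \<Longrightarrow> \<omega>' \<in> \<Omega> \<Longrightarrow> (\<And>x. x \<in> \<Union> (S ` pverts H) \<Longrightarrow> \<omega> x = \<omega>' x) \<Longrightarrow> \<omega> = \<omega>'"
    and levels: "\<And>\<omega> \<omega>' w. \<omega> \<in> \<Omega> \<Longrightarrow> \<omega>' \<in> \<Omega> \<Longrightarrow> w \<in> pverts H \<Longrightarrow>
      level1 (rel w) \<omega> \<omega> = level1 (rel w) \<omega>' \<omega>' \<and> level2 (rel w) \<omega> \<omega> = level2 (rel w) \<omega>' \<omega>' \<and>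
      level3 (rel w) \<omega> \<omega> = level3 (rel w) \<omega>' \<omega>'"
begin

definition lab :: "('a name \<Rightarrow> nat) \<Rightarrow> 'a \<Rightarrow> 'a \<times> ('a name \<Rightarrow> nat)" where
  "lab \<omega> u = (u, restrict \<omega> (S u))"

text \<open>Every valuation contributes a copy of \<open>H\<close>, and copies overlap where the
  coordinates of a vertex agree. Homomorphisms into \<open>T\<close> may thus change valuations from
  edge to edge; the assumption \<open>levels\<close> limits the damage.\<close>

definition T :: "('a \<times> ('a name \<Rightarrow> nat)) pair_pre_digraph" where
  "T = \<lparr>pverts = (\<lambda>(\<omega>, u). lab \<omega> u) ` (\<Omega> \<times> pverts H),
        parcs = (\<lambda>(\<omega>, u, v). (lab \<omega> u, lab \<omega> v)) ` (\<Omega> \<times> parcs H)\<rparr>"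

lemma lab_eq_iff: "lab \<omega> u = lab \<omega>' v \<longleftrightarrow> u = v \<and> (\<forall>x \<in> S u. \<omega> x = \<omega>' x)"
  by (auto simp: lab_def restrict_def fun_eq_iff)

lemma snd_lab: "x \<in> S u \<Longrightarrow> snd (lab \<omega> u) x = \<omega> x"
  by (simp add: lab_def)

lemma vert_TE:
  assumes "y \<in> pverts T"
  obtains \<omega> where "\<omega> \<in> \<Omega>" "fst y \<in> pverts H" "y = lab \<omega> (fst y)"
  using assms by (auto simp: T_def lab_def)

lemma arc_TE:
  assumes "(y, z) \<in> parcs T"
  obtains \<omega> where "\<omega> \<in> \<Omega>" "(fst y, fst z) \<in> parcs H" "y = lab \<omega> (fst y)" "z = lab \<omega> (fst z)"
  using assms by (auto simp: T_def lab_def)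

lemma arc_TI: "\<omega> \<in> \<Omega> \<Longrightarrow> (u, v) \<in> parcs H \<Longrightarrow> (lab \<omega> u, lab \<omega> v) \<in> parcs T"
  by (force simp: T_def)

lemma pair_graph_T: "pair_graph T"
proof -
  interpret H: pair_graph H by (rule H)
  have verts: "y \<in> pverts T \<and> z \<in> pverts T" if "(y, z) \<in> parcs T" for y z
    using that H.in_arcsD1 H.in_arcsD2 by (fastforce simp: T_def)
  show ?thesis
  proof
    show "\<And>e. e \<in> parcs T \<Longrightarrow> fst e \<in> pverts T" "\<And>e. e \<in> parcs T \<Longrightarrow> snd e \<in> pverts T"
      using verts by auto
    show "finite (pverts T)" "finite (parcs T)"
      using fin H.pair_finite_verts H.pair_finite_arcs by (simp_all add: T_def)
    show "fst e \<noteq> snd e" if "e \<in> parcs T" for e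
    proof
      assume eq: "fst e = snd e"
      obtain y z where e: "e = (y, z)" by (metis surj_pair)
      with that have "(fst y, fst z) \<in> parcs H" by (auto elim: arc_TE)
      then show False using eq e pair_graph_irrefl[OF H] by auto
    qed
    have "sym (parcs T)"
    proof (rule symI)
      fix y z assume "(y, z) \<in> parcs T"
      then obtain \<omega> where w: "\<omega> \<in> \<Omega>" "(fst y, fst z) \<in> parcs H" "y = lab \<omega> (fst y)" "z = lab \<omega> (fst z)"
        by (rule arc_TE)
      show "(z, y) \<in> parcs T" using arc_TI[OF w(1) pair_graph_sym[OF H w(2)]] w(3,4) by simp
    qed
    then show "symmetric (with_proj T)" by (simp add: symmetric_def)
  qed
qed

lemma card_le_hom: "card \<Omega> \<le> hom H T"
proof -
  let ?f = "\<lambda>\<omega>. \<lambda>u \<in> pverts H. lab \<omega> u"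
  have "inj_on ?f \<Omega>"
  proof (rule inj_onI)
    fix \<omega> \<omega>' assume o: "\<omega> \<in> \<Omega>" "\<omega>' \<in> \<Omega>" "?f \<omega> = ?f \<omega>'"
    show "\<omega> = \<omega>'"
    proof (rule eqI[OF o(1,2)])
      fix x assume "x \<in> \<Union> (S ` pverts H)"
      then obtain u where u: "u \<in> pverts H" "x \<in> S u" by blast
      have "lab \<omega> u = lab \<omega>' u" using fun_cong[OF o(3), of u] u(1) by simp
      then show "\<omega> x = \<omega>' x" using u(2) by (simp add: lab_eq_iff)
    qed
  qed
  moreover have "?f ` \<Omega> \<subseteq> homs H T"
  proof clarify
    fix \<omega> assume o: "\<omega> \<in> \<Omega>"
    have "lab \<omega> u \<in> pverts T" if "u \<in> pverts H" for u using o that by (force simp: T_def)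
    moreover have "(lab \<omega> u, lab \<omega> v) \<in> parcs T" if "(u, v) \<in> parcs H" for u v by (rule arc_TI[OF o that])
    ultimately show "?f \<omega> \<in> homs H T" using pair_graph_verts[OF H] by (auto simp: homs_def)
  qed
  moreover have "finite (homs H T)" by (rule finite_homs[OF H pair_graph_T])
  ultimately show ?thesis unfolding hom_def by (metis card_image card_mono)
qed

text \<open>The three edges may come from three valuations, but each level depends on one edge only
  and is the same for all valuations in \<open>\<Omega>\<close>. The sum of the levels on the
  triangle is therefore that of a single valuation, which is 0, and a vanishing sum of squares gives
  every relation.\<close>

lemma triangle_sum:
  assumes tri: "triangle_names p S rel u v w" and w: "w \<in> pverts H"
    and arcs: "(a, b) \<in> parcs T" "(b, c) \<in> parcs T" "(a, c) \<in> parcs T"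
    and f: "fst a = u" "fst b = v" "fst c = w" and t: "(i, j, k) \<in> rel w"
  shows "snd c k = snd a i + snd b j"
proof -
  obtain \<omega>1 where o1: "\<omega>1 \<in> \<Omega>" "a = lab \<omega>1 u" "b = lab \<omega>1 v" using arcs(1) f by (metis arc_TE)
  obtain \<omega>2 where o2: "\<omega>2 \<in> \<Omega>" "b = lab \<omega>2 v" "c = lab \<omega>2 w" using arcs(2) f by (metis arc_TE)
  obtain \<omega>3 where o3: "\<omega>3 \<in> \<Omega>" "a = lab \<omega>3 u" "c = lab \<omega>3 w" using arcs(3) f by (metis arc_TE)
  have sub: "rel w \<subseteq> S u \<times> S v \<times> S w" using tri by (simp add: triangle_names_def)
  have fr: "finite (rel w)" using names_for_rel(1)[OF names w] by simp
  have a: "snd a x = \<omega>1 x" "snd a x = \<omega>3 x" if "x \<in> S u" for x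
    using that o1(2) o3(2) snd_lab by metis+
  have b: "snd b x = \<omega>1 x" "snd b x = \<omega>2 x" if "x \<in> S v" for x
    using that o1(3) o2(2) snd_lab by metis+
  have c: "snd c x = \<omega>2 x" "snd c x = \<omega>3 x" if "x \<in> S w" for x
    using that o2(3) o3(3) snd_lab by metis+
  have "level1 (rel w) (snd a) (snd b) = level1 (rel w) \<omega>1 \<omega>1"
    unfolding level1_def using sub a(1) b(1) by (intro sum.cong refl) auto
  moreover have "level2 (rel w) (snd b) (snd c) = level2 (rel w) \<omega>2 \<omega>2"
    unfolding level2_def using sub b(2) c(1) by (intro sum.cong refl) auto
  moreover have "level3 (rel w) (snd a) (snd c) = level3 (rel w) \<omega>3 \<omega>3"
    unfolding level3_def using sub a(2) c(2) by (intro sum.cong refl) auto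
  moreover have "level1 (rel w) \<omega>1 \<omega>1 + level2 (rel w) \<omega>1 \<omega>1 + level3 (rel w) \<omega>1 \<omega>1 = 0"
    unfolding level_sum using rel_sum[OF o1(1) w] by (intro sum.neutral) auto
  ultimately have "level1 (rel w) (snd a) (snd b) + level2 (rel w) (snd b) (snd c) + level3 (rel w) (snd a) (snd c) = 0"
    using levels[OF o1(1) o2(1) w] levels[OF o1(1) o3(1) w] by simp
  then show ?thesis by (rule level_sum_eq_0[OF fr _ t])
qed

lemma card_le_of_determined:
  assumes Y: "Y \<subseteq> {y \<in> pverts T. fst y = u}" and u: "u \<in> pverts H" and A: "A \<subseteq> S u"
    and det: "\<And>y z x. y \<in> Y \<Longrightarrow> z \<in> Y \<Longrightarrow> (\<And>x. x \<in> A \<Longrightarrow> snd y x = snd z x) \<Longrightarrow> x \<in> S u \<Longrightarrow> snd y x = snd z x"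
  shows "card Y \<le> N ^ card A"
proof -
  have fA: "finite A" using A names_for_vertex[OF names u] finite_subset by blast
  let ?r = "\<lambda>y. restrict (snd y) A"
  have ylab: "\<exists>\<omega> \<in> \<Omega>. y = lab \<omega> u" if "y \<in> Y" for y using that Y by (auto elim!: vert_TE)
  have "inj_on ?r Y"
  proof (rule inj_onI)
    fix y z assume yz: "y \<in> Y" "z \<in> Y" "?r y = ?r z"
    have "snd y x = snd z x" if "x \<in> A" for x using fun_cong[OF yz(3), of x] that by simp
    then have eq: "snd y x = snd z x" if "x \<in> S u" for x using det[OF yz(1,2)] that by blast
    obtain \<omega> \<omega>' where "y = lab \<omega> u" "z = lab \<omega>' u" using ylab yz by blast
    then show "y = z" using eq by (simp add: lab_eq_iff snd_lab)
  qed
  moreover have "?r ` Y \<subseteq> A \<rightarrow>\<^sub>E {..<N}"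
  proof clarify
    fix y assume "y \<in> Y"
    then obtain \<omega> where o: "\<omega> \<in> \<Omega>" "y = lab \<omega> u" using ylab by blast
    have "snd y x < N" if "x \<in> A" for x
    proof -
      have "x \<in> S u" using that A by blast
      then show ?thesis using lt[OF o(1), of x] u by (auto simp: o(2) snd_lab)
    qed
    then show "?r y \<in> A \<rightarrow>\<^sub>E {..<N}" by auto
  qed
  moreover have "finite (A \<rightarrow>\<^sub>E {..<N})" using fA by (simp add: finite_PiE)
  ultimately have "card Y \<le> card (A \<rightarrow>\<^sub>E {..<N})" by (metis card_image card_mono)
  then show ?thesis using fA by (simp add: card_PiE)
qed

lemma arc_agree:
  assumes "(y, z) \<in> parcs T" "x \<in> S (fst y)" "x \<in> S (fst z)"
  shows "snd y x = snd z x"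
  using assms by (metis arc_TE snd_lab)

text \<open>Coordinates shared with a vertex of \<open>Q\<close> are fixed by the arcs, and in a
  triangle the coordinates of \<open>u\<close> occurring in a relation are fixed by
  \<open>triangle_sum\<close>. The number of remaining ones is the conditional rank, by the choice
  of names.\<close>

lemma card_extensions:
  assumes cl: "clique H (insert u Q)" and uQ: "u \<notin> Q"
    and f: "\<And>v. v \<in> Q \<Longrightarrow> fst (f v) = v" and adj: "\<And>v v'. v \<in> Q \<Longrightarrow> v' \<in> Q \<Longrightarrow> v \<noteq> v' \<Longrightarrow> (f v, f v') \<in> parcs T"
  shows "card {y \<in> pverts T. fst y = u \<and> (\<forall>v \<in> Q. (f v, y) \<in> parcs T)} \<le> N ^ (p (insert u Q) - p Q)" (is "card ?Y \<le> _")
proof -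
  have symT: "(z, y) \<in> parcs T" if "(y, z) \<in> parcs T" for y z by (rule pair_graph_sym[OF pair_graph_T that])
  have V: "u \<in> pverts H" "Q \<subseteq> pverts H" using cl by (auto simp: clique_def)
  have finQ: "finite Q" using V(2) pair_graph_finite[OF H] finite_subset by blast
  have Yu: "?Y \<subseteq> {y \<in> pverts T. fst y = u}" by blast
  have "card Q \<le> 2" using card3[OF cl] uQ finQ by simp
  then consider "card Q = 0" | "card Q = 1" | "card Q = 2" by linarith
  then show ?thesis
  proof cases
    case 1
    then have Q: "Q = {}" using finQ by simp
    have "p {} = 0" using poly by (simp add: clique_polymatroid_def)
    moreover have "card ?Y \<le> N ^ card (S u)"
      by (rule card_le_of_determined[OF Yu V(1) order_refl]) blast
    ultimately show ?thesis using names_for_vertex[OF names V(1)] Q by simp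
  next
    case 2
    then obtain v where Q: "Q = {v}" by (rule card_1_singletonE)
    have uv: "(u, v) \<in> parcs H" "v \<in> pverts H" using cl uQ Q by (auto simp: clique_def)
    have "card ?Y \<le> N ^ card (S u - S v)"
    proof (rule card_le_of_determined[OF Yu V(1)])
      fix y z x assume yz: "y \<in> ?Y" "z \<in> ?Y" and eq: "\<And>x. x \<in> S u - S v \<Longrightarrow> snd y x = snd z x" and x: "x \<in> S u"
      show "snd y x = snd z x"
      proof (cases "x \<in> S v")
        case True
        then have "snd (f v) x = snd y x" "snd (f v) x = snd z x"
          using yz x Q f[of v] by (auto intro!: arc_agree)
        then show ?thesis by simp
      qed (use eq x in simp)
    qed blast
    moreover have "card (S u - S v) = p (insert u Q) - p Q"
    proof -
      have "card (S u \<union> S v) = p {u, v}" by (rule names_for_edge[OF names V(1) uv(2,1)])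
      moreover have "finite (S u)" "finite (S v)" "card (S v) = p {v}"
        using names_for_vertex[OF names] V(1) uv(2) by auto
      moreover have "card (S u \<union> S v) = card (S u - S v) + card (S v)"
        using card_Un_disjoint[of "S u - S v" "S v"] \<open>finite (S u)\<close> \<open>finite (S v)\<close>
        by (simp add: Diff_disjoint[of "S v" "S u"] Int_commute)
      ultimately show ?thesis using Q by simp
    qed
    ultimately show ?thesis by simp
  next
    case 3
    have c3: "card (insert u Q) = 3" using 3 uQ finQ by simp
    obtain a b c where abc: "insert u Q = {a, b, c}" and tri: "triangle_names p S rel a b c"
      using names_for_triangle[OF names _ cl c3] cl by (auto simp: clique_def)
    have ne: "a \<noteq> b" "a \<noteq> c" "b \<noteq> c"
      using c3 unfolding abc by (auto simp: card_insert_if split: if_splits)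
    have "c \<in> insert u Q" unfolding abc by simp
    then have cV: "c \<in> pverts H" using V by auto
    have relsub: "rel c \<subseteq> S a \<times> S b \<times> S c" using tri by (simp add: triangle_names_def)
    \<comment> \<open>The names come with their own ordering \<open>a\<close>, \<open>b\<close>,
      \<open>c\<close> of the triangle, in which \<open>u\<close> may have any place;
      \<open>g y\<close> is the triangle of \<open>T\<close> addressed in this ordering.\<close>
    define g where "g y v = (if v = u then y else f v)" for y v
    have gadj: "(g y v, g y v') \<in> parcs T" if "y \<in> ?Y" "v \<in> {a, b, c}" "v' \<in> {a, b, c}" "v \<noteq> v'" for y v v'
    proof -
      have "v = u \<or> v \<in> Q" "v' = u \<or> v' \<in> Q" using that(2,3) abc by blast+
      then consider "v = u" "v' \<in> Q" "v' \<noteq> u" | "v' = u" "v \<in> Q" "v \<noteq> u" | "v \<in> Q" "v' \<in> Q" "v \<noteq> u" "v' \<noteq> u"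
        using \<open>v \<noteq> v'\<close> uQ by blast
      then show ?thesis
      proof cases
        case 1
        then have "(f v', y) \<in> parcs T" using that(1) by simp
        from symT[OF this] show ?thesis using 1 by (simp add: g_def)
      next
        case 2
        then show ?thesis using that(1) by (simp add: g_def)
      next
        case 3
        then show ?thesis using adj that(4) by (simp add: g_def)
      qed
    qed
    have gfst: "fst (g y v) = v" if "y \<in> ?Y" "v \<in> {a, b, c}" for y v
    proof -
      have "v = u \<or> v \<in> Q" using that(2) abc by blast
      then show ?thesis using that(1) f unfolding g_def by auto
    qed
    have sum: "snd (g y c) k = snd (g y a) i + snd (g y b) j" if "y \<in> ?Y" "(i, j, k) \<in> rel c" for y i j k
      by (rule triangle_sum[OF tri cV _ _ _ _ _ _ that(2)]) (use gadj[OF that(1)] gfst[OF that(1)] ne in auto)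
    have agree: "snd (g y v) x = snd (g y v') x"
      if "y \<in> ?Y" "v \<in> {a, b, c}" "v' \<in> {a, b, c}" "x \<in> S v" "x \<in> S v'" for y v v' x
    proof (cases "v = v'")
      case False
      show ?thesis by (rule arc_agree[OF gadj[OF that(1-3) False]]) (use gfst that in auto)
    qed simp
    have det: "snd y x = snd z x" if yz: "y \<in> ?Y" "z \<in> ?Y" and x: "x \<in> S u" "v \<in> {a, b, c}" "v \<noteq> u" "x \<in> S v" for y z x v
    proof -
      have u: "u \<in> {a, b, c}" using abc by blast
      have "snd (g y u) x = snd (g y v) x" "snd (g z u) x = snd (g z v) x"
        using agree[OF yz(1) u x(2,1,4)] agree[OF yz(2) u x(2,1,4)] .
      then show ?thesis using x(3) by (simp add: g_def)
    qed
    have pabc: "p (insert u Q) = p {a, b, c}" by (simp only: abc)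
    \<comment> \<open>\<open>X\<close> will be the coordinates of \<open>u\<close> in the relations,
      namely the projection of \<open>rel c\<close> to the place of \<open>u\<close>. Each relation
      determines any one of its entries from the other two, so all three places are alike.\<close>
    have finish: "card ?Y \<le> N ^ (p (insert u Q) - p Q)"
      if "card (S u - (S v \<union> S v' \<union> X)) + p Q = p {a, b, c}" and v: "v \<in> {a, b, c}" "v \<noteq> u" "v' \<in> {a, b, c}" "v' \<noteq> u"
        and X: "\<And>y z x. y \<in> ?Y \<Longrightarrow> z \<in> ?Y \<Longrightarrow> x \<in> X \<Longrightarrow> snd y x = snd z x" for v v' X
    proof -
      have "card ?Y \<le> N ^ card (S u - (S v \<union> S v' \<union> X))"
      proof (rule card_le_of_determined[OF Yu V(1)])
        fix y z x assume yz: "y \<in> ?Y" "z \<in> ?Y" and x: "x \<in> S u"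
          and eq: "\<And>x. x \<in> S u - (S v \<union> S v' \<union> X) \<Longrightarrow> snd y x = snd z x"
        consider "x \<in> S u - (S v \<union> S v' \<union> X)" | "x \<in> S v" | "x \<in> S v'" | "x \<in> X" using x by blast
        then show "snd y x = snd z x"
          by cases (use eq det[OF yz x v(1,2)] det[OF yz x v(3,4)] X[OF yz] in auto)
      qed blast
      moreover have "card (S u - (S v \<union> S v' \<union> X)) = p (insert u Q) - p Q"
        using that(1) by (simp add: pabc)
      ultimately show ?thesis by simp
    qed
    have "u = a \<or> u = b \<or> u = c" using abc by blast
    then show ?thesis
    proof (elim disjE)
      assume ua: "u = a"
      have Q: "Q = {b, c}" using abc uQ ne ua by auto
      show ?thesis
      proof (rule finish[of b c "fst ` rel c"])
        fix y z x assume yz: "y \<in> ?Y" "z \<in> ?Y" "x \<in> fst ` rel c"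
        then obtain j k where t: "(x, j, k) \<in> rel c" by force
        show "snd y x = snd z x"
          using sum[OF yz(1) t] sum[OF yz(2) t] ua ne by (simp add: g_def)
      qed (use tri ua ne Q in \<open>simp_all add: triangle_names_def\<close>)
    next
      assume ub: "u = b"
      have Q: "Q = {a, c}" using abc uQ ne ub by auto
      show ?thesis
      proof (rule finish[of a c "(fst \<circ> snd) ` rel c"])
        fix y z x assume yz: "y \<in> ?Y" "z \<in> ?Y" "x \<in> (fst \<circ> snd) ` rel c"
        then obtain i k where t: "(i, x, k) \<in> rel c" by force
        show "snd y x = snd z x"
          using sum[OF yz(1) t] sum[OF yz(2) t] ub ne by (simp add: g_def)
      qed (use tri ub ne Q in \<open>simp_all add: triangle_names_def\<close>)
    next
      assume uc: "u = c"
      have Q: "Q = {a, b}" using abc uQ ne uc by auto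
      show ?thesis
      proof (rule finish[of a b "(snd \<circ> snd) ` rel c"])
        fix y z x assume yz: "y \<in> ?Y" "z \<in> ?Y" "x \<in> (snd \<circ> snd) ` rel c"
        then obtain i j where t: "(i, j, x) \<in> rel c" by force
        show "snd y x = snd z x"
          using sum[OF yz(1) t] sum[OF yz(2) t] uc ne by (simp add: g_def)
      qed (use tri uc ne Q in \<open>simp_all add: triangle_names_def\<close>)
    qed
  qed
qed

definition lifts :: "'b pair_pre_digraph \<Rightarrow> ('b \<Rightarrow> 'a) \<Rightarrow> 'b set \<Rightarrow> ('b \<Rightarrow> 'a \<times> ('a name \<Rightarrow> nat)) set" where
  "lifts G \<phi> W = {g \<in> W \<rightarrow>\<^sub>E pverts T. (\<forall>u \<in> W. fst (g u) = \<phi> u) \<and>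
     (\<forall>u \<in> W. \<forall>v \<in> W. (u, v) \<in> parcs G \<longrightarrow> (g u, g v) \<in> parcs T)}"

text \<open>Vertices are added from the end of the elimination ordering. The later neighbours of
  \<open>w\<close> form a clique, on which \<open>\<phi>\<close> is injective because
  \<open>H\<close> has no loops; so \<open>card_extensions\<close> bounds the choices for
  \<open>w\<close> by one factor of the product.\<close>

lemma card_lifts:
  assumes G: "pair_graph G" and peo: "peo G vs" and N: "0 < N"
    and \<phi>: "\<And>u. u \<in> set vs \<Longrightarrow> \<phi> u \<in> pverts H" "\<And>u v. (u, v) \<in> parcs G \<Longrightarrow> (\<phi> u, \<phi> v) \<in> parcs H"
  shows "finite (lifts G \<phi> (set vs)) \<and>
    real (card (lifts G \<phi> (set vs))) \<le> real N powr chain_rank G (\<lambda>Q. real (p (\<phi> ` Q))) vs"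
  using peo \<phi>(1)
proof (induction vs)
  case Nil
  have "lifts G \<phi> (set []) = {\<lambda>x. undefined}" by (auto simp: lifts_def)
  then show ?case using N by simp
next
  case (Cons w vs)
  let ?K = "nbrs G (set vs) w" and ?X = "lifts G \<phi> (set vs)"
  let ?E = "\<lambda>g. {y \<in> pverts T. fst y = \<phi> w \<and> (\<forall>v \<in> ?K. (g v, y) \<in> parcs T)}"
  let ?e = "p (\<phi> ` insert w ?K) - p (\<phi> ` ?K)"
  have IH: "finite ?X" "real (card ?X) \<le> real N powr chain_rank G (\<lambda>Q. real (p (\<phi> ` Q))) vs"
    using Cons by auto
  have cl: "clique G (insert w ?K)" by (rule clique_insert_nbrs[OF G Cons.prems(1)])
  have KW: "?K \<subseteq> set vs" and wK: "w \<notin> set vs" using Cons.prems(1) by (auto simp: nbrs_def)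
  have ne: "\<phi> u \<noteq> \<phi> v" if "(u, v) \<in> parcs G" for u v
    using \<phi>(2)[OF that] pair_graph_irrefl[OF H] by metis
  have clH: "clique H (insert (\<phi> w) (\<phi> ` ?K))"
  proof -
    have "\<phi> u \<in> pverts H" if "u \<in> insert w ?K" for u using Cons.prems(2)[of u] KW that by auto
    moreover have "(\<phi> u, \<phi> v) \<in> parcs H" if "u \<in> insert w ?K" "v \<in> insert w ?K" "\<phi> u \<noteq> \<phi> v" for u v
      using \<phi>(2)[of u v] cl that unfolding clique_def by metis
    ultimately have "clique H (\<phi> ` insert w ?K)" unfolding clique_def by blast
    then show ?thesis by simp
  qed
  have inj: "inj_on \<phi> ?K"
    using cl ne unfolding inj_on_def clique_def by (metis insertCI)
  have w\<phi>: "\<phi> w \<notin> \<phi> ` ?K" using ne by (auto simp: nbrs_def)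
  have ext: "card (?E g) \<le> N ^ ?e" if g: "g \<in> ?X" for g
  proof -
    let ?f = "\<lambda>v. g (inv_into ?K \<phi> v)"
    have inv: "inv_into ?K \<phi> (\<phi> v) = v" if "v \<in> ?K" for v using inv_into_f_f[OF inj that] .
    have "card {y \<in> pverts T. fst y = \<phi> w \<and> (\<forall>v \<in> \<phi> ` ?K. (?f v, y) \<in> parcs T)} \<le> N ^ (p (insert (\<phi> w) (\<phi> ` ?K)) - p (\<phi> ` ?K))"
    proof (rule card_extensions[OF clH w\<phi>])
      show "fst (?f v) = v" if "v \<in> \<phi> ` ?K" for v
      proof -
        obtain u where "u \<in> ?K" "v = \<phi> u" using \<open>v \<in> \<phi> ` ?K\<close> by blast
        moreover have "u \<in> set vs" using \<open>u \<in> ?K\<close> KW by blast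
        ultimately show ?thesis using g inv by (simp add: lifts_def)
      qed
      show "(?f v, ?f v') \<in> parcs T" if vv: "v \<in> \<phi> ` ?K" "v' \<in> \<phi> ` ?K" "v \<noteq> v'" for v v'
      proof -
        obtain u u' where u: "u \<in> ?K" "v = \<phi> u" "u' \<in> ?K" "v' = \<phi> u'" using vv by blast
        then have "(u, u') \<in> parcs G" using cl vv(3) unfolding clique_def by (metis insertCI)
        moreover have "u \<in> set vs" "u' \<in> set vs" using u KW by blast+
        ultimately show ?thesis using g inv u by (simp add: lifts_def)
      qed
    qed
    moreover have "{y \<in> pverts T. fst y = \<phi> w \<and> (\<forall>v \<in> \<phi> ` ?K. (?f v, y) \<in> parcs T)} = ?E g" using inv by auto
    ultimately show ?thesis by simp
  qed
  have finE: "finite (?E g)" for g using pair_graph_finite[OF pair_graph_T] by simp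
  have sub: "lifts G \<phi> (set (w # vs)) \<subseteq> (\<lambda>(g, y). g(w := y)) ` (SIGMA g:?X. ?E g)"
  proof
    fix h assume h: "h \<in> lifts G \<phi> (set (w # vs))"
    let ?g = "restrict h (set vs)"
    have "?g \<in> ?X" using h by (auto simp: lifts_def)
    moreover have "h w \<in> ?E ?g"
    proof -
      have "(h v, h w) \<in> parcs T" if "v \<in> ?K" for v
      proof -
        have "(v, w) \<in> parcs G" using that pair_graph_sym[OF G, of w v] by (simp add: nbrs_def)
        then show ?thesis using h that KW by (auto simp: lifts_def)
      qed
      then show ?thesis using h KW by (auto simp: lifts_def)
    qed
    moreover have "h = ?g(w := h w)" using h by (auto simp: lifts_def PiE_def extensional_def fun_eq_iff)
    ultimately show "h \<in> (\<lambda>(g, y). g(w := y)) ` (SIGMA g:?X. ?E g)"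
      by (intro image_eqI[of _ _ "(?g, h w)"]) simp_all
  qed
  have finS: "finite (SIGMA g:?X. ?E g)" using IH(1) finE by blast
  have "card (lifts G \<phi> (set (w # vs))) \<le> card (SIGMA g:?X. ?E g)"
    using surj_card_le[OF finS sub] .
  also have "\<dots> = (\<Sum>g\<in>?X. card (?E g))" using IH(1) finE by (simp add: card_SigmaI)
  also have "\<dots> \<le> (\<Sum>g\<in>?X. N ^ ?e)" using ext by (rule sum_mono)
  also have "\<dots> = card ?X * N ^ ?e" by simp
  finally have "real (card (lifts G \<phi> (set (w # vs)))) \<le> real (card ?X) * real N ^ ?e"
    by (metis of_nat_le_iff of_nat_mult of_nat_power)
  also have "\<dots> \<le> real N powr chain_rank G (\<lambda>Q. real (p (\<phi> ` Q))) vs * real N powr real ?e"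
    using IH(2) N by (simp add: powr_realpow mult_right_mono)
  also have "\<dots> = real N powr chain_rank G (\<lambda>Q. real (p (\<phi> ` Q))) (w # vs)"
  proof -
    have "p (\<phi> ` ?K) \<le> p (\<phi> ` insert w ?K)"
      using clique_polymatroid_mono[OF poly clH, of "\<phi> ` ?K"] by auto
    then show ?thesis by (simp add: powr_add[symmetric] of_nat_diff add.commute)
  qed
  finally show ?case using finite_subset[OF sub] finS by blast
qed

lemma hom_le:
  assumes G: "pair_graph G" "peo G vs" "set vs = pverts G" and N: "0 < N"
  shows "real (hom G T) \<le> (\<Sum>\<phi>\<in>homs G H. real N powr chain_rank G (\<lambda>Q. real (p (\<phi> ` Q))) vs)"
proof -
  have finH: "finite (homs G H)"
    by (rule finite_homs[OF G(1) H])
  have lift: "finite (lifts G \<phi> (pverts G))"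
    "real (card (lifts G \<phi> (pverts G))) \<le> real N powr chain_rank G (\<lambda>Q. real (p (\<phi> ` Q))) vs"
    if "\<phi> \<in> homs G H" for \<phi>
    using card_lifts[OF G(1,2) N, of \<phi>] that unfolding G(3)[symmetric] by (auto simp: homs_def G(3))
  have "homs G T \<subseteq> (\<Union>\<phi>\<in>homs G H. lifts G \<phi> (pverts G))"
  proof
    fix g assume g: "g \<in> homs G T"
    let ?\<phi> = "\<lambda>u \<in> pverts G. fst (g u)"
    have "fst (g u) \<in> pverts H" if "u \<in> pverts G" for u
    proof -
      have "g u \<in> pverts T" using g that by (auto simp: homs_def)
      then show ?thesis by (auto elim: vert_TE)
    qed
    moreover have "(fst (g u), fst (g v)) \<in> parcs H" if "(u, v) \<in> parcs G" for u v
    proof -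
      have "(g u, g v) \<in> parcs T" using g that by (auto simp: homs_def)
      then show ?thesis by (auto elim: arc_TE)
    qed
    ultimately have "?\<phi> \<in> homs G H" using pair_graph_verts[OF G(1)] by (auto simp: homs_def)
    moreover have "g \<in> lifts G ?\<phi> (pverts G)" using g by (auto simp: homs_def lifts_def)
    ultimately show "g \<in> (\<Union>\<phi>\<in>homs G H. lifts G \<phi> (pverts G))" by blast
  qed
  then have "hom G T \<le> card (\<Union>\<phi>\<in>homs G H. lifts G \<phi> (pverts G))"
    unfolding hom_def using finH lift(1) by (intro card_mono) auto
  also have "\<dots> \<le> (\<Sum>\<phi>\<in>homs G H. card (lifts G \<phi> (pverts G)))" by (rule card_UN_le[OF finH])
  finally have "real (hom G T) \<le> (\<Sum>\<phi>\<in>homs G H. real (card (lifts G \<phi> (pverts G))))"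
    by (metis of_nat_le_iff of_nat_sum)
  also have "\<dots> \<le> (\<Sum>\<phi>\<in>homs G H. real N powr chain_rank G (\<lambda>Q. real (p (\<phi> ` Q))) vs)"
    by (rule sum_mono) (rule lift(2))
  finally show ?thesis .
qed

end

text \<open>Each level of each vertex is an integer between \<open>- 4 * P * N\<^sup>2\<close> and
  \<open>4 * P * N\<^sup>2\<close>. Three levels at every vertex give the stated number of classes,
  and the blow-up uses a class of at least average size.\<close>

lemma blowup_exists:
  fixes H :: "'a pair_pre_digraph" and p :: "'a set \<Rightarrow> nat"
  assumes H: "pair_graph H" and poly: "clique_polymatroid H p" and peo: "peo H vs" "set vs = pverts H"
    and card3: "\<And>Q. clique H Q \<Longrightarrow> card Q \<le> 3" and n: "0 < n" and P: "\<And>u. u \<in> pverts H \<Longrightarrow> p {u} \<le> P"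
  defines "N \<equiv> 2 ^ length vs * n"
  shows "\<exists>T :: ('a \<times> ('a name \<Rightarrow> nat)) pair_pre_digraph. pair_graph T \<and>
    real n powr chain_rank H (\<lambda>Q. real (p Q)) vs \<le> real ((8 * P * N\<^sup>2 + 1) ^ (3 * card (pverts H))) * real (hom H T) \<and>
    (\<forall>(G :: 'a pair_pre_digraph) us. pair_graph G \<and> peo G us \<and> set us = pverts G \<longrightarrow>
      real (hom G T) \<le> (\<Sum>\<phi>\<in>homs G H. real N powr chain_rank G (\<lambda>Q. real (p (\<phi> ` Q))) us))"
proof -
  let ?V = "pverts H"
  obtain S rel \<Omega> where names: "names_for H p ?V S rel"
    and val: "valuations_for n N (chain_rank H (\<lambda>Q. real (p Q)) vs) ?V S rel \<Omega>"
    using names_exist[OF H poly n card3 peo(1)] unfolding peo(2) N_def by blast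
  have fin\<Omega>: "finite \<Omega>" "real (card \<Omega>) = real n powr chain_rank H (\<lambda>Q. real (p Q)) vs"
    using val by (simp_all only: valuations_for_def)
  have "\<Omega> \<noteq> {}" using fin\<Omega>(2) n by auto
  define Z where "Z = {- (4 * int P * (int N)\<^sup>2) .. 4 * int P * (int N)\<^sup>2}"
  define \<sigma> where "\<sigma> \<omega> = (\<lambda>w \<in> ?V. (level1 (rel w) \<omega> \<omega>, level2 (rel w) \<omega> \<omega>, level3 (rel w) \<omega> \<omega>))" for \<omega>
  let ?R = "PiE ?V (\<lambda>_. Z \<times> Z \<times> Z)"
  have finV: "finite ?V" by (rule pair_graph_finite[OF H])
  have finR: "finite ?R" using finV by (intro finite_PiE) (auto simp: Z_def)
  have cardZ: "card Z = 8 * P * N\<^sup>2 + 1"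
    by (simp add: Z_def nat_add_distrib nat_mult_distrib nat_power_eq)
  have cardR: "card ?R = (8 * P * N\<^sup>2 + 1) ^ (3 * card ?V)"
    by (simp only: card_PiE[OF finV] card_cartesian_product cardZ prod_constant power_mult power3_eq_cube mult.assoc)
  have "\<sigma> ` \<Omega> \<subseteq> ?R"
  proof clarify
    fix \<omega> assume o: "\<omega> \<in> \<Omega>"
    have "(level1 (rel w) \<omega> \<omega>, level2 (rel w) \<omega> \<omega>, level3 (rel w) \<omega> \<omega>) \<in> Z \<times> Z \<times> Z" if w: "w \<in> ?V" for w
    proof -
      have R: "finite (rel w)" "card (rel w) \<le> P" using names_for_rel(1)[OF names w] P[OF w] by simp_all
      have "\<omega> i \<le> N \<and> \<omega> j \<le> N \<and> \<omega> k \<le> N" if "(i, j, k) \<in> rel w" for i j k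
      proof -
        have "\<omega> x \<le> N" if "x \<in> {i, j, k}" for x
          using valuations_for_lt[OF val o, of x] names_for_rel(2)[OF names w \<open>(i, j, k) \<in> rel w\<close>] that
          by (meson less_imp_le subsetD)
        then show ?thesis by simp
      qed
      from level_bounds[where x = \<omega>, OF R this] show ?thesis by (simp add: Z_def abs_le_iff)
    qed
    then show "\<sigma> \<omega> \<in> ?R" by (simp add: \<sigma>_def)
  qed
  from pigeonhole_fibre[OF fin\<Omega>(1) \<open>\<Omega> \<noteq> {}\<close> finR this]
  obtain \<Omega>' where \<Omega>': "\<Omega>' \<subseteq> \<Omega>" "\<forall>a \<in> \<Omega>'. \<forall>b \<in> \<Omega>'. \<sigma> a = \<sigma> b" "card \<Omega> \<le> card ?R * card \<Omega>'" by blast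
  interpret blowup H p S rel N \<Omega>'
  proof (rule blowup.intro)
    show "pair_graph H" "clique_polymatroid H p" "names_for H p ?V S rel" by fact+
    show "card Q \<le> 3" if "clique H Q" for Q using card3[OF that] .
    show "finite \<Omega>'" using \<Omega>'(1) fin\<Omega>(1) finite_subset by blast
    show "\<omega> x < N" if "\<omega> \<in> \<Omega>'" "x \<in> \<Union> (S ` ?V)" for \<omega> x
      using valuations_for_lt[OF val subsetD[OF \<Omega>'(1) that(1)] that(2)] .
    show "\<omega> k = \<omega> i + \<omega> j" if "\<omega> \<in> \<Omega>'" "w \<in> ?V" "(i, j, k) \<in> rel w" for \<omega> w i j k
      using valuations_for_rel[OF val subsetD[OF \<Omega>'(1) that(1)] that(2,3)] .
    show "\<omega> = \<omega>'" if "\<omega> \<in> \<Omega>'" "\<omega>' \<in> \<Omega>'" "\<And>x. x \<in> \<Union> (S ` ?V) \<Longrightarrow> \<omega> x = \<omega>' x" for \<omega> \<omega>'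
      using valuations_for_eq[OF val subsetD[OF \<Omega>'(1) that(1)] subsetD[OF \<Omega>'(1) that(2)] that(3)] .
    show "level1 (rel w) \<omega> \<omega> = level1 (rel w) \<omega>' \<omega>' \<and> level2 (rel w) \<omega> \<omega> = level2 (rel w) \<omega>' \<omega>' \<and>
      level3 (rel w) \<omega> \<omega> = level3 (rel w) \<omega>' \<omega>'" if "\<omega> \<in> \<Omega>'" "\<omega>' \<in> \<Omega>'" "w \<in> ?V" for \<omega> \<omega>' w
    proof -
      have "\<sigma> \<omega> w = \<sigma> \<omega>' w" using \<Omega>'(2) that(1,2) by metis
      then show ?thesis using that(3) by (simp add: \<sigma>_def)
    qed
  qed
  have "real n powr chain_rank H (\<lambda>Q. real (p Q)) vs \<le> real (card ?R * hom H T)"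
    unfolding fin\<Omega>(2)[symmetric] of_nat_le_iff using \<Omega>'(3) card_le_hom by (meson le_trans mult_le_mono2)
  moreover have "0 < N" using n by (simp add: N_def)
  ultimately show ?thesis
    using pair_graph_T hom_le unfolding cardR by (intro exI[of _ T] conjI) (simp_all only: of_nat_mult, blast)
qed

section \<open>Disjoint unions\<close>

lemma connected_constant:
  assumes H: "pair_graph H" and con: "Digraph_Component.connected (with_proj H)"
    and c: "\<And>u v. (u, v) \<in> parcs H \<Longrightarrow> c u = c v" and uv: "u \<in> pverts H" "v \<in> pverts H"
  shows "c u = c v"
proof -
  have "(u, v) \<in> rtrancl_on (pverts H) ((parcs H)\<^sup>s)"
    using con uv unfolding connected_conv by simp
  then show ?thesis
  proof (induction rule: rtrancl_on_induct)
    case (step y z)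
    then have "(y, z) \<in> parcs H \<or> (z, y) \<in> parcs H" by (auto simp: symcl_def)
    then have "c y = c z" using c by metis
    then show ?case using step by simp
  qed simp
qed

text \<open>A connected graph maps into a single component. The two bounds determine the count up to
  the factor \<open>CARD('n)\<close>, so on the logarithmic scale the union realises the maximum
  over \<open>j\<close>. The vertices are relabelled by natural numbers as
  \<open>number_profile\<close> requires.\<close>

lemma disjoint_union_exists:
  fixes T :: "'n::finite \<Rightarrow> 'c pair_pre_digraph"
  assumes T: "\<And>j. pair_graph (T j)"
  shows "\<exists>G :: nat pair_pre_digraph. pair_graph G \<and>
    (\<forall>H :: 'a pair_pre_digraph. pair_graph H \<and> Digraph_Component.connected (with_proj H) \<longrightarrow>
      (\<forall>j. hom H (T j) \<le> hom H G) \<and> hom H G \<le> (\<Sum>j\<in>UNIV. hom H (T j)))"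
proof -
  define W where "W = (SIGMA j:UNIV. pverts (T j))"
  have finW: "finite W" unfolding W_def by (intro finite_SigmaI finite pair_graph_finite[OF T])
  obtain e :: "'n \<times> 'c \<Rightarrow> nat" where inj: "inj_on e W"
    using finite_imp_inj_to_nat_seg[OF finW] by blast
  define G where "G = \<lparr>pverts = e ` W, parcs = {(e (j, u), e (j, v)) |j u v. (u, v) \<in> parcs (T j)}\<rparr>"
  have pG: "(x, y) \<in> parcs G \<longleftrightarrow> (\<exists>j u v. x = e (j, u) \<and> y = e (j, v) \<and> (u, v) \<in> parcs (T j))" for x y
    unfolding G_def by simp
  have TW: "(j, u) \<in> W" "(j, v) \<in> W" if "(u, v) \<in> parcs (T j)" for j u v
    using pair_graph_verts[OF T that] by (auto simp: W_def)
  have sub: "parcs G \<subseteq> pverts G \<times> pverts G" using TW by (auto simp: G_def)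
  have G: "pair_graph G"
  proof
    show "\<And>e. e \<in> parcs G \<Longrightarrow> fst e \<in> pverts G" "\<And>e. e \<in> parcs G \<Longrightarrow> snd e \<in> pverts G"
      using sub by auto
    show fin: "finite (pverts G)" using finW by (simp add: G_def)
    show "finite (parcs G)" using sub fin finite_subset by blast
    have "sym (parcs G)"
      by (rule symI) (auto simp: G_def dest: pair_graph_sym[OF T])
    then show "symmetric (with_proj G)" by (simp add: symmetric_def)
    show "fst a \<noteq> snd a" if "a \<in> parcs G" for a
    proof
      assume eq: "fst a = snd a"
      obtain j u v where a: "a = (e (j, u), e (j, v))" "(u, v) \<in> parcs (T j)"
        using \<open>a \<in> parcs G\<close> pG[of "fst a" "snd a"] by (metis prod.collapse)
      have "(j, u) = (j, v)" by (rule inj_onD[OF inj]) (use eq a TW[OF a(2)] in auto)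
      then show False using a(2) pair_graph_irrefl[OF T] by auto
    qed
  qed
  have arcG: "(u, v) \<in> parcs (T j) \<and> j = j'"
    if "(e (j, u), e (j', v)) \<in> parcs G" "(j, u) \<in> W" "(j', v) \<in> W" for j j' u v
  proof -
    obtain i a b where "e (j, u) = e (i, a)" "e (j', v) = e (i, b)" "(a, b) \<in> parcs (T i)"
      using \<open>(e (j, u), e (j', v)) \<in> parcs G\<close> unfolding pG by blast
    moreover from this have "(j, u) = (i, a)" "(j', v) = (i, b)"
      using inj_onD[OF inj] TW that(2,3) by metis+
    ultimately show ?thesis by simp
  qed
  have "(\<forall>j. hom H (T j) \<le> hom H G) \<and> hom H G \<le> (\<Sum>j\<in>UNIV. hom H (T j))"
    if H: "pair_graph H" and con: "Digraph_Component.connected (with_proj H)" for H :: "'a pair_pre_digraph"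
  proof (intro conjI allI)
    let ?V = "pverts H"
    let ?f = "\<lambda>j g. \<lambda>u \<in> ?V. e (j, g u)"
    note HV = pair_graph_verts[OF H]
    fix j
    have "inj_on (?f j) (homs H (T j))"
    proof (rule inj_onI)
      fix g g' assume g: "g \<in> homs H (T j)" "g' \<in> homs H (T j)" "?f j g = ?f j g'"
      have gP: "g \<in> ?V \<rightarrow>\<^sub>E pverts (T j)" "g' \<in> ?V \<rightarrow>\<^sub>E pverts (T j)" using g by (auto simp: homs_def)
      have "g u = g' u" if "u \<in> ?V" for u
      proof -
        have "e (j, g u) = e (j, g' u)" using fun_cong[OF g(3), of u] that by simp
        moreover have "(j, g u) \<in> W" "(j, g' u) \<in> W" using gP that by (auto simp: W_def)
        ultimately have "(j, g u) = (j, g' u)" using inj_onD[OF inj] by metis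
        then show ?thesis by simp
      qed
      then show "g = g'" by (rule PiE_ext[OF gP])
    qed
    moreover have "?f j ` homs H (T j) \<subseteq> homs H G"
    proof clarify
      fix g assume g: "g \<in> homs H (T j)"
      have "e (j, g u) \<in> pverts G" if "u \<in> ?V" for u
        using g that by (auto simp: homs_def G_def W_def)
      moreover have "(e (j, g u), e (j, g v)) \<in> parcs G" if "(u, v) \<in> parcs H" for u v
      proof -
        have "(g u, g v) \<in> parcs (T j)" using g that by (auto simp: homs_def)
        then show ?thesis unfolding pG by blast
      qed
      ultimately show "?f j g \<in> homs H G" using HV by (auto simp: homs_def)
    qed
    ultimately show "hom H (T j) \<le> hom H G"
      unfolding hom_def using finite_homs[OF H G] by (metis card_image card_mono)
  next
    let ?V = "pverts H"
    let ?f = "\<lambda>j g. \<lambda>u \<in> ?V. e (j, g u)"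
    obtain u0 where u0: "u0 \<in> ?V" using con unfolding connected_conv by auto
    have "homs H G \<subseteq> (\<Union>j. ?f j ` homs H (T j))"
    proof
      fix g assume g: "g \<in> homs H G"
      define d where "d u = inv_into W e (g u)" for u
      have d: "d u \<in> W" "e (d u) = g u" if "u \<in> ?V" for u
      proof -
        have "g u \<in> e ` W" using g that by (auto simp: homs_def G_def)
        then show "d u \<in> W" "e (d u) = g u" unfolding d_def by (auto intro: inv_into_into f_inv_into_f)
      qed
      have arc: "(snd (d u), snd (d v)) \<in> parcs (T (fst (d u))) \<and> fst (d u) = fst (d v)" if "(u, v) \<in> parcs H" for u v
      proof -
        have uv: "u \<in> ?V" "v \<in> ?V" using pair_graph_verts[OF H that] .
        have "(g u, g v) \<in> parcs G" using g that by (auto simp: homs_def)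
        then have "(e (fst (d u), snd (d u)), e (fst (d v), snd (d v))) \<in> parcs G" using d(2) uv by simp
        from arcG[OF this] show ?thesis using d(1) uv by (metis prod.collapse)
      qed
      define j where "j = fst (d u0)"
      have dj: "fst (d u) = j" if "u \<in> ?V" for u
        unfolding j_def by (rule connected_constant[OF H con _ that u0]) (use arc in blast)
      let ?g = "\<lambda>u \<in> ?V. snd (d u)"
      have "snd (d u) \<in> pverts (T j)" if "u \<in> ?V" for u
        using d(1)[OF that] dj[OF that] by (auto simp: W_def)
      moreover have "(snd (d u), snd (d v)) \<in> parcs (T j)" if "(u, v) \<in> parcs H" for u v
        using arc[OF that] dj[OF pair_graph_verts(1)[OF H that]] by metis
      ultimately have "?g \<in> homs H (T j)" using pair_graph_verts[OF H] by (auto simp: homs_def)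
      moreover have "g = ?f j ?g"
      proof
        fix u
        show "g u = ?f j ?g u"
        proof (cases "u \<in> ?V")
          case True
          have "d u = (j, snd (d u))" using dj[OF True] by (metis prod.collapse)
          then show ?thesis using True d(2)[OF True] by simp
        next
          case False
          then show ?thesis using g by (auto simp: homs_def PiE_def extensional_def)
        qed
      qed
      ultimately show "g \<in> (\<Union>j. ?f j ` homs H (T j))" by blast
    qed
    then have "hom H G \<le> card (\<Union>j. ?f j ` homs H (T j))"
      unfolding hom_def using finite_homs[OF H T] by (intro card_mono) auto
    also have "\<dots> \<le> (\<Sum>j\<in>UNIV. card (?f j ` homs H (T j)))" by (rule card_UN_le) simp
    also have "\<dots> \<le> (\<Sum>j\<in>UNIV. hom H (T j))"
      unfolding hom_def by (intro sum_mono card_image_le finite_homs[OF H T])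
    finally show "hom H G \<le> (\<Sum>j\<in>UNIV. hom H (T j))" .
  qed
  then show ?thesis using G by blast
qed

section \<open>The cone of clique ranks\<close>

lemma chain_rank_cong:
  assumes H: "pair_graph H" and q: "\<And>Q. clique H Q \<Longrightarrow> q Q = q' Q" and "peo H vs"
  shows "chain_rank H q vs = chain_rank H q' vs"
  using assms(3)
proof (induction vs)
  case (Cons w vs)
  have "clique H (insert w (nbrs H (set vs) w))" by (rule clique_insert_nbrs[OF H Cons.prems])
  moreover have "clique H (nbrs H (set vs) w)" using Cons.prems by simp
  ultimately show ?case using Cons q by simp
qed simp

lemma chain_rank_scale: "chain_rank H (\<lambda>Q. c * q Q) vs = c * chain_rank H q vs"
  by (induction vs) (auto simp: algebra_simps)

lemma chain_rank_nonneg: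
  assumes H: "pair_graph H" and q: "clique_polymatroid H q" and "peo H vs"
  shows "0 \<le> chain_rank H q vs"
  using assms(3)
proof (induction vs)
  case (Cons w vs)
  have "q (nbrs H (set vs) w) \<le> q (insert w (nbrs H (set vs) w))"
    by (rule clique_polymatroid_mono[OF q clique_insert_nbrs[OF H Cons.prems]]) blast
  then show ?case using Cons by simp
qed simp

lemma clique_image_hom:
  assumes "\<phi> \<in> homs H H'" "clique H Q"
  shows "clique H' (\<phi> ` Q)"
proof -
  have "\<phi> u \<in> pverts H'" if "u \<in> Q" for u using assms that by (auto simp: homs_def clique_def)
  moreover have "(\<phi> u, \<phi> v) \<in> parcs H'" if "u \<in> Q" "v \<in> Q" "\<phi> u \<noteq> \<phi> v" for u v
  proof -
    have "(u, v) \<in> parcs H" using assms(2) that by (auto simp: clique_def)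
    then show ?thesis using assms(1) by (auto simp: homs_def)
  qed
  ultimately show ?thesis unfolding clique_def by blast
qed

lemma identity_hom:
  assumes "pair_graph H"
  shows "restrict id (pverts H) \<in> homs H H"
  using pair_graph_verts[OF assms] by (auto simp: homs_def)

text \<open>For \<open>i = j\<close> and \<open>\<phi>\<close> the identity, the last condition
  turns the second one into an equality. Hence \<open>y i\<close> is the maximum of the pulled-back
  chain ranks over all \<open>j\<close> and \<open>\<phi>\<close>, the growth exponent expected for
  a disjoint union of blow-ups.\<close>

definition feasible :: "('n \<Rightarrow> 'a pair_pre_digraph) \<Rightarrow> ('n \<Rightarrow> 'a list) \<Rightarrow> ('n \<Rightarrow> real) \<Rightarrow> ('n \<Rightarrow> 'a set \<Rightarrow> real) \<Rightarrow> bool" where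
  "feasible H vs y p \<longleftrightarrow> (\<forall>j. clique_polymatroid (H j) (p j)) \<and>
     (\<forall>j. y j \<le> chain_rank (H j) (p j) (vs j)) \<and>
     (\<forall>i j. \<forall>\<phi> \<in> homs (H i) (H j). chain_rank (H i) (\<lambda>Q. p j (\<phi> ` Q)) (vs i) \<le> y i)"

lemma feasible_log_hom:
  assumes H: "\<And>i. pair_graph (H i)" and vs: "\<And>i. peo (H i) (vs i)" "\<And>i. set (vs i) = pverts (H i)"
    and G: "pair_graph G" and pos: "\<And>i. 0 < hom (H i) G"
  shows "feasible H vs (\<lambda>i. ln (hom (H i) G)) (\<lambda>j. ent (homs (H j) G))"
  unfolding feasible_def
proof (intro conjI allI ballI)
  fix j
  have fin: "finite (homs (H j) G)" by (rule finite_homs[OF H G])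
  have ne: "homs (H j) G \<noteq> {}" using pos[of j] by (auto simp: hom_def)
  show "clique_polymatroid (H j) (ent (homs (H j) G))"
    unfolding clique_polymatroid_def by (simp add: ent_mono[OF fin] ent_submodular[OF fin])
  have "ent (homs (H j) G) (set (vs j)) = ln (card (homs (H j) G))"
  proof (rule ent_determined[OF fin ne])
    fix f g assume fg: "f \<in> homs (H j) G" "g \<in> homs (H j) G" "\<And>u. u \<in> set (vs j) \<Longrightarrow> f u = g u"
    then show "f = g" unfolding vs(2) homs_def by (auto intro: PiE_ext)
  qed
  then show "ln (hom (H j) G) \<le> chain_rank (H j) (ent (homs (H j) G)) (vs j)"
    using ent_le_chain_rank[OF fin vs(1)[of j]] by (simp add: hom_def)
  show "chain_rank (H i) (\<lambda>Q. ent (homs (H j) G) (\<phi> ` Q)) (vs i) \<le> ln (hom (H i) G)"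
    if "\<phi> \<in> homs (H i) (H j)" for i \<phi>
    by (rule chain_rank_ent_le_hom[OF H vs H G that ne])
qed

lemma ratsys_cong:
  assumes "ratsys I P" "\<And>i. i \<in> I \<Longrightarrow> x i = x' i"
  shows "P x \<longleftrightarrow> P x'"
proof -
  obtain \<F> where F: "\<forall>F \<in> \<F>. ratlin I F" "P = (\<lambda>x. \<forall>F \<in> \<F>. 0 \<le> F x)"
    using assms(1) unfolding ratsys_def by blast
  have "F x = F x'" if "F \<in> \<F>" for F
  proof -
    obtain a where "F = (\<lambda>x. \<Sum>i\<in>I. a i * x i)" using F(1) \<open>F \<in> \<F>\<close> unfolding ratlin_def by blast
    then show ?thesis using assms(2) by simp
  qed
  then show ?thesis unfolding F(2) by (metis (no_types))
qed

lemma ratsys_scale: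
  assumes "ratsys I P" "P x" "0 \<le> c"
  shows "P (\<lambda>k. c * x k)"
proof -
  obtain \<F> where F: "\<forall>F \<in> \<F>. ratlin I F" "P = (\<lambda>x. \<forall>F \<in> \<F>. 0 \<le> F x)"
    using assms(1) unfolding ratsys_def by blast
  have "F (\<lambda>k. c * x k) = c * F x" if "F \<in> \<F>" for F
  proof -
    obtain a where "F = (\<lambda>x. \<Sum>i\<in>I. a i * x i)" using F(1) \<open>F \<in> \<F>\<close> unfolding ratlin_def by blast
    then show ?thesis by (simp add: sum_distrib_left mult_ac)
  qed
  moreover have "\<forall>F \<in> \<F>. 0 \<le> F x" using assms(2) by (simp only: F(2))
  ultimately have "\<forall>F \<in> \<F>. 0 \<le> F (\<lambda>k. c * x k)" using assms(3) by (metis mult_nonneg_nonneg)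
  then show ?thesis by (simp only: F(2))
qed

lemma ratlin_chain_rank:
  assumes "\<And>Q. Q \<subseteq> W \<Longrightarrow> ratlin I (\<lambda>x. q x Q)" "set vs \<subseteq> W"
  shows "ratlin I (\<lambda>x. chain_rank H (q x) vs)"
  using assms(2)
proof (induction vs)
  case (Cons w vs)
  have "insert w (nbrs H (set vs) w) \<subseteq> W" "nbrs H (set vs) w \<subseteq> W" using Cons.prems by (auto simp: nbrs_def)
  then show ?case using Cons by (simp add: ratlin_add ratlin_diff assms(1))
qed (simp add: ratlin_zero)

text \<open>There is a variable for every set of vertices, so linearity of the chain ranks requires
  only that the sets involved, and their images under \<open>\<phi>\<close>, consist of
  vertices.\<close>

definition rank_vars :: "('n \<Rightarrow> 'a pair_pre_digraph) \<Rightarrow> ('n + 'n \<times> 'a set) set" where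
  "rank_vars H = Inr ` (SIGMA j:UNIV. Pow (pverts (H j)))"

lemma ratsys_feasible:
  fixes H :: "'n::finite \<Rightarrow> 'a pair_pre_digraph"
  assumes H: "\<And>i. pair_graph (H i)" and vs: "\<And>i. peo (H i) (vs i)"
  shows "finite (rank_vars H)"
    "ratsys (rank_vars H \<union> range Inl) (\<lambda>x. feasible H vs (\<lambda>i. x (Inl i)) (\<lambda>j Q. x (Inr (j, Q))))"
proof -
  let ?I = "rank_vars H \<union> range Inl"
  note finV = pair_graph_finite[OF H]
  show fin: "finite (rank_vars H)" unfolding rank_vars_def using finV by (intro finite_imageI finite_SigmaI) auto
  then have finI: "finite ?I" by simp
  have y: "ratlin ?I (\<lambda>x. x (Inl i))" for i using finI by (rule ratlin_var) simp
  have p: "ratlin ?I (\<lambda>x. x (Inr (j, Q)))" if "Q \<subseteq> pverts (H j)" for j Q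
    using finI by (rule ratlin_var) (use that in \<open>auto simp: rank_vars_def\<close>)
  have poly: "ratsys ?I (\<lambda>x. clique_polymatroid (H j) (\<lambda>Q. x (Inr (j, Q))))" for j
  proof -
    let ?C = "{ST \<in> Pow (pverts (H j)) \<times> Pow (pverts (H j)). clique (H j) (fst ST \<union> snd ST)}"
    have eq: "clique_polymatroid (H j) (\<lambda>Q. x (Inr (j, Q))) \<longleftrightarrow>
      x (Inr (j, {})) \<le> 0 \<and> 0 \<le> x (Inr (j, {})) \<and> (\<forall>ST \<in> ?C.
        x (Inr (j, fst ST)) \<le> x (Inr (j, fst ST \<union> snd ST)) \<and>
        x (Inr (j, fst ST \<union> snd ST)) + x (Inr (j, fst ST \<inter> snd ST)) \<le> x (Inr (j, fst ST)) + x (Inr (j, snd ST)))"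
      for x :: "'n + 'n \<times> 'a set \<Rightarrow> real"
      unfolding clique_polymatroid_def by (auto simp: clique_def)
    show ?thesis
      unfolding eq
    proof (intro ratsys_conj ratsys_ball ratsys_le ratlin_add ratlin_zero p)
      show "finite ?C" using finV[of j] by simp
    qed auto
  qed
  have low: "ratsys ?I (\<lambda>x. x (Inl j) \<le> chain_rank (H j) (\<lambda>Q. x (Inr (j, Q))) (vs j))" for j
    by (rule ratsys_le[OF y ratlin_chain_rank[OF p peo_subset[OF vs]]])
  have up: "ratsys ?I (\<lambda>x. chain_rank (H i) (\<lambda>Q. x (Inr (j, \<phi> ` Q))) (vs i) \<le> x (Inl i))"
    if "\<phi> \<in> homs (H i) (H j)" for i j \<phi>
  proof (rule ratsys_le[OF ratlin_chain_rank[OF p peo_subset[OF vs]] y])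
    show "\<phi> ` Q \<subseteq> pverts (H j)" if "Q \<subseteq> pverts (H i)" for Q
      using \<open>\<phi> \<in> homs (H i) (H j)\<close> that by (auto simp: homs_def)
  qed
  have "ratsys ?I (\<lambda>x. (\<forall>j \<in> UNIV. clique_polymatroid (H j) (\<lambda>Q. x (Inr (j, Q)))) \<and>
     (\<forall>j \<in> UNIV. x (Inl j) \<le> chain_rank (H j) (\<lambda>Q. x (Inr (j, Q))) (vs j)) \<and>
     (\<forall>i \<in> UNIV. \<forall>j \<in> UNIV. \<forall>\<phi> \<in> homs (H i) (H j). chain_rank (H i) (\<lambda>Q. x (Inr (j, \<phi> ` Q))) (vs i) \<le> x (Inl i)))"
    by (intro ratsys_conj ratsys_ball poly low up finite finite_homs H)
  then show "ratsys ?I (\<lambda>x. feasible H vs (\<lambda>i. x (Inl i)) (\<lambda>j Q. x (Inr (j, Q))))"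
    by (simp add: feasible_def)
qed

definition rank_cone :: "('n::finite \<Rightarrow> 'a pair_pre_digraph) \<Rightarrow> ('n \<Rightarrow> 'a list) \<Rightarrow> (real ^ 'n) set" where
  "rank_cone H vs = {y. \<exists>p. feasible H vs (($) y) p}"

lemma rational_polyhedral_cone_rank_cone:
  fixes H :: "'n::finite \<Rightarrow> 'a pair_pre_digraph"
  assumes H: "\<And>i. pair_graph (H i)" and vs: "\<And>i. peo (H i) (vs i)"
  shows "rational_polyhedral_cone (rank_cone H vs)"
proof -
  let ?J = "rank_vars H" and ?P = "\<lambda>x. feasible H vs (\<lambda>i. x (Inl i)) (\<lambda>j Q. x (Inr (j, Q)))"
  note sys = ratsys_feasible[OF H vs]
  have disj: "range Inl \<inter> ?J = {}" by (auto simp: rank_vars_def)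
  have "(\<exists>z. ?P (\<lambda>k. if k \<in> ?J then z k else case_sum (($) y) (\<lambda>_. 0) k)) \<longleftrightarrow> y \<in> rank_cone H vs" for y
  proof
    assume "\<exists>z. ?P (\<lambda>k. if k \<in> ?J then z k else case_sum (($) y) (\<lambda>_. 0) k)"
    then obtain z where z: "?P (\<lambda>k. if k \<in> ?J then z k else case_sum (($) y) (\<lambda>_. 0) k)" by blast
    have nJ: "Inl i \<notin> ?J" for i using disj by blast
    show "y \<in> rank_cone H vs" using z unfolding rank_cone_def by (auto simp: nJ)
  next
    assume "y \<in> rank_cone H vs"
    then obtain p where p: "feasible H vs (($) y) p" by (auto simp: rank_cone_def)
    let ?x = "case_sum (($) y) (\<lambda>(j, Q). p j Q)"
    have "?P ?x" using p by simp
    moreover have "?P ?x \<longleftrightarrow> ?P (\<lambda>k. if k \<in> ?J then ?x k else case_sum (($) y) (\<lambda>_. 0) k)"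
      by (rule ratsys_cong[OF sys(2)]) auto
    ultimately show "\<exists>z. ?P (\<lambda>k. if k \<in> ?J then z k else case_sum (($) y) (\<lambda>_. 0) k)" by blast
  qed
  moreover have "rational_polyhedral_cone {y. \<exists>z. ?P (\<lambda>k. if k \<in> ?J then z k else case_sum (($) y) (\<lambda>_. 0) k)}"
    by (rule ratsys_rational_polyhedral_cone[OF ratsys_ex_many[OF _ sys(1) disj sys(2)]]) simp
  ultimately show ?thesis by simp
qed

lemma rational_polyhedral_cone_closed_convex:
  assumes "rational_polyhedral_cone C"
  shows "closed C" "convex_cone C"
proof -
  obtain A where A: "C = {x. \<forall>a \<in> A. 0 \<le> a \<bullet> x}"
    using assms by (auto simp: rational_polyhedral_cone_def)
  have "C = (\<Inter>a \<in> A. {x. a \<bullet> x \<ge> 0})" unfolding A by auto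
  then show "closed C" by (simp add: closed_INT closed_halfspace_ge)
  show "convex_cone C"
    unfolding convex_cone_iff A by (auto simp: inner_add_right)
qed

section \<open>Integral points as limits of homomorphism counts\<close>

lemma frequently_along_sequence:
  assumes "filterlim \<tau> F sequentially" "\<forall>\<^sub>F k in sequentially. Q (\<tau> k)"
  shows "\<exists>\<^sub>F t in F. Q t"
proof (rule ccontr)
  assume "\<not> ?thesis"
  then have "\<forall>\<^sub>F t in F. \<not> Q t" by (simp add: not_frequently)
  then have "\<forall>\<^sub>F k in sequentially. \<not> Q (\<tau> k)" using assms(1) unfolding filterlim_iff by blast
  with assms(2) have "\<forall>\<^sub>F k::nat in sequentially. False" by eventually_elim simp
  then show False by simp
qed

text \<open>The errors are of order \<open>ln k\<close> below and of order \<open>k\<close> above;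
  both are negligible against \<open>k ln k\<close>.\<close>

lemma hom_limit:
  fixes h :: "nat \<Rightarrow> real" and y a b c d :: real
  assumes h: "\<And>k. 2 \<le> k \<Longrightarrow> 0 < h k \<and> real k * y * ln (real k) - (a + b * ln (real k)) \<le> ln (h k) \<and>
      ln (h k) \<le> c + real k * y * (d + ln (real k))"
  shows "(\<lambda>k. ln (h k) / (real k * ln (real k))) \<longlonglongrightarrow> y"
proof (rule tendsto_sandwich)
  have ev: "\<forall>\<^sub>F k in sequentially. 2 \<le> k" by (rule eventually_ge_at_top)
  have pos: "0 < real k * ln (real k)" if "2 \<le> k" for k using that by simp
  show "\<forall>\<^sub>F k in sequentially. (real k * y * ln (real k) - (a + b * ln (real k))) / (real k * ln (real k)) \<le> ln (h k) / (real k * ln (real k))"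
    using ev by eventually_elim (use h pos in \<open>intro divide_right_mono; fastforce\<close>)
  show "\<forall>\<^sub>F k in sequentially. ln (h k) / (real k * ln (real k)) \<le> (c + real k * y * (d + ln (real k))) / (real k * ln (real k))"
    using ev by eventually_elim (use h pos in \<open>intro divide_right_mono; fastforce\<close>)
  show "(\<lambda>k. (real k * y * ln (real k) - (a + b * ln (real k))) / (real k * ln (real k))) \<longlonglongrightarrow> y"
  proof -
    have "(\<lambda>k. y - a * (1 / (real k * ln (real k))) - b * (1 / real k)) \<longlonglongrightarrow> y - a * 0 - b * 0"
      by (intro tendsto_intros) real_asymp+
    moreover have "\<forall>\<^sub>F k in sequentially. y - a * (1 / (real k * ln (real k))) - b * (1 / real k)
       = (real k * y * ln (real k) - (a + b * ln (real k))) / (real k * ln (real k))"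
      using ev by eventually_elim (use pos in \<open>simp add: field_simps\<close>)
    ultimately show ?thesis by (simp add: tendsto_cong)
  qed
  show "(\<lambda>k. (c + real k * y * (d + ln (real k))) / (real k * ln (real k))) \<longlonglongrightarrow> y"
  proof -
    have "(\<lambda>k. c * (1 / (real k * ln (real k))) + y * d * (1 / ln (real k)) + y) \<longlonglongrightarrow> c * 0 + y * d * 0 + y"
      by (intro tendsto_intros) real_asymp+
    moreover have "\<forall>\<^sub>F k in sequentially. c * (1 / (real k * ln (real k))) + y * d * (1 / ln (real k)) + y
       = (c + real k * y * (d + ln (real k))) / (real k * ln (real k))"
      using ev by eventually_elim (use pos in \<open>simp add: field_simps\<close>)
    ultimately show ?thesis by (simp add: tendsto_cong)
  qed
qed

lemma clique_polymatroid_cong: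
  assumes "\<And>Q. clique H Q \<Longrightarrow> q Q = q' Q"
  shows "clique_polymatroid H q \<longleftrightarrow> clique_polymatroid H q'"
proof -
  have "clique H {}" by (simp add: clique_def)
  moreover have "clique H S \<and> clique H T \<and> clique H (S \<inter> T)" if "clique H (S \<union> T)" for S T
    using clique_subset[OF that] by blast
  ultimately show ?thesis unfolding clique_polymatroid_def using assms by (metis (no_types, lifting))
qed

lemma clique_polymatroid_of_nat: "clique_polymatroid H (\<lambda>Q. real (q Q)) \<longleftrightarrow> clique_polymatroid H q"
  unfolding clique_polymatroid_def of_nat_add[symmetric] of_nat_le_iff by simp

lemma clique_polymatroid_mult:
  fixes q :: "'a set \<Rightarrow> nat"
  assumes "clique_polymatroid H q"
  shows "clique_polymatroid H (\<lambda>Q. k * q Q)"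
  using assms unfolding clique_polymatroid_def by (simp add: distrib_left[symmetric] del: distrib_left)

lemma feasible_cong:
  assumes H: "\<And>i. pair_graph (H i)" and vs: "\<And>i. peo (H i) (vs i)"
    and p: "\<And>j Q. clique (H j) Q \<Longrightarrow> p j Q = p' j Q" and f: "feasible H vs y p"
  shows "feasible H vs y p'"
  unfolding feasible_def
proof (intro conjI allI ballI)
  show "clique_polymatroid (H j) (p' j)" for j
    using f clique_polymatroid_cong[of "H j" "p j" "p' j"] p unfolding feasible_def by blast
  show "y j \<le> chain_rank (H j) (p' j) (vs j)" for j
  proof -
    have "chain_rank (H j) (p j) (vs j) = chain_rank (H j) (p' j) (vs j)"
      by (rule chain_rank_cong[OF H p vs])
    then show ?thesis using f unfolding feasible_def by metis
  qed
  fix i j \<phi> assume \<phi>: "\<phi> \<in> homs (H i) (H j)"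
  have "chain_rank (H i) (\<lambda>Q. p j (\<phi> ` Q)) (vs i) = chain_rank (H i) (\<lambda>Q. p' j (\<phi> ` Q)) (vs i)"
    by (rule chain_rank_cong[OF H _ vs]) (rule p[OF clique_image_hom[OF \<phi>]])
  then show "chain_rank (H i) (\<lambda>Q. p' j (\<phi> ` Q)) (vs i) \<le> y i"
    using f \<phi> unfolding feasible_def by metis
qed

lemma feasible_value:
  assumes H: "\<And>i. pair_graph (H i)" and vs: "\<And>i. peo (H i) (vs i)" and f: "feasible H vs y p"
  shows "0 \<le> y i"
proof -
  let ?id = "restrict id (pverts (H i))"
  have "?id ` Q = Q" if "clique (H i) Q" for Q using that by (auto simp: clique_def image_iff)
  then have "chain_rank (H i) (\<lambda>Q. p i (?id ` Q)) (vs i) = chain_rank (H i) (p i) (vs i)"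
    by (intro chain_rank_cong[OF H _ vs]) simp
  moreover have "chain_rank (H i) (\<lambda>Q. p i (?id ` Q)) (vs i) \<le> y i"
    using f identity_hom[OF H] unfolding feasible_def by blast
  moreover have "0 \<le> chain_rank (H i) (p i) (vs i)"
    by (rule chain_rank_nonneg[OF H _ vs]) (use f in \<open>simp add: feasible_def\<close>)
  ultimately show ?thesis by linarith
qed

text \<open>\<open>a i + b i * ln k\<close> bounds the logarithm of the number of level classes,
  \<open>c i\<close> is that of the number of homomorphisms from \<open>H i\<close> to all the
  \<open>H j\<close>, and \<open>d\<close> that of a common bound on the enlargement of the range by
  sums. None of them depends on \<open>k\<close>.\<close>

definition target_graph where
  "target_graph H y a b c d k G \<longleftrightarrow> pair_graph G \<and> (\<forall>i. 0 < hom (H i) G \<and>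
     real k * y i * ln (real k) - (a i + b i * ln (real k)) \<le> ln (hom (H i) G) \<and>
     ln (hom (H i) G) \<le> c i + real k * y i * (d + ln (real k)))"

text \<open>The graph is the union of blow-ups \<open>T j\<close> of \<open>H j\<close> for the
  ranks \<open>k * q j\<close> and the range \<open>k\<close>. The lower bound for
  \<open>H i\<close> needs \<open>T i\<close> alone. The upper bound sums over all \<open>j\<close>
  and \<open>\<phi>\<close>; feasibility bounds every exponent by \<open>k * y i\<close>, and
  \<open>y i \<ge> 0\<close> permits the common base \<open>M * k\<close>.\<close>

lemma target_graph_exists:
  fixes H :: "'n::finite \<Rightarrow> 'a pair_pre_digraph" and q :: "'n \<Rightarrow> 'a set \<Rightarrow> nat"
  assumes H: "\<And>i. pair_graph (H i)" and con: "\<And>i. Digraph_Component.connected (with_proj (H i))"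
    and vs: "\<And>i. peo (H i) (vs i)" "\<And>i. set (vs i) = pverts (H i)"
    and card3: "\<forall>i Q. clique (H i) Q \<longrightarrow> card Q \<le> 3"
    and f: "feasible H vs y (\<lambda>j Q. real (q j Q))"
  shows "\<exists>a b c d. \<forall>k\<ge>2. \<exists>G :: nat pair_pre_digraph. target_graph H y a b c d k G"
proof -
  have card3': "card Q \<le> 3" if "clique (H i) Q" for i Q using card3 that by blast
  define M where "M = (\<Sum>j\<in>UNIV. 2 ^ length (vs j) :: nat)"
  define P where "P = (\<Sum>j\<in>UNIV. \<Sum>u\<in>pverts (H j). q j {u})"
  define A where "A i = 8 * real P * (2 ^ length (vs i))\<^sup>2 + 1" for i
  define v where "v i = 3 * card (pverts (H i))" for i
  define D where "D i = (\<Sum>j\<in>UNIV. card (homs (H i) (H j)))" for i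
  have Mj: "2 ^ length (vs j) \<le> M" for j unfolding M_def by (rule member_le_sum) auto
  have M1: "1 \<le> M" using Mj one_le_power[of "2::nat"] by (metis le_trans one_le_numeral)
  have Pj: "q j {u} \<le> P" if "u \<in> pverts (H j)" for j u
  proof -
    have "q j {u} \<le> (\<Sum>u\<in>pverts (H j). q j {u})"
      using that pair_graph_finite[OF H] by (intro member_le_sum) auto
    also have "\<dots> \<le> P" unfolding P_def by (rule member_le_sum[where f = "\<lambda>j. \<Sum>u\<in>pverts (H j). q j {u}"]) auto
    finally show ?thesis .
  qed
  have A1: "1 \<le> A i" for i by (simp add: A_def)
  have poly: "clique_polymatroid (H j) (q j)" for j
    using f clique_polymatroid_of_nat unfolding feasible_def by blast
  have y0: "0 \<le> y i" for i by (rule feasible_value[OF H vs(1) f])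
  have "\<exists>G :: nat pair_pre_digraph. target_graph H y (\<lambda>i. real (v i) * ln (A i)) (\<lambda>i. 3 * real (v i))
    (\<lambda>i. ln (real (D i))) (ln (real M)) k G" if k: "2 \<le> k" for k
  proof -
    let ?N = "\<lambda>j. 2 ^ length (vs j) * k"
    let ?B = "\<lambda>j. (8 * (k * P) * (?N j)\<^sup>2 + 1) ^ v j"
    let ?prop = "\<lambda>j (T :: ('a \<times> ('a name \<Rightarrow> nat)) pair_pre_digraph). pair_graph T \<and>
      real k powr chain_rank (H j) (\<lambda>Q. real (k * q j Q)) (vs j) \<le> real (?B j) * real (hom (H j) T) \<and>
      (\<forall>(G :: 'a pair_pre_digraph) us. pair_graph G \<and> peo G us \<and> set us = pverts G \<longrightarrow>
        real (hom G T) \<le> (\<Sum>\<phi>\<in>homs G (H j). real (?N j) powr chain_rank G (\<lambda>Q. real (k * q j (\<phi> ` Q))) us))"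
    have "\<forall>j. \<exists>T. ?prop j T"
    proof
      fix j
      have "k * q j {u} \<le> k * P" if "u \<in> pverts (H j)" for u using Pj[OF that] by simp
      then show "\<exists>T. ?prop j T"
        unfolding v_def using k by (intro blowup_exists[OF H clique_polymatroid_mult[OF poly] vs card3']) simp_all
    qed
    from choice[OF this] obtain T where T: "\<forall>j. ?prop j (T j)" by (rule exE)
    have TG: "pair_graph (T j)" for j using T by blast
    obtain G :: "nat pair_pre_digraph" where G: "pair_graph G"
      and G_hom: "\<forall>F :: 'a pair_pre_digraph. pair_graph F \<and> Digraph_Component.connected (with_proj F) \<longrightarrow>
        (\<forall>j. hom F (T j) \<le> hom F G) \<and> hom F G \<le> (\<Sum>j\<in>UNIV. hom F (T j))"
      using disjoint_union_exists[where T = T, OF TG] by (elim exE conjE)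
    have homG: "hom (H i) (T j) \<le> hom (H i) G" "hom (H i) G \<le> (\<Sum>j\<in>UNIV. hom (H i) (T j))" for i j
      using G_hom H[of i] con[of i] by simp_all
    have main: "0 < hom (H i) G \<and>
      real k * y i * ln (real k) - (v i * ln (A i) + 3 * v i * ln (real k)) \<le> ln (hom (H i) G) \<and>
      ln (hom (H i) G) \<le> ln (D i) + real k * y i * (ln M + ln (real k))" for i
    proof (intro conjI)
      have kpos: "0 < real k" "1 \<le> real k" using k by simp_all
      have "real k * y i \<le> real k * chain_rank (H i) (\<lambda>Q. real (q i Q)) (vs i)"
        using f k by (intro mult_left_mono) (auto simp: feasible_def)
      then have "real k powr (real k * y i) \<le> real k powr chain_rank (H i) (\<lambda>Q. real (k * q i Q)) (vs i)"
        unfolding of_nat_mult chain_rank_scale using kpos by (intro powr_mono) auto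
      also have "\<dots> \<le> real (?B i) * real (hom (H i) (T i))" using T by blast
      also have "\<dots> \<le> real (?B i) * real (hom (H i) G)" using homG(1) by (intro mult_left_mono) auto
      finally have low: "real k powr (real k * y i) \<le> real (?B i) * real (hom (H i) G)" .
      have "0 < real k powr (real k * y i)" using kpos by simp
      with low have "0 < real (?B i) * real (hom (H i) G)" by linarith
      then have pos: "0 < real (hom (H i) G)" by (simp add: zero_less_mult_iff)
      then show "0 < hom (H i) G" by simp
      have B0: "0 < real (8 * (k * P) * (?N i)\<^sup>2 + 1)" by (simp only: of_nat_0_less_iff)
      then have Bpos: "0 < real (?B i)" by (simp only: of_nat_power zero_less_power)
      have "real k * y i * ln (real k) = ln (real k powr (real k * y i))" using kpos by (simp add: ln_powr)
      also have "\<dots> \<le> ln (real (?B i) * real (hom (H i) G))" using low kpos by (intro ln_mono) auto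
      also have "\<dots> = ln (real (?B i)) + ln (hom (H i) G)" using Bpos pos by (intro ln_mult_pos)
      also have "ln (real (?B i)) \<le> v i * (ln (A i) + 3 * ln (real k))"
      proof -
        \<comment> \<open>One factor \<open>k\<close> comes from the scaled rank bound
          \<open>k * P\<close>, two from the square of the range; the summand 1 is absorbed because
          \<open>1 \<le> k ^ 3\<close>.\<close>
        have "real (8 * (k * P) * (?N i)\<^sup>2 + 1) = (A i - 1) * real k ^ 3 + 1"
          by (simp add: A_def power_mult_distrib power2_eq_square power3_eq_cube)
        also have "\<dots> \<le> A i * real k ^ 3"
          using one_le_power[OF kpos(2), of 3] by (simp add: left_diff_distrib)
        finally have "ln (real (8 * (k * P) * (?N i)\<^sup>2 + 1)) \<le> ln (A i * real k ^ 3)"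
          using B0 by (intro ln_mono)
        also have "\<dots> = ln (A i) + 3 * ln (real k)"
          using A1[of i] kpos by (simp add: ln_mult_pos ln_realpow)
        finally have "v i * ln (real (8 * (k * P) * (?N i)\<^sup>2 + 1)) \<le> v i * (ln (A i) + 3 * ln (real k))"
          by (intro mult_left_mono) auto
        moreover have "ln (real (?B i)) = v i * ln (real (8 * (k * P) * (?N i)\<^sup>2 + 1))"
          unfolding of_nat_power by (rule ln_realpow)
        ultimately show ?thesis by simp
      qed
      finally show "real k * y i * ln (real k) - (v i * ln (A i) + 3 * v i * ln (real k)) \<le> ln (hom (H i) G)"
        by (simp add: distrib_left)
      have bound: "real (?N j) powr chain_rank (H i) (\<lambda>Q. real (k * q j (\<phi> ` Q))) (vs i) \<le> real (M * k) powr (real k * y i)"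
        if "\<phi> \<in> homs (H i) (H j)" for j \<phi>
      proof -
        have "1 \<le> ?N j" using k by (simp add: Suc_le_eq)
        from of_nat_mono[OF this, where 'a = real] have N1: "1 \<le> real (?N j)" by (simp only: of_nat_1)
        have N2: "real (?N j) \<le> real (M * k)"
          unfolding of_nat_le_iff by (rule mult_le_mono1[OF Mj])
        have "real k * chain_rank (H i) (\<lambda>Q. real (q j (\<phi> ` Q))) (vs i) \<le> real k * y i"
          using f that by (intro mult_left_mono) (auto simp: feasible_def)
        then have "real (?N j) powr chain_rank (H i) (\<lambda>Q. real (k * q j (\<phi> ` Q))) (vs i) \<le> real (?N j) powr (real k * y i)"
          unfolding of_nat_mult[of k] chain_rank_scale using N1 by (intro powr_mono) auto
        also have "\<dots> \<le> real (M * k) powr (real k * y i)"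
          using N1 N2 y0 by (intro powr_mono2) auto
        finally show ?thesis .
      qed
      have "real (hom (H i) G) \<le> (\<Sum>j\<in>UNIV. real (hom (H i) (T j)))"
        using homG(2)[of i] by (metis of_nat_le_iff of_nat_sum)
      also have "\<dots> \<le> (\<Sum>j\<in>UNIV. \<Sum>\<phi>\<in>homs (H i) (H j). real (?N j) powr chain_rank (H i) (\<lambda>Q. real (k * q j (\<phi> ` Q))) (vs i))"
        using T H vs by (intro sum_mono) blast
      also have "\<dots> \<le> (\<Sum>j\<in>UNIV. \<Sum>\<phi>\<in>homs (H i) (H j). real (M * k) powr (real k * y i))"
        by (intro sum_mono bound)
      also have "\<dots> = real (D i) * real (M * k) powr (real k * y i)"
        by (simp add: D_def sum_distrib_right)
      finally have up: "real (hom (H i) G) \<le> real (D i) * real (M * k) powr (real k * y i)" .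
      have MK: "0 < real (M * k)" using k M1 by simp
      have "0 < real (D i) * real (M * k) powr (real k * y i)" using pos up by linarith
      then have Dpos: "0 < real (D i)" by (simp add: zero_less_mult_iff)
      have "ln (hom (H i) G) \<le> ln (real (D i) * real (M * k) powr (real k * y i))" using up pos by (intro ln_mono)
      also have "\<dots> = ln (D i) + real k * y i * ln (real (M * k))"
      proof -
        have "0 < real (M * k) powr (real k * y i)" using MK by (simp only: powr_gt_zero)
        then have "ln (real (D i) * real (M * k) powr (real k * y i)) = ln (D i) + ln (real (M * k) powr (real k * y i))"
          using Dpos by (intro ln_mult_pos)
        then show ?thesis using MK by (simp only: ln_powr)
      qed
      also have "ln (real (M * k)) = ln M + ln (real k)"
        unfolding of_nat_mult using M1 kpos by (intro ln_mult_pos) auto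
      finally show "ln (hom (H i) G) \<le> ln (D i) + real k * y i * (ln M + ln (real k))" .
    qed
    then show ?thesis using G unfolding target_graph_def by auto
  qed
  then show ?thesis by blast
qed

text \<open>Since \<open>trop\<close> is an upper limit, graphs along one sequence of scales
  suffice.\<close>

lemma integer_point_in_trop:
  fixes H :: "'n::finite \<Rightarrow> 'a pair_pre_digraph" and q :: "'n \<Rightarrow> 'a set \<Rightarrow> nat" and y :: "real ^ 'n"
  assumes H: "\<And>i. pair_graph (H i)" and con: "\<And>i. Digraph_Component.connected (with_proj (H i))"
    and vs: "\<And>i. peo (H i) (vs i)" "\<And>i. set (vs i) = pverts (H i)"
    and card3: "\<forall>i Q. clique (H i) Q \<longrightarrow> card Q \<le> 3"
    and f: "feasible H vs (($) y) (\<lambda>j Q. real (q j Q))"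
  shows "y \<in> trop (number_profile H)"
proof -
  obtain a b c d where "\<forall>k\<ge>2. \<exists>G :: nat pair_pre_digraph. target_graph H (($) y) a b c d k G"
    using target_graph_exists[where H = H, OF H con vs card3 f] by (elim exE)
  then have "\<forall>k. \<exists>G :: nat pair_pre_digraph. 2 \<le> k \<longrightarrow> target_graph H (($) y) a b c d k G" by blast
  from choice[OF this] obtain G :: "nat \<Rightarrow> nat pair_pre_digraph" where
    G: "\<forall>k. 2 \<le> k \<longrightarrow> target_graph H (($) y) a b c d k (G k)" by (rule exE)
  define z where "z k = (\<chi> i. ln (real (hom (H i) (G k))))" for k
  have zlog: "z k \<in> log_set (number_profile H)" if "2 \<le> k" for k
  proof -
    have "(\<chi> i. real (hom (H i) (G k))) \<in> {x \<in> number_profile H. \<forall>i. 0 < x $ i}"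
      using G that unfolding number_profile_def target_graph_def by auto
    then show ?thesis unfolding log_set_def z_def by (intro image_eqI) auto
  qed
  \<comment> \<open>Chosen so that \<open>ln (\<tau> k)\<close> is the normalisation
    \<open>k * ln k\<close> of \<open>hom_limit\<close>.\<close>
  define \<tau> where "\<tau> k = exp (real k * ln (real k))" for k :: nat
  have lim: "(\<lambda>k. z k /\<^sub>R ln (\<tau> k)) \<longlonglongrightarrow> y"
  proof (rule vec_tendstoI)
    fix i
    have "(\<lambda>k. ln (real (hom (H i) (G k))) / (real k * ln (real k))) \<longlonglongrightarrow> y $ i"
      by (rule hom_limit[where a = "a i" and b = "b i" and c = "c i" and d = d]) (use G in \<open>simp add: target_graph_def\<close>)
    then show "(\<lambda>k. (z k /\<^sub>R ln (\<tau> k)) $ i) \<longlonglongrightarrow> y $ i"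
      by (simp add: z_def \<tau>_def divide_inverse mult.commute)
  qed
  have \<tau>: "filterlim \<tau> at_top sequentially" unfolding \<tau>_def by real_asymp
  show ?thesis
    unfolding trop_def
  proof (intro CollectI allI impI)
    fix e :: real assume "0 < e"
    have "\<forall>\<^sub>F k in sequentially. dist (z k /\<^sub>R ln (\<tau> k)) y < e" using lim \<open>0 < e\<close> by (rule tendstoD)
    then have "\<forall>\<^sub>F k in sequentially. \<exists>x \<in> log_set (number_profile H). dist (x /\<^sub>R ln (\<tau> k)) y < e"
      using eventually_ge_at_top[of 2] by eventually_elim (use zlog in blast)
    then show "\<exists>\<^sub>F t in at_top. \<exists>x \<in> log_set (number_profile H). dist (x /\<^sub>R ln t) y < e"
      by (rule frequently_along_sequence[OF \<tau>])
  qed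
qed

lemma trop_scale:
  fixes H :: "'n::finite \<Rightarrow> 'a pair_pre_digraph"
  assumes H: "\<And>i. pair_graph (H i)" and "y \<in> trop (number_profile H)" "0 \<le> c"
  shows "c *\<^sub>R y \<in> trop (number_profile H)"
proof -
  let ?K = "convex_cone hull (log_set (number_profile H))"
  have sub: "(*\<^sub>R) c ` ?K \<subseteq> ?K" using assms(3) by (auto intro: convex_cone_hull_mul)
  have "(*\<^sub>R) c ` closure ?K \<subseteq> closure ?K"
    unfolding closure_scaleR using sub by (rule closure_mono)
  then show ?thesis using assms(2) unfolding trop_number_profile[OF H] by blast
qed

text \<open>Rational density is applied to the full system, ranks included, so that one common
  denominator makes the polymatroids integral. Scaling back and passing to the limit are possible
  because \<open>trop\<close> is a closed cone.\<close>

lemma rank_cone_subset_trop: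
  fixes H :: "'n::finite \<Rightarrow> 'a pair_pre_digraph"
  assumes H: "\<And>i. pair_graph (H i)" and con: "\<And>i. Digraph_Component.connected (with_proj (H i))"
    and vs: "\<And>i. peo (H i) (vs i)" "\<And>i. set (vs i) = pverts (H i)"
    and card3: "\<forall>i Q. clique (H i) Q \<longrightarrow> card Q \<le> 3"
  shows "rank_cone H vs \<subseteq> trop (number_profile H)"
proof
  fix y assume "y \<in> rank_cone H vs"
  then obtain p where p: "feasible H vs (($) y) p" by (auto simp: rank_cone_def)
  let ?I = "rank_vars H \<union> range Inl" and ?P = "\<lambda>x. feasible H vs (\<lambda>i. x (Inl i)) (\<lambda>j Q. x (Inr (j, Q)))"
  let ?x = "case_sum (($) y) (\<lambda>(j, Q). p j Q)"
  note sys = ratsys_feasible[OF H vs(1)]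
  have finI: "finite ?I" using sys(1) by simp
  have "y \<in> closure (trop (number_profile H))"
    unfolding closure_approachable
  proof (intro allI impI)
    fix e :: real assume "0 < e"
    define e' where "e' = e / CARD('n)"
    have "0 < e'" using \<open>0 < e\<close> by (simp add: e'_def)
    moreover have "?P ?x" using p by simp
    ultimately obtain x where x: "?P x" "\<And>k. k \<in> ?I \<Longrightarrow> x k \<in> \<rat> \<and> \<bar>x k - ?x k\<bar> < e'"
      using ratsys_rational_dense[OF finI sys(2)] by blast
    obtain m :: nat where m: "0 < m" "\<And>k. k \<in> ?I \<Longrightarrow> real m * x k \<in> \<int>"
      using common_denominator[OF finI, of x] x(2) by blast
    define w :: "real ^ 'n" where "w = (\<chi> i. x (Inl i))"
    \<comment> \<open>Floor and truncation are exact on cliques, where the scaled ranks are integers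
      and nonnegative by monotonicity from the empty set. Agreement on cliques is enough for
      \<open>feasible_cong\<close>.\<close>
    define q where "q j Q = nat \<lfloor>real m * x (Inr (j, Q))\<rfloor>" for j Q
    have mf: "feasible H vs (\<lambda>i. real m * x (Inl i)) (\<lambda>j Q. real m * x (Inr (j, Q)))"
      using ratsys_scale[OF sys(2) x(1), of "real m"] by simp
    have "feasible H vs (\<lambda>i. real m * x (Inl i)) (\<lambda>j Q. real (q j Q))"
    proof (rule feasible_cong[OF H vs(1) _ mf])
      fix j Q assume Q: "clique (H j) Q"
      have poly: "clique_polymatroid (H j) (\<lambda>Q. real m * x (Inr (j, Q)))" using mf by (simp add: feasible_def)
      have "real m * x (Inr (j, {})) \<le> real m * x (Inr (j, Q))"
        by (rule clique_polymatroid_mono[OF poly Q]) simp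
      moreover have "real m * x (Inr (j, {})) = 0" using poly by (simp only: clique_polymatroid_def)
      ultimately have "0 \<le> real m * x (Inr (j, Q))" by linarith
      moreover have "real m * x (Inr (j, Q)) \<in> \<int>"
        by (rule m(2)) (use Q in \<open>auto simp: rank_vars_def clique_def\<close>)
      ultimately show "real m * x (Inr (j, Q)) = real (q j Q)" unfolding q_def by (simp add: of_nat_nat of_int_floor_cancel)
    qed
    moreover have "(\<lambda>i. real m * x (Inl i)) = ($) (real m *\<^sub>R w)" by (simp add: w_def fun_eq_iff)
    ultimately have "feasible H vs (($) (real m *\<^sub>R w)) (\<lambda>j Q. real (q j Q))" by (simp only:)
    then have "real m *\<^sub>R w \<in> trop (number_profile H)"
      by (rule integer_point_in_trop[where H = H, OF H con vs card3])
    then have "(1 / real m) *\<^sub>R (real m *\<^sub>R w) \<in> trop (number_profile H)" by (rule trop_scale[OF H]) simp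
    then have "w \<in> trop (number_profile H)" using m(1) by simp
    moreover have "dist w y < e"
    proof -
      have "dist w y \<le> (\<Sum>i\<in>UNIV. \<bar>(w - y) $ i\<bar>)" unfolding dist_norm by (rule norm_le_l1_cart)
      also have "\<dots> < (\<Sum>i\<in>(UNIV :: 'n set). e')"
      proof (rule sum_strict_mono)
        fix i :: 'n
        show "\<bar>(w - y) $ i\<bar> < e'" using x(2)[of "Inl i"] by (simp add: w_def)
      qed auto
      also have "\<dots> = e" by (simp add: e'_def)
      finally show ?thesis .
    qed
    ultimately show "\<exists>w \<in> trop (number_profile H). dist w y < e" by blast
  qed
  then show "y \<in> trop (number_profile H)" unfolding trop_number_profile[OF H] by simp
qed

theorem theorem3p2:
  fixes H :: "'n::finite \<Rightarrow> 'a pair_pre_digraph"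
  assumes "\<And>i. pair_graph (H i)"
    and "\<And>i. Digraph_Component.connected (with_proj (H i))"
    and "\<And>i. chordal (H i)"
    and "\<And>i. series_parallel (H i)"
  shows "rational_polyhedral_cone (trop (number_profile H))"
proof -
  have "\<forall>i. \<exists>us. peo (H i) us \<and> set us = pverts (H i)"
    using chordal_peo[OF assms(1,3)] by blast
  from choice[OF this] obtain vs where vs: "\<And>i. peo (H i) (vs i)" "\<And>i. set (vs i) = pverts (H i)" by blast
  have cone: "rational_polyhedral_cone (rank_cone H vs)"
    by (rule rational_polyhedral_cone_rank_cone[OF assms(1) vs(1)])
  have "log_set (number_profile H) \<subseteq> rank_cone H vs"
  proof
    fix y assume "y \<in> log_set (number_profile H)"
    then obtain G :: "nat pair_pre_digraph" where G: "pair_graph G" "\<And>i. 0 < hom (H i) G"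
      and y: "y = (\<chi> i. ln (real (hom (H i) G)))"
      unfolding log_set_def number_profile_def by auto
    have "($) y = (\<lambda>i. ln (real (hom (H i) G)))" by (simp add: y fun_eq_iff)
    then show "y \<in> rank_cone H vs"
      using feasible_log_hom[where H = H and vs = vs, OF assms(1) vs G] unfolding rank_cone_def by auto
  qed
  \<comment> \<open>As the closure of a conical hull, \<open>trop\<close> lies in every closed
    convex cone that contains the logarithmic points.\<close>
  then have "trop (number_profile H) \<subseteq> rank_cone H vs"
    unfolding trop_number_profile[OF assms(1)]
    by (intro closure_minimal hull_minimal rational_polyhedral_cone_closed_convex[OF cone])
  moreover have "\<forall>i Q. clique (H i) Q \<longrightarrow> card Q \<le> 3"
    using series_parallel_clique_card[OF assms(1,4)] by blast
  then have "rank_cone H vs \<subseteq> trop (number_profile H)"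
    by (rule rank_cone_subset_trop[OF assms(1,2) vs])
  ultimately have "trop (number_profile H) = rank_cone H vs" by (rule subset_antisym)
  then show ?thesis using cone by (simp only:)
qed

end
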